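(* Let $d\ge 1$ and $k\ge d$ be integers, and let $p=n^{\alpha}$ for a fixed real number $\alpha$. Let $G_d(n,p)$ denote the random $d$-dimensional simplicial complex on $[n]$ and $\Delta_d(G_d(n,p))$ its $d$-clique complex. (i) If $\alpha<\max\left\{\frac{-1}{k-d+1},\,-\frac{d+1}{\binom{k}{d}}\right\}$ or $\alpha>\frac{-1}{\binom{2k+2}{d}}$, then asymptotically almost surely $\tilde H_k(\Delta_d(G_d(n,p));\mathbb{Z})=0$. (ii) Suppose moreover $k\ge 1$, and let $t=\left(\frac{(d+1)(k+1)}{\binom{(d+1)(k+1)}{d+1}-(k+1)}\right)^{-1}$. If $\frac{-1}{t}<\alpha<\frac{-1}{t+1}$, then asymptotically almost surely $\tilde H_{(k+1)d-1}(\Delta_d(G_d(n,p));\mathbb{Z})\neq 0$.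
   Context: For $0\le p\le 1$, the random simplicial complex $G_d(n,p)$ is the $d$-dimensional simplicial complex on vertex set $[n]=\{1,\dots,n\}$ which contains the full $(d-1)$-dimensional skeleton of the simplex on $[n]$ and in which each $d$-dimensional face (i.e. each $(d+1)$-subset of $[n]$) is included independently with probability $p$. For a finite simplicial complex $X$ with vertex set $V(X)$, the $d$-clique complex $\Delta_d(X)$ is the simplicial complex on $V(X)$ whose faces are all subsets $F\subseteq V(X)$ such that every $(d+1)$-element subset of $F$ is a face of $X$ (so $\Delta_d(X)$ contains $X$ and the full $(d-1)$-skeleton on $V(X)$). An event depending on $n$ holds asymptotically almost surely (a.a.s.) if its probability tends to $1$ as $n\to\infty$. $\tilde H$ denotes reduced simplicial homology. *)

theory Defs
  imports "HOL-Probability.Probability" "HOL-Algebra.Free_Abelian_Groups"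
begin

section \<open>Reduced simplicial homology with integer coefficients\<close>

text \<open>An abstract simplicial complex is given by the set of its faces, including the empty face.\<close>

definition simplicial_complex_on :: "'a set \<Rightarrow> 'a set set \<Rightarrow> bool" where
  "simplicial_complex_on V K \<longleftrightarrow>
     finite V \<and> K \<subseteq> Pow V \<and> {} \<in> K \<and> (\<forall>v\<in>V. {v} \<in> K) \<and> (\<forall>F\<in>K. \<forall>G\<subseteq>F. G \<in> K)"

definition faces :: "nat \<Rightarrow> 'a set set \<Rightarrow> 'a set set" where
  "faces k K = {F \<in> K. card F = k + 1}"

definition simplicial_chain_group :: "nat \<Rightarrow> 'a set set \<Rightarrow> ('a set \<Rightarrow>\<^sub>0 int) monoid" where
  "simplicial_chain_group k K = free_Abelian_group (faces k K)"

text \<open>Faces are oriented by the order of the vertices: omitting the vertex of a face that has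
  \<open>i\<close> smaller vertices in this face contributes the sign \<open>(-1)\<^sup>i\<close>. A single vertex
  has boundary the empty face, so this is the augmented chain complex, and its homology
  is reduced homology.\<close>

definition simplicial_boundary :: "('a::linorder set \<Rightarrow>\<^sub>0 int) \<Rightarrow> ('a set \<Rightarrow>\<^sub>0 int)" where
  "simplicial_boundary =
     frag_extend (\<lambda>F. \<Sum>v\<in>F. frag_cmul ((-1) ^ card {u \<in> F. u < v}) (frag_of (F - {v})))"

definition simplicial_cycles :: "nat \<Rightarrow> 'a::linorder set set \<Rightarrow> ('a set \<Rightarrow>\<^sub>0 int) set" where
  "simplicial_cycles k K =
     {c \<in> carrier (simplicial_chain_group k K). simplicial_boundary c = 0}"

definition simplicial_boundaries :: "nat \<Rightarrow> 'a::linorder set set \<Rightarrow> ('a set \<Rightarrow>\<^sub>0 int) set" where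
  "simplicial_boundaries k K =
     simplicial_boundary ` carrier (simplicial_chain_group (k + 1) K)"

definition simplicial_cycle_group :: "nat \<Rightarrow> 'a::linorder set set \<Rightarrow> ('a set \<Rightarrow>\<^sub>0 int) monoid" where
  "simplicial_cycle_group k K =
     subgroup_generated (simplicial_chain_group k K) (simplicial_cycles k K)"

definition reduced_simplicial_homology ::
    "nat \<Rightarrow> 'a::linorder set set \<Rightarrow> ('a set \<Rightarrow>\<^sub>0 int) set monoid" where
  "reduced_simplicial_homology k K =
     simplicial_cycle_group k K Mod simplicial_boundaries k K"

lemma simplicial_boundary_0 [simp]: "simplicial_boundary 0 = 0"
  by (simp add: simplicial_boundary_def)

lemma simplicial_boundary_add:
  "simplicial_boundary (a + b) = simplicial_boundary a + simplicial_boundary b"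
  by (simp add: simplicial_boundary_def frag_extend_add)

lemma simplicial_boundary_minus:
  "simplicial_boundary (- a) = - simplicial_boundary a"
  by (simp add: simplicial_boundary_def frag_extend_minus)

lemma simplicial_boundary_diff:
  "simplicial_boundary (a - b) = simplicial_boundary a - simplicial_boundary b"
  by (simp add: simplicial_boundary_def frag_extend_diff)

lemma simplicial_boundary_cmul:
  "simplicial_boundary (frag_cmul n a) = frag_cmul n (simplicial_boundary a)"
  by (simp add: simplicial_boundary_def frag_extend_cmul)

lemma simplicial_boundary_of:
  "simplicial_boundary (frag_of F) =
     (\<Sum>v\<in>F. frag_cmul ((-1) ^ card {u \<in> F. u < v}) (frag_of (F - {v})))"
  by (simp add: simplicial_boundary_def)

lemma simplicial_boundary_sum:
  "finite I \<Longrightarrow> simplicial_boundary (sum f I) = (\<Sum>i\<in>I. simplicial_boundary (f i))"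
  by (simp add: simplicial_boundary_def frag_extend_sum o_def)

lemma sum_antisym_frag:
  fixes g :: "'a \<Rightarrow> 'a \<Rightarrow> 'b \<Rightarrow>\<^sub>0 int"
  assumes "finite F" "\<And>v w. v \<in> F \<Longrightarrow> w \<in> F \<Longrightarrow> v \<noteq> w \<Longrightarrow> g v w = - g w v"
  shows "(\<Sum>v\<in>F. \<Sum>w\<in>F - {v}. g v w) = 0"
proof -
  define h where "h v w = (if v = w then 0 else g v w)" for v w
  have *: "(\<Sum>v\<in>F. \<Sum>w\<in>F - {v}. g v w) = (\<Sum>v\<in>F. \<Sum>w\<in>F. h v w)"
    using assms(1) by (intro sum.cong refl sum.mono_neutral_cong_left) (auto simp: h_def)
  have "(\<Sum>v\<in>F. \<Sum>w\<in>F. h v w) = (\<Sum>w\<in>F. \<Sum>v\<in>F. h v w)"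
    by (rule sum.swap)
  also have "\<dots> = (\<Sum>w\<in>F. \<Sum>v\<in>F. - h w v)"
  proof (intro sum.cong refl)
    fix v w assume "v \<in> F" "w \<in> F"
    then show "h v w = - h w v"
      using assms(2)[of v w] by (cases "v = w") (simp_all add: h_def)
  qed
  also have "\<dots> = - (\<Sum>v\<in>F. \<Sum>w\<in>F. h v w)"
    by (simp add: sum_negf)
  finally have "s = - s" if "s = (\<Sum>v\<in>F. \<Sum>w\<in>F. h v w)" for s
    using that by simp
  moreover have "s = 0" if "s = - s" for s :: "'b \<Rightarrow>\<^sub>0 int"
  proof (rule poly_mapping_eqI)
    fix x
    have "Poly_Mapping.lookup s x = - Poly_Mapping.lookup s x"
      using that lookup_uminus[of s] by metis
    then show "Poly_Mapping.lookup s x = Poly_Mapping.lookup 0 x" by simp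
  qed
  ultimately show ?thesis
    unfolding * by blast
qed

lemma simplicial_boundary_boundary_of:
  assumes "finite F"
  shows "simplicial_boundary (simplicial_boundary (frag_of F)) = 0"
proof -
  define s :: "'a set \<Rightarrow> 'a \<Rightarrow> int" where "s F v = (-1) ^ card {u \<in> F. u < v}" for F v
  have s1: "s (F - {v}) w = s F w" if "w \<le> v" for v w
  proof -
    have "{u \<in> F - {v}. u < w} = {u \<in> F. u < w}" using that by auto
    then show ?thesis by (simp add: s_def)
  qed
  have s2: "s (F - {v}) w = - s F w" if "v < w" "v \<in> F" for v w
  proof -
    have eq: "{u \<in> F. u < w} = insert v {u \<in> F - {v}. u < w}" using that by auto
    have "finite {u \<in> F - {v}. u < w}" using assms by simp
    then show ?thesis unfolding s_def eq by (subst card_insert_disjoint) auto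
  qed
  have "simplicial_boundary (simplicial_boundary (frag_of F)) =
      (\<Sum>v\<in>F. \<Sum>w\<in>F - {v}. frag_cmul (s F v * s (F - {v}) w) (frag_of (F - {v} - {w})))"
    unfolding simplicial_boundary_of s_def
    using assms by (simp add: simplicial_boundary_sum simplicial_boundary_cmul
        simplicial_boundary_of frag_cmul_sum frag_cmul_cmul)
  also have "\<dots> = 0"
  proof (rule sum_antisym_frag[OF assms])
    fix v w assume vw: "v \<in> F" "w \<in> F" "v \<noteq> w"
    have "s F v * s (F - {v}) w = - (s F w * s (F - {w}) v)"
      using vw s1[of w v] s1[of v w] s2[of w v] s2[of v w] by (cases "v < w") auto
    moreover have "F - {v} - {w} = F - {w} - {v}" by auto
    ultimately show "frag_cmul (s F v * s (F - {v}) w) (frag_of (F - {v} - {w})) =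
       - frag_cmul (s F w * s (F - {w}) v) (frag_of (F - {w} - {v}))"
      by simp
  qed
  finally show ?thesis .
qed

lemma finite_faces: "F \<in> faces k K \<Longrightarrow> finite F"
  by (rule card_ge_0_finite) (simp add: faces_def)

lemma simplicial_boundary_boundary:
  assumes "Poly_Mapping.keys c \<subseteq> faces k K"
  shows "simplicial_boundary (simplicial_boundary c) = 0"
  using assms
proof (induction c rule: frag_induction)
  case (one F)
  then show ?case by (simp add: simplicial_boundary_boundary_of finite_faces)
next
  case (diff a b)
  then show ?case by (simp add: simplicial_boundary_diff)
qed simp

lemma keys_simplicial_boundary:
  assumes K: "simplicial_complex_on V K" and "Poly_Mapping.keys c \<subseteq> faces (k + 1) K"
  shows "Poly_Mapping.keys (simplicial_boundary c) \<subseteq> faces k K"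
  using assms(2)
proof (induction c rule: frag_induction)
  case (one F)
  then have F: "F \<in> K" "card F = k + 2" "finite F"
    using finite_faces[of F] by (auto simp: faces_def)
  have "F - {v} \<in> faces k K" if "v \<in> F" for v
  proof -
    have "F - {v} \<in> K"
      using K F(1) Diff_subset[of F "{v}"] unfolding simplicial_complex_on_def by metis
    then show ?thesis using that F by (simp add: faces_def)
  qed
  then have "Poly_Mapping.keys (frag_cmul ((-1) ^ card {u \<in> F. u < v}) (frag_of (F - {v}))) \<subseteq> faces k K"
    if "v \<in> F" for v
    using that by auto
  then show ?case
    unfolding simplicial_boundary_of by (intro order_trans[OF keys_sum]) blast
next
  case (diff a b)
  then show ?case
    unfolding simplicial_boundary_diff
    using keys_diff[of "simplicial_boundary a" "simplicial_boundary b"] by blast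
qed simp

lemma subgroup_simplicial_cycles:
  "subgroup (simplicial_cycles k K) (simplicial_chain_group k K)"
proof (rule group.subgroupI)
  fix a b assume ab: "a \<in> simplicial_cycles k K" "b \<in> simplicial_cycles k K"
  then show "a \<otimes>\<^bsub>simplicial_chain_group k K\<^esub> b \<in> simplicial_cycles k K"
    using keys_add[of a b]
    by (auto simp: simplicial_cycles_def simplicial_chain_group_def simplicial_boundary_add)
next
  have "0 \<in> simplicial_cycles k K"
    by (simp add: simplicial_cycles_def simplicial_chain_group_def)
  then show "simplicial_cycles k K \<noteq> {}" by blast
qed (auto simp: simplicial_cycles_def simplicial_chain_group_def simplicial_boundary_minus)

lemma subgroup_simplicial_boundaries:
  assumes "simplicial_complex_on V K"
  shows "subgroup (simplicial_boundaries k K) (simplicial_chain_group k K)"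
proof -
  have "group_hom (simplicial_chain_group (k + 1) K) (simplicial_chain_group k K) simplicial_boundary"
    using keys_simplicial_boundary[OF assms]
    by (auto simp: group_hom_def group_hom_axioms_def simplicial_chain_group_def hom_def
        simplicial_boundary_add)
  then show ?thesis
    unfolding simplicial_boundaries_def by (rule group_hom.img_is_subgroup)
qed

text \<open>Since the quotient is a group, \<open>\<not> trivial_group\<close> says that the homology is nonzero.\<close>

lemma group_reduced_simplicial_homology:
  assumes "simplicial_complex_on V K"
  shows "group (reduced_simplicial_homology k K)"
proof -
  have gr: "group (simplicial_chain_group k K)" "comm_group (simplicial_chain_group k K)"
    by (simp_all add: simplicial_chain_group_def abelian_free_Abelian_group)
  have "simplicial_boundaries k K \<subseteq> simplicial_cycles k K"
  proof
    fix x assume "x \<in> simplicial_boundaries k K"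
    then obtain c where "x = simplicial_boundary c" "Poly_Mapping.keys c \<subseteq> faces (k + 1) K"
      by (auto simp: simplicial_boundaries_def simplicial_chain_group_def)
    then show "x \<in> simplicial_cycles k K"
      using keys_simplicial_boundary[OF assms] simplicial_boundary_boundary[of c]
      by (simp add: simplicial_cycles_def simplicial_chain_group_def)
  qed
  then have "subgroup (simplicial_boundaries k K) (simplicial_cycle_group k K)"
    unfolding simplicial_cycle_group_def
    using group.subgroup_of_subgroup_generated[OF gr(1)] subgroup_simplicial_boundaries[OF assms]
    by blast
  moreover have "comm_group (simplicial_cycle_group k K)"
    unfolding simplicial_cycle_group_def
    by (rule group.abelian_subgroup_generated) (use gr in auto)
  ultimately show ?thesis
    unfolding reduced_simplicial_homology_def
    by (metis comm_group.normal_iff_subgroup normal.factorgroup_is_group)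
qed

section \<open>Clique complexes and random complexes\<close>

text \<open>The vertex set of \<open>K\<close> is \<open>\<Union>K\<close>.\<close>

definition clique_complex :: "nat \<Rightarrow> 'a set set \<Rightarrow> 'a set set" where
  "clique_complex d K = {F. F \<subseteq> \<Union>K \<and> (\<forall>S\<subseteq>F. card S = d + 1 \<longrightarrow> S \<in> K)}"

text \<open>Every \<open>(d+1)\<close>-subset of \<open>{1..n}\<close> carries an independent coin deciding whether it is a face.\<close>

definition random_complex :: "nat \<Rightarrow> nat \<Rightarrow> real \<Rightarrow> nat set set pmf" where
  "random_complex d n p =
     map_pmf (\<lambda>coin. {F. F \<subseteq> {1..n} \<and> card F \<le> d} \<union> {F. F \<subseteq> {1..n} \<and> card F = d + 1 \<and> coin F})
       (Pi_pmf {F. F \<subseteq> {1..n} \<and> card F = d + 1} False (\<lambda>_. bernoulli_pmf p))"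

definition asymptotically_almost_surely :: "(nat \<Rightarrow> 'a pmf) \<Rightarrow> ('a \<Rightarrow> bool) \<Rightarrow> bool" where
  "asymptotically_almost_surely M P \<longleftrightarrow>
     (\<lambda>n. measure_pmf.prob (M n) {x. P x}) \<longlonglongrightarrow> 1"

lemma simplicial_complex_random_complex:
  assumes "d \<ge> 1" "K \<in> set_pmf (random_complex d n p)"
  shows "simplicial_complex_on {1..n} K"
proof -
  from assms(2) obtain coin where K: "K = {F. F \<subseteq> {1..n} \<and> card F \<le> d} \<union>
      {F. F \<subseteq> {1..n} \<and> card F = d + 1 \<and> coin F}"
    by (auto simp: random_complex_def)
  have "G \<in> K" if "F \<in> K" "G \<subseteq> F" for F G
  proof (cases "G = F")
    case False
    have F: "F \<subseteq> {1..n}" "card F \<le> d + 1" using that K by auto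
    then have "card G < card F"
      using that False by (intro psubset_card_mono) (auto intro: finite_subset)
    then show ?thesis using F that K by auto
  qed (use that in simp)
  then show ?thesis
    using assms(1) unfolding simplicial_complex_on_def by (auto simp: K)
qed

lemma simplicial_complex_clique_complex:
  assumes "simplicial_complex_on V K" "d \<ge> 1"
  shows "simplicial_complex_on V (clique_complex d K)"
proof -
  have V: "\<Union>K = V" using assms(1) unfolding simplicial_complex_on_def by blast
  have "card S \<noteq> d + 1" if "S \<subseteq> {v}" for S :: "'a set" and v
    using card_mono[OF _ that] assms(2) by auto
  then show ?thesis
    using assms V unfolding simplicial_complex_on_def clique_complex_def
    by (auto dest: subset_trans)
qed

end

theory Submission
  imports Defs "HOL-Real_Asymp.Real_Asymp"
begin

text \<open>
Part (i) has three regimes. Below \<open>-(d+1)/(k choose d)\<close> a first moment computation shows that there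
are no \<open>k\<close>-faces. Below \<open>-1/(k-d+1)\<close>, take a non-bounding \<open>k\<close>-cycle with the fewest faces: it
is strongly connected, so each new vertex of its support brings \<open>k choose d\<close> new \<open>d\<close>-faces and
its support has bounded size; moreover it contains a vertex set \<open>S\<close> spanning at least \<open>(k-d+1) |S|\<close>
\<open>d\<close>-faces, which again is excluded by the first moment. For \<open>d \<ge> 2\<close> the latter follows by counting
faces at a vertex of a cycle, while for \<open>d = 1\<close> it uses that non-bounding cycles of flag complexes
have at least as many vertices as a cross-polytope. Above \<open>-1/(2k+2 choose d)\<close>, every \<open>2k+2\<close>
vertices can be coned off by a common neighbour, and iterated Mayer-Vietoris for the cover by vertex
stars gives the vanishing.

For part (ii), the second moment method produces copies of the join of \<open>k+1\<close> boundaries of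
\<open>d\<close>-simplices, a sphere of dimension \<open>(k+1)d-1\<close>. Most copies are induced and have a facet
contained in no larger face of the clique complex; the fundamental cycle of such a copy does not bound.
\<close>

section \<open>Boundary operators\<close>

text \<open>The first moment excludes only patterns of bounded size, so a cycle with large support
  has to be replaced by a bounded dense piece. Each vertex added while growing brings at least
  \<open>k - d + 1\<close> faces; the first \<open>k + 1\<close> vertices leave a fixed deficit,
  which a large enough piece absorbs. For small supports, density \<open>k - d + 1\<close> means
  average degree \<open>(d + 1) * (k - d + 1)\<close>. A vertex of a cycle has degree at least
  \<open>Suc k choose d\<close>, which suffices for d \<ge> 2; for d = 1 this is only
  \<open>k + 1\<close> where \<open>2 * k\<close> is wanted, whence the detour through flag
  complexes.

  The number \<open>2 * k + 2\<close> is the vertex budget of the Mayer-Vietoris induction: two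
  vertices for each of the \<open>k + 1\<close> vertices of a \<open>k\<close>-face.

  In part (ii), \<open>t\<close> is the number of \<open>d\<close>-faces per vertex of the join. The
  lower bound on \<alpha> makes the expected number of copies grow; regularity yields the same for
  every induced part of a copy, which keeps the variance small. The upper bound makes it unlikely
  that an outside vertex extends a given facet: this takes \<open>(d * r) choose d\<close> further
  faces, where \<open>r = k + 1\<close>, and that number is at least \<open>t + 1\<close>.\<close>

definition vsign :: "'a::linorder set \<Rightarrow> 'a \<Rightarrow> int" where
  "vsign F v = (-1) ^ card {u \<in> F. u < v}"

text \<open>A partial boundary: only vertices of \<open>U\<close> are deleted, with the signs of the
  full boundary. \<open>U = UNIV\<close> gives the ordinary boundary; taking the blocks of a join
  for \<open>U\<close> produces its fundamental cycle.\<close>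

definition bd_in :: "'a::linorder set \<Rightarrow> ('a set \<Rightarrow>\<^sub>0 int) \<Rightarrow> ('a set \<Rightarrow>\<^sub>0 int)" where
  "bd_in U = frag_extend (\<lambda>F. \<Sum>v\<in>F \<inter> U. frag_cmul (vsign F v) (frag_of (F - {v})))"

text \<open>Only smaller vertices enter the sign, so \<open>vsign F v\<close> is also the sign of
  \<open>v\<close> in \<open>insert v F\<close>; deleting \<open>v\<close> again returns
  \<open>F\<close> with coefficient 1.\<close>

definition cone_over :: "'a::linorder \<Rightarrow> ('a set \<Rightarrow>\<^sub>0 int) \<Rightarrow> ('a set \<Rightarrow>\<^sub>0 int)" where
  "cone_over v = frag_extend (\<lambda>F. if v \<in> F then 0 else frag_cmul (vsign F v) (frag_of (insert v F)))"

lemma simplicial_boundary_eq_bd_in: "simplicial_boundary = bd_in UNIV"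
  by (simp add: simplicial_boundary_def bd_in_def vsign_def)

lemma vsign_square [simp]: "vsign F v * vsign F v = 1"
  by (simp add: vsign_def flip: power_add)

lemma vsign_nonzero [simp]: "vsign F v \<noteq> 0"
  by (simp add: vsign_def)

lemma vsign_Diff:
  assumes "finite F" "v \<in> F"
  shows "vsign (F - {v}) w = (if v < w then - vsign F w else vsign F w)"
proof (cases "v < w")
  case True
  have eq: "{u \<in> F. u < w} = insert v {u \<in> F - {v}. u < w}" using True assms by auto
  have "finite {u \<in> F - {v}. u < w}" using assms by simp
  then show ?thesis using True unfolding vsign_def eq by (subst card_insert_disjoint) auto
next
  case False
  have "{u \<in> F - {v}. u < w} = {u \<in> F. u < w}" using False by auto
  then show ?thesis using False by (simp add: vsign_def)
qed

lemma vsign_insert: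
  assumes "finite F" "v \<notin> F"
  shows "vsign (insert v F) w = (if v < w then - vsign F w else vsign F w)"
  using vsign_Diff[of "insert v F" v w] assms by (simp split: if_splits)

lemma bd_in_0 [simp]: "bd_in U 0 = 0"
  by (simp add: bd_in_def)
lemma bd_in_add: "bd_in U (a + b) = bd_in U a + bd_in U b"
  by (simp add: bd_in_def frag_extend_add)
lemma bd_in_diff: "bd_in U (a - b) = bd_in U a - bd_in U b"
  by (simp add: bd_in_def frag_extend_diff)
lemma bd_in_cmul: "bd_in U (frag_cmul n a) = frag_cmul n (bd_in U a)"
  by (simp add: bd_in_def frag_extend_cmul)
lemma bd_in_sum: "finite I \<Longrightarrow> bd_in U (sum f I) = (\<Sum>i\<in>I. bd_in U (f i))"
  by (simp add: bd_in_def frag_extend_sum o_def)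
lemma bd_in_of:
  "bd_in U (frag_of F) = (\<Sum>v\<in>F \<inter> U. frag_cmul (vsign F v) (frag_of (F - {v})))"
  by (simp add: bd_in_def)

lemma cone_over_0 [simp]: "cone_over v 0 = 0"
  by (simp add: cone_over_def)
lemma cone_over_diff: "cone_over v (a - b) = cone_over v a - cone_over v b"
  by (simp add: cone_over_def frag_extend_diff)
lemma cone_over_cmul: "cone_over v (frag_cmul n a) = frag_cmul n (cone_over v a)"
  by (simp add: cone_over_def frag_extend_cmul)
lemma cone_over_sum: "finite I \<Longrightarrow> cone_over v (sum f I) = (\<Sum>i\<in>I. cone_over v (f i))"
  by (simp add: cone_over_def frag_extend_sum o_def)
lemma cone_over_of:
  "cone_over v (frag_of F) = (if v \<in> F then 0 else frag_cmul (vsign F v) (frag_of (insert v F)))"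
  by (simp add: cone_over_def)

lemma keys_bd_in:
  "Poly_Mapping.keys (bd_in U c) \<subseteq> {F - {v} |F v. F \<in> Poly_Mapping.keys c \<and> v \<in> F \<inter> U}"
proof -
  have "Poly_Mapping.keys (\<Sum>v\<in>F \<inter> U. frag_cmul (vsign F v) (frag_of (F - {v})))
      \<subseteq> (\<Union>v\<in>F \<inter> U. {F - {v}})" for F :: "'a set"
    by (intro order_trans[OF keys_sum]) auto
  then show ?thesis
    unfolding bd_in_def by (intro order_trans[OF keys_frag_extend]) blast
qed

lemma keys_cone_over:
  "Poly_Mapping.keys (cone_over v c) \<subseteq> insert v ` {F \<in> Poly_Mapping.keys c. v \<notin> F}"
  unfolding cone_over_def by (intro order_trans[OF keys_frag_extend]) (auto split: if_splits)

text \<open>The case \<open>U = UNIV\<close> says that a cone is acyclic.\<close>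

lemma bd_in_cone_over:
  assumes "\<And>F. F \<in> Poly_Mapping.keys c \<Longrightarrow> finite F"
  shows "bd_in U (cone_over u c) + cone_over u (bd_in U c) = (if u \<in> U then c else 0)"
proof -
  have "Poly_Mapping.keys c \<subseteq> Collect finite" using assms by auto
  then show ?thesis
  proof (induction c rule: frag_induction)
    case (one F)
    then have F: "finite F" by simp
    show ?case
    proof (cases "u \<in> F")
      case True
      have "cone_over u (bd_in U (frag_of F)) =
          (\<Sum>v\<in>F \<inter> U. if v = u then frag_of F else 0)"
        unfolding bd_in_of cone_over_sum[OF finite_Int[OF disjI1[OF F]]]
      proof (rule sum.cong[OF refl])
        fix v assume "v \<in> F \<inter> U"
        then show "cone_over u (frag_cmul (vsign F v) (frag_of (F - {v}))) = (if v = u then frag_of F else 0)"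
          using F True by (auto simp: cone_over_cmul cone_over_of vsign_Diff insert_absorb)
      qed
      then show ?thesis using True F by (simp add: cone_over_of)
    next
      case False
      have 1: "bd_in U (cone_over u (frag_of F)) =
        (\<Sum>v\<in>insert u F \<inter> U. frag_cmul (vsign F u * vsign (insert u F) v) (frag_of (insert u F - {v})))"
        using False by (simp add: cone_over_of bd_in_cmul bd_in_of frag_cmul_sum)
      have 2: "cone_over u (bd_in U (frag_of F)) =
        (\<Sum>v\<in>F \<inter> U. frag_cmul (vsign F v * vsign (F - {v}) u) (frag_of (insert u (F - {v}))))"
        using False F by (simp add: bd_in_of cone_over_sum cone_over_cmul cone_over_of)
      \<comment> \<open>Termwise cancellation: inserting \<open>u\<close> flips the sign of
        \<open>v\<close> if \<open>u < v\<close>, deleting \<open>v\<close> flips the sign of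
        \<open>u\<close> if \<open>v < u\<close>, and exactly one of the two happens.\<close>
      have 3: "(\<Sum>v\<in>F \<inter> U. frag_cmul (vsign F u * vsign (insert u F) v) (frag_of (insert u F - {v})))
         + (\<Sum>v\<in>F \<inter> U. frag_cmul (vsign F v * vsign (F - {v}) u) (frag_of (insert u (F - {v})))) = 0"
        unfolding sum.distrib[symmetric]
      proof (intro sum.neutral ballI)
        fix v assume v: "v \<in> F \<inter> U"
        then have "insert u F - {v} = insert u (F - {v})" "u \<noteq> v" using False by auto
        then show "frag_cmul (vsign F u * vsign (insert u F) v) (frag_of (insert u F - {v})) +
          frag_cmul (vsign F v * vsign (F - {v}) u) (frag_of (insert u (F - {v}))) = 0"
          using v F False
          by (cases "u < v") (auto simp: vsign_insert vsign_Diff simp flip: frag_cmul_distrib)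
      qed
      show ?thesis
      proof (cases "u \<in> U")
        case True
        then have "insert u F \<inter> U = insert u (F \<inter> U)" by auto
        then show ?thesis using 3 F False True
          by (simp add: 1 2 vsign_insert add.assoc)
      next
        case nU: False
        then have "insert u F \<inter> U = F \<inter> U" by auto
        then show ?thesis using 3 nU by (simp add: 1 2)
      qed
    qed
  next
    case (diff a b)
    have "bd_in U (cone_over u (a - b)) + cone_over u (bd_in U (a - b)) =
        (bd_in U (cone_over u a) + cone_over u (bd_in U a)) -
        (bd_in U (cone_over u b) + cone_over u (bd_in U b))"
      by (simp add: bd_in_diff cone_over_diff)
    then show ?case using diff by simp
  qed simp
qed

lemma bd_in_bd_in:
  assumes "\<And>F. F \<in> Poly_Mapping.keys c \<Longrightarrow> finite F"
  shows "bd_in U (bd_in U c) = 0"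
proof -
  have "Poly_Mapping.keys c \<subseteq> Collect finite" using assms by auto
  then show ?thesis
  proof (induction c rule: frag_induction)
    case (one F)
    then have F: "finite F" by simp
    have "bd_in U (bd_in U (frag_of F)) =
      (\<Sum>v\<in>F \<inter> U. \<Sum>w\<in>F \<inter> U - {v}. frag_cmul (vsign F v * vsign (F - {v}) w) (frag_of (F - {v} - {w})))"
      unfolding bd_in_of using F
      by (simp add: bd_in_sum bd_in_cmul bd_in_of frag_cmul_sum Int_Diff[symmetric] Diff_Int_distrib2)
    also have "\<dots> = 0"
    proof (rule sum_antisym_frag)
      fix v w assume vw: "v \<in> F \<inter> U" "w \<in> F \<inter> U" "v \<noteq> w"
      have "vsign F v * vsign (F - {v}) w = - (vsign F w * vsign (F - {w}) v)"
        using vw F by (cases "v < w") (auto simp: vsign_Diff)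
      moreover have "F - {v} - {w} = F - {w} - {v}" by auto
      ultimately show "frag_cmul (vsign F v * vsign (F - {v}) w) (frag_of (F - {v} - {w})) =
         - frag_cmul (vsign F w * vsign (F - {w}) v) (frag_of (F - {w} - {v}))"
        by simp
    qed (use F in simp)
    finally show ?case .
  next
    case (diff a b)
    then show ?case by (simp add: bd_in_diff)
  qed simp
qed

lemma bd_in_Un:
  assumes "\<And>F. F \<in> Poly_Mapping.keys c \<Longrightarrow> finite F" "U \<inter> W = {}"
  shows "bd_in (U \<union> W) c = bd_in U c + bd_in W c"
proof -
  have "Poly_Mapping.keys c \<subseteq> Collect finite" using assms by auto
  then show ?thesis
  proof (induction c rule: frag_induction)
    case (one F)
    then show ?case using assms(2)
      by (auto simp: bd_in_of Int_Un_distrib intro!: sum.union_disjoint)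
  next
    case (diff a b)
    then show ?case by (simp add: bd_in_diff)
  qed simp
qed

lemma bd_in_cong:
  assumes "\<And>F. F \<in> Poly_Mapping.keys c \<Longrightarrow> F \<inter> U = F \<inter> W"
  shows "bd_in U c = bd_in W c"
  unfolding bd_in_def by (rule frag_extend_eq) (use assms in auto)

text \<open>Expanding the vanishing square of the partial boundary for \<open>U \<union> W\<close>
  leaves only the mixed terms. Hence processing a further block preserves the vanishing already
  achieved for earlier ones.\<close>

lemma bd_in_anticommute:
  assumes fin: "\<And>F. F \<in> Poly_Mapping.keys c \<Longrightarrow> finite F" and "U \<inter> W = {}"
  shows "bd_in U (bd_in W c) = - bd_in W (bd_in U c)"
proof -
  have fin': "\<And>F. F \<in> Poly_Mapping.keys (bd_in X c) \<Longrightarrow> finite F" for X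
    using keys_bd_in[of X c] fin by fastforce
  have "0 = bd_in (U \<union> W) (bd_in (U \<union> W) c)"
    using bd_in_bd_in[OF fin] by simp
  also have "\<dots> = bd_in U (bd_in U c) + bd_in W (bd_in U c) + (bd_in U (bd_in W c) + bd_in W (bd_in W c))"
    using fin fin' assms(2) by (simp add: bd_in_Un bd_in_add)
  also have "\<dots> = bd_in W (bd_in U c) + bd_in U (bd_in W c)"
    using bd_in_bd_in[OF fin] by simp
  finally show ?thesis
    by (metis add.commute eq_neg_iff_add_eq_0)
qed

text \<open>When \<open>F\<close> is the only face of the support that yields
  \<open>F - {v}\<close>, no other term can cancel this coefficient. Splitting off the term of
  \<open>c\<close> at \<open>F\<close> makes this precise.\<close>

lemma in_keys_bd_in:
  assumes F: "F \<in> Poly_Mapping.keys c" "finite F" "v \<in> F \<inter> U"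
    and uniq: "\<And>G w. G \<in> Poly_Mapping.keys c \<Longrightarrow> w \<in> G \<inter> U \<Longrightarrow> G - {w} = F - {v} \<Longrightarrow> G = F"
  shows "F - {v} \<in> Poly_Mapping.keys (bd_in U c)"
proof -
  let ?n = "Poly_Mapping.lookup c F"
  define r where "r = c - frag_cmul ?n (frag_of F)"
  have keys_r: "Poly_Mapping.keys r \<subseteq> Poly_Mapping.keys c - {F}"
    by (auto simp: r_def in_keys_iff lookup_minus split: if_splits)
  have "F - {v} \<notin> Poly_Mapping.keys (bd_in U r)"
    using keys_bd_in[of U r] keys_r uniq by fastforce
  then have 1: "Poly_Mapping.lookup (bd_in U r) (F - {v}) = 0"
    by (simp add: in_keys_iff)
  have "F - {w} \<noteq> F - {v}" if "w \<in> F \<inter> U" "w \<noteq> v" for w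
    using that F(3) by auto
  then have "Poly_Mapping.lookup (bd_in U (frag_of F)) (F - {v}) =
      (\<Sum>w\<in>F \<inter> U. if w = v then vsign F v else 0)"
    using F unfolding bd_in_of lookup_sum
    by (intro sum.cong) (auto simp: lookup_single when_def)
  then have 2: "Poly_Mapping.lookup (bd_in U (frag_of F)) (F - {v}) = vsign F v"
    using F by simp
  have "c = r + frag_cmul ?n (frag_of F)" by (simp add: r_def)
  then have "bd_in U c = bd_in U r + frag_cmul ?n (bd_in U (frag_of F))"
    by (metis bd_in_add bd_in_cmul)
  then have "Poly_Mapping.lookup (bd_in U c) (F - {v}) = ?n * vsign F v"
    using 1 2 by (simp add: lookup_add)
  then show ?thesis using F(1) by (simp add: in_keys_iff)
qed

section \<open>Acyclicity in a fixed degree\<close>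

text \<open>Chains are indexed by the cardinality of the faces, so that \<open>acyclic_at j\<close> concerns
  reduced homology in degree \<open>j - 1\<close>.\<close>

definition face_chains :: "nat \<Rightarrow> 'a set set \<Rightarrow> ('a set \<Rightarrow>\<^sub>0 int) set" where
  "face_chains j K = {c. \<forall>F\<in>Poly_Mapping.keys c. F \<in> K \<and> finite F \<and> card F = j}"

definition acyclic_at :: "nat \<Rightarrow> 'a::linorder set set \<Rightarrow> bool" where
  "acyclic_at j K \<longleftrightarrow>
     (\<forall>c\<in>face_chains j K. bd_in UNIV c = 0 \<longrightarrow> (\<exists>b\<in>face_chains (Suc j) K. bd_in UNIV b = c))"

definition down_closed :: "'a set set \<Rightarrow> bool" where
  "down_closed K \<longleftrightarrow> (\<forall>F\<in>K. \<forall>G\<subseteq>F. G \<in> K)"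

lemma face_chains_mono: "K \<subseteq> L \<Longrightarrow> face_chains j K \<subseteq> face_chains j L"
  by (auto simp: face_chains_def)

lemma face_chains_add: "a \<in> face_chains j K \<Longrightarrow> b \<in> face_chains j K \<Longrightarrow> a + b \<in> face_chains j K"
  using keys_add[of a b] by (auto simp: face_chains_def)

lemma face_chains_diff: "a \<in> face_chains j K \<Longrightarrow> b \<in> face_chains j K \<Longrightarrow> a - b \<in> face_chains j K"
  using keys_diff[of a b] by (auto simp: face_chains_def)

lemma face_chains_bd_in:
  assumes "down_closed K" "c \<in> face_chains (Suc j) K"
  shows "bd_in U c \<in> face_chains j K"
proof -
  have "F - {v} \<in> K \<and> finite (F - {v}) \<and> card (F - {v}) = j"
    if "F \<in> Poly_Mapping.keys c" "v \<in> F" for F v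
    using that assms by (fastforce simp: face_chains_def down_closed_def)
  then show ?thesis
    using keys_bd_in[of U c] unfolding face_chains_def by fastforce
qed

text \<open>The cone over a cycle is a chain that it bounds. The condition concerns faces with
  exactly \<open>j\<close> vertices only, so the lemma also covers complexes that have no such
  face.\<close>

lemma acyclic_at_cone:
  assumes "\<And>F. F \<in> K \<Longrightarrow> finite F \<Longrightarrow> card F = j \<Longrightarrow> insert u F \<in> K"
  shows "acyclic_at j K"
  unfolding acyclic_at_def
proof (intro ballI impI)
  fix c assume c: "c \<in> face_chains j K" "bd_in UNIV c = 0"
  have "bd_in UNIV (cone_over u c) = c"
    using bd_in_cone_over[of c UNIV u] c by (auto simp: face_chains_def)
  moreover have "cone_over u c \<in> face_chains (Suc j) K"
    unfolding face_chains_def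
  proof (intro CollectI ballI)
    fix G assume "G \<in> Poly_Mapping.keys (cone_over u c)"
    then obtain F where "F \<in> Poly_Mapping.keys c" "u \<notin> F" "G = insert u F"
      using keys_cone_over[of u c] by blast
    then show "G \<in> K \<and> finite G \<and> card G = Suc j"
      using c(1) assms by (auto simp: face_chains_def)
  qed
  ultimately show "\<exists>b\<in>face_chains (Suc j) K. bd_in UNIV b = c" by blast
qed

text \<open>The relevant piece of the Mayer-Vietoris sequence, on chains: split a cycle as
  \<open>a + b\<close>, fill the common boundary by some \<open>w\<close> in the intersection, and
  fill the cycles \<open>a - w\<close> and \<open>b + w\<close> separately.\<close>

lemma acyclic_at_Un:
  assumes A: "down_closed A" "acyclic_at (Suc j) A" and B: "down_closed B" "acyclic_at (Suc j) B"
    and AB: "acyclic_at j (A \<inter> B)"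
  shows "acyclic_at (Suc j) (A \<union> B)"
  unfolding acyclic_at_def
proof (intro ballI impI)
  fix c assume c: "c \<in> face_chains (Suc j) (A \<union> B)" "bd_in UNIV c = 0"
  have "Poly_Mapping.keys c \<subseteq> {F \<in> A. finite F \<and> card F = Suc j} \<union> {F \<in> B. finite F \<and> card F = Suc j}"
    using c(1) by (auto simp: face_chains_def)
  from frag_split[OF this] obtain a b where
    ab: "Poly_Mapping.keys a \<subseteq> {F \<in> A. finite F \<and> card F = Suc j}"
        "Poly_Mapping.keys b \<subseteq> {F \<in> B. finite F \<and> card F = Suc j}" "a + b = c"
    by blast
  then have a: "a \<in> face_chains (Suc j) A" and b: "b \<in> face_chains (Suc j) B"
    by (auto simp: face_chains_def)
  have eq: "bd_in UNIV a = - bd_in UNIV b"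
    using c(2) ab(3) by (metis add_eq_0_iff bd_in_add minus_equation_iff)
  then have "Poly_Mapping.keys (bd_in UNIV a) = Poly_Mapping.keys (bd_in UNIV b)"
    by simp
  then have "bd_in UNIV a \<in> face_chains j (A \<inter> B)"
    using face_chains_bd_in[OF A(1) a] face_chains_bd_in[OF B(1) b] by (auto simp: face_chains_def)
  moreover have "bd_in UNIV (bd_in UNIV a) = 0"
    using a by (intro bd_in_bd_in) (auto simp: face_chains_def)
  ultimately obtain w where w: "w \<in> face_chains (Suc j) (A \<inter> B)" "bd_in UNIV w = bd_in UNIV a"
    using AB unfolding acyclic_at_def by blast
  have "w \<in> face_chains (Suc j) A" "w \<in> face_chains (Suc j) B"
    using w(1) by (auto simp: face_chains_def)
  then have "a - w \<in> face_chains (Suc j) A" "b + w \<in> face_chains (Suc j) B"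
    using a b by (auto intro: face_chains_add face_chains_diff)
  moreover have "bd_in UNIV (a - w) = 0" "bd_in UNIV (b + w) = 0"
    using w(2) eq by (simp_all add: bd_in_add bd_in_diff)
  ultimately obtain a' b' where
    "a' \<in> face_chains (Suc (Suc j)) A" "bd_in UNIV a' = a - w"
    "b' \<in> face_chains (Suc (Suc j)) B" "bd_in UNIV b' = b + w"
    using A(2) B(2) unfolding acyclic_at_def by blast
  then have "a' + b' \<in> face_chains (Suc (Suc j)) (A \<union> B)" "bd_in UNIV (a' + b') = c"
    using ab(3) face_chains_mono[of A "A \<union> B"] face_chains_mono[of B "A \<union> B"]
    by (auto simp: bd_in_add intro!: face_chains_add)
  then show "\<exists>b\<in>face_chains (Suc (Suc j)) (A \<union> B). bd_in UNIV b = c" by blast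
qed

lemma trivial_homology_iff_acyclic_at:
  assumes K: "simplicial_complex_on V K"
  shows "trivial_group (reduced_simplicial_homology k K) \<longleftrightarrow> acyclic_at (Suc k) K"
proof -
  have fin: "finite F" if "F \<in> K" for F
    using K that unfolding simplicial_complex_on_def by (meson PowD finite_subset subsetD)
  have ch: "carrier (simplicial_chain_group j K) = face_chains (Suc j) K" for j
    using fin by (auto simp: simplicial_chain_group_def face_chains_def faces_def subset_iff)
  let ?G = "simplicial_chain_group k K" and ?Z = "simplicial_cycle_group k K"
  let ?B = "simplicial_boundaries k K"
  have Z: "carrier ?Z = simplicial_cycles k K"
    unfolding simplicial_cycle_group_def
    by (intro subgroup.carrier_subgroup_generated_subgroup subgroup_simplicial_cycles)
  have B_sub: "?B \<subseteq> simplicial_cycles k K"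
  proof
    fix x assume "x \<in> ?B"
    then obtain c where "x = simplicial_boundary c" "Poly_Mapping.keys c \<subseteq> faces (k + 1) K"
      by (auto simp: simplicial_boundaries_def simplicial_chain_group_def)
    then show "x \<in> simplicial_cycles k K"
      using keys_simplicial_boundary[OF K] simplicial_boundary_boundary[of c]
      by (simp add: simplicial_cycles_def simplicial_chain_group_def)
  qed
  have grG: "group ?G"
    by (simp add: simplicial_chain_group_def)
  have sub: "subgroup ?B ?Z"
    unfolding simplicial_cycle_group_def
    using group.subgroup_of_subgroup_generated[OF grG B_sub subgroup_simplicial_boundaries[OF K]] .
  interpret Z: group ?Z
    unfolding simplicial_cycle_group_def by (rule group.group_subgroup_generated[OF grG])
  have "trivial_group (reduced_simplicial_homology k K) \<longleftrightarrow>
      carrier (?Z Mod ?B) = {?B}"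
    using group_reduced_simplicial_homology[OF K, of k]
    by (simp add: trivial_group_def reduced_simplicial_homology_def)
  also have "\<dots> \<longleftrightarrow> (\<forall>x\<in>carrier ?Z. ?B #>\<^bsub>?Z\<^esub> x = ?B)"
    using Z.one_closed unfolding carrier_FactGroup by blast
  also have "\<dots> \<longleftrightarrow> carrier ?Z \<subseteq> ?B"
    using Z.coset_join1[OF _ _ sub] Z.coset_join2[OF _ sub] by blast
  also have "\<dots> \<longleftrightarrow> acyclic_at (Suc k) K"
    unfolding Z acyclic_at_def simplicial_cycles_def simplicial_boundaries_def ch
    by (auto simp: ch simplicial_boundary_eq_bd_in)
  finally show ?thesis .
qed

section \<open>Complexes in which small vertex sets have common neighbours\<close>

text \<open>The intersection of the closed stars of the single vertices in \<open>T\<close>; the set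
  \<open>T\<close> itself need not be a face.\<close>

definition star :: "'a set set \<Rightarrow> 'a set \<Rightarrow> 'a set set" where
  "star K T = {F \<in> K. \<forall>t\<in>T. insert t F \<in> K}"

text \<open>One apex serves all faces inside \<open>W\<close> simultaneously. For empty
  \<open>W\<close> the condition provides a vertex, as soon as \<open>{}\<close> is a face.\<close>

definition coned_up_to :: "nat \<Rightarrow> 'a set set \<Rightarrow> bool" where
  "coned_up_to m K \<longleftrightarrow>
     (\<forall>W. finite W \<and> card W \<le> m \<longrightarrow> (\<exists>v. \<forall>F\<in>K. F \<subseteq> W \<longrightarrow> insert v F \<in> K))"

lemma down_closed_star:
  assumes "down_closed K"
  shows "down_closed (star K T)"
  unfolding down_closed_def star_def
proof (intro ballI allI impI CollectI conjI)
  fix F G t assume F: "F \<in> {F \<in> K. \<forall>t\<in>T. insert t F \<in> K}" "G \<subseteq> F"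
  then show "G \<in> K" using assms unfolding down_closed_def by blast
  assume "t \<in> T"
  then have "insert t F \<in> K" "insert t G \<subseteq> insert t F" using F by auto
  then show "insert t G \<in> K" using assms unfolding down_closed_def by blast
qed

lemma down_closed_UN: "(\<And>i. i \<in> I \<Longrightarrow> down_closed (A i)) \<Longrightarrow> down_closed (\<Union>i\<in>I. A i)"
  unfolding down_closed_def by blast

text \<open>An apex for \<open>W \<union> T\<close> in \<open>K\<close> extends both
  \<open>F\<close> and every \<open>insert t F\<close>, so it is an apex for \<open>W\<close> in the
  star. The price is \<open>card T\<close> vertices of the budget.\<close>

lemma coned_up_to_star:
  fixes K :: "'a set set"
  assumes "coned_up_to m K" "finite T" "card T \<le> m"
  shows "coned_up_to (m - card T) (star K T)"
  unfolding coned_up_to_def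
proof (intro allI impI)
  fix W :: "'a set" assume W: "finite W \<and> card W \<le> m - card T"
  have "card (W \<union> T) \<le> m"
    using W assms(3) card_Un_le[of W T] by linarith
  then obtain v where v: "\<And>F. F \<in> K \<Longrightarrow> F \<subseteq> W \<union> T \<Longrightarrow> insert v F \<in> K"
    using assms W unfolding coned_up_to_def by (metis finite_UnI)
  have "insert v F \<in> star K T" if F: "F \<in> star K T" "F \<subseteq> W" for F
  proof -
    have "insert v (insert t F) \<in> K" if "t \<in> T" for t
      using that F by (intro v) (auto simp: star_def)
    moreover have "F \<in> K" "F \<subseteq> W \<union> T" using F by (auto simp: star_def)
    ultimately show ?thesis using v by (auto simp: star_def insert_commute)
  qed
  then show "\<exists>v. \<forall>F\<in>star K T. F \<subseteq> W \<longrightarrow> insert v F \<in> star K T" by blast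
qed

text \<open>Mayer-Vietoris is applied to the cover by vertex stars: intersecting stars costs one
  coned vertex each, while the degree drops by one.\<close>

theorem acyclic_at_if_coned:
  assumes "down_closed K" "finite (\<Union>K)" "coned_up_to (2 * J) K" "{} \<in> K"
  shows "acyclic_at J K"
  using assms
proof (induction J arbitrary: K rule: less_induct)
  case (less J)
  \<comment> \<open>For empty \<open>T\<close> the star is a cone with apex \<open>u\<close>.
    Otherwise \<open>card T \<ge> 1\<close> forces \<open>j < J\<close>, and
    \<open>1 + card T + 2 * j \<le> 1 + J + j \<le> 2 * J\<close> shows that enough budget remains
    for the outer induction hypothesis in degree \<open>j\<close>.\<close>
  have single: "acyclic_at j (star K (insert u T))"
    if "finite T" "j + card T \<le> J" "\<forall>t\<in>insert u T. {t} \<in> K" for j u T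
  proof (cases "T = {}")
    case True
    then show ?thesis
      by (intro acyclic_at_cone[of _ _ u]) (auto simp: star_def)
  next
    case False
    then have T: "card T \<ge> 1" using that(1) by (simp add: Suc_leI card_gt_0_iff)
    then have jJ: "j < J" using that by linarith
    have c: "card (insert u T) \<le> Suc (card T)" using that(1) by (simp add: card_insert_if)
    then have le: "card (insert u T) + 2 * j \<le> 2 * J" using that(2) jJ by linarith
    have "coned_up_to (2 * J - card (insert u T)) (star K (insert u T))"
      using le that(1) less.prems(3) by (intro coned_up_to_star) auto
    moreover have "2 * j \<le> 2 * J - card (insert u T)" using le by linarith
    ultimately have "coned_up_to (2 * j) (star K (insert u T))"
      unfolding coned_up_to_def by (meson order_trans)
    moreover have "finite (\<Union>(star K (insert u T)))"
      by (rule finite_subset[OF _ less.prems(2)]) (auto simp: star_def)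
    moreover have "{} \<in> star K (insert u T)"
      using that(3) less.prems(4) by (auto simp: star_def)
    ultimately show ?thesis
      using less.IH[OF jJ] down_closed_star[OF less.prems(1)] by blast
  qed
  \<comment> \<open>Inner induction on \<open>j\<close>, for all \<open>T\<close>: the star of
    \<open>u\<close> meets the union of the others in the union of the stars for
    \<open>insert u T\<close>. The degree drops by one while \<open>T\<close> gains at most one
    vertex, so \<open>j + card T\<close> stays below the bound.\<close>
  have union: "acyclic_at j (\<Union>u\<in>U. star K (insert u T))"
    if "finite U" "U \<noteq> {}" "finite T" "j + card T \<le> J" "\<forall>t\<in>U \<union> T. {t} \<in> K" for j U T
    using that
  proof (induction j arbitrary: U T)
    case 0
    then obtain u where u: "u \<in> U" by blast
    have le: "card (insert u T) \<le> 2 * J \<or> J = 0 \<and> T = {}"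
      using 0 by (cases "J = 0") (auto simp: card_insert_if)
    \<comment> \<open>At \<open>j = 0\<close> the only face to extend is \<open>{}\<close>, so a
      single vertex of the star suffices.\<close>
    obtain v where v: "insert v {} \<in> star K (insert u T)"
    proof (cases "T = {}")
      case True
      then show ?thesis using that[of u] 0 u by (auto simp: star_def)
    next
      case False
      then have "coned_up_to (2 * J - card (insert u T)) (star K (insert u T))"
        using le 0 less.prems(3) by (intro coned_up_to_star) auto
      moreover have "{} \<in> star K (insert u T)"
        using 0 u less.prems(4) by (auto simp: star_def)
      ultimately show ?thesis
        using that unfolding coned_up_to_def
        by (metis card.empty empty_subsetI finite.emptyI zero_le)
    qed
    show ?case
      by (rule acyclic_at_cone[of _ _ v]) (use v u in auto)
  next
    case (Suc j)
    from Suc.prems(1,2,5) show ?case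
    proof (induction U rule: finite_ne_induct)
      case (singleton u)
      then show ?case using single[OF Suc.prems(3,4), of u] by simp
    next
      case (insert u U)
      let ?B = "\<Union>w\<in>U. star K (insert w T)"
      have "acyclic_at (Suc j) (star K (insert u T) \<union> ?B)"
      proof (rule acyclic_at_Un)
        show "acyclic_at (Suc j) (star K (insert u T))"
          using Suc.prems insert by (intro single) auto
        show "acyclic_at (Suc j) ?B" using insert by auto
        have "star K (insert u T) \<inter> ?B = (\<Union>w\<in>U. star K (insert w (insert u T)))"
          by (auto simp: star_def)
        moreover have "acyclic_at j (\<Union>w\<in>U. star K (insert w (insert u T)))"
        proof (rule Suc.IH)
          show "j + card (insert u T) \<le> J"
            using Suc.prems(3,4) by (auto simp: card_insert_if)
        qed (use insert Suc.prems in auto)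
        ultimately show "acyclic_at j (star K (insert u T) \<inter> ?B)" by simp
      qed (intro down_closed_star down_closed_UN less.prems)+
      then show ?case by simp
    qed
  qed
  obtain v where v: "{v} \<in> K"
    using less.prems(3,4) unfolding coned_up_to_def
    by (metis card.empty empty_subsetI finite.emptyI zero_le)
  define V where "V = {v. {v} \<in> K}"
  show ?case
  proof (cases "J = 0")
    case True
    then show ?thesis using v by (intro acyclic_at_cone[of _ _ v]) auto
  next
    case False
    have "finite V" by (rule finite_subset[OF _ less.prems(2)]) (auto simp: V_def)
    moreover have "V \<noteq> {}" using v by (auto simp: V_def)
    ultimately have "acyclic_at J (\<Union>u\<in>V. star K (insert u {}))"
      by (intro union) (auto simp: V_def)
    \<comment> \<open>A nonempty face lies in the star of each of its vertices, so for positive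
      \<open>J\<close> the vertex stars carry all \<open>J\<close>-chains.\<close>
    moreover have "face_chains J K \<subseteq> face_chains J (\<Union>u\<in>V. star K (insert u {}))"
    proof
      fix c assume c: "c \<in> face_chains J K"
      have "F \<in> (\<Union>u\<in>V. star K {u})" if F: "F \<in> Poly_Mapping.keys c" for F
      proof -
        have F': "F \<in> K" "card F = J" using c F by (auto simp: face_chains_def)
        then obtain u where "u \<in> F" using False by fastforce
        then have "{u} \<subseteq> F" "insert u F = F" by auto
        moreover from this have "{u} \<in> K" using less.prems(1) F' unfolding down_closed_def by metis
        ultimately show ?thesis using F' by (auto simp: V_def star_def)
      qed
      then show "c \<in> face_chains J (\<Union>u\<in>V. star K (insert u {}))"
        using c by (auto simp: face_chains_def)
    qed
    moreover have "(\<Union>u\<in>V. star K (insert u {})) \<subseteq> K" by (auto simp: star_def)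
    ultimately show ?thesis
      unfolding acyclic_at_def by (meson face_chains_mono subsetD)
  qed
qed

section \<open>Cycles of minimal support\<close>

text \<open>Choose \<open>S\<close> of least cardinality. The subcomplex on \<open>S\<close> is the
  union of the one on \<open>S - {v}\<close>, acyclic by minimality, and the star of
  \<open>v\<close>, a cone; they meet in the link of \<open>v\<close>. Were the link acyclic one
  degree lower, Mayer-Vietoris would make the union acyclic.\<close>

lemma minimal_nonacyclic_subset:
  assumes K: "down_closed K" and S0: "finite S0" "\<not> acyclic_at (Suc j) {F \<in> K. F \<subseteq> S0}"
  obtains S where "S \<subseteq> S0" "S \<noteq> {}" "\<not> acyclic_at (Suc j) {F \<in> K. F \<subseteq> S}"
    "\<forall>v\<in>S. \<not> acyclic_at j {F \<in> K. F \<subseteq> S - {v} \<and> insert v F \<in> K}"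
proof -
  define P where "P S \<longleftrightarrow> S \<subseteq> S0 \<and> \<not> acyclic_at (Suc j) {F \<in> K. F \<subseteq> S}" for S
  have "P S0" using S0 by (simp add: P_def)
  then obtain S where S: "P S" and min: "\<And>S'. P S' \<Longrightarrow> card S \<le> card S'"
    using ex_has_least_nat[of P S0 card] by blast
  have fS: "finite S" using S S0 finite_subset unfolding P_def by blast
  have "S \<noteq> {}"
  proof
    assume "S = {}"
    then have "acyclic_at (Suc j) {F \<in> K. F \<subseteq> S}"
      by (intro acyclic_at_cone) auto
    then show False using S by (simp add: P_def)
  qed
  moreover have "\<not> acyclic_at j {F \<in> K. F \<subseteq> S - {v} \<and> insert v F \<in> K}" if v: "v \<in> S" for v
  proof
    assume L: "acyclic_at j {F \<in> K. F \<subseteq> S - {v} \<and> insert v F \<in> K}"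
    let ?KS = "{F \<in> K. F \<subseteq> S}" and ?A = "{F \<in> K. F \<subseteq> S - {v}}"
    have dKS: "down_closed ?KS" and dA: "down_closed ?A"
      using K unfolding down_closed_def by blast+
    have "card (S - {v}) < card S" using card_Diff1_less[OF fS v] .
    then have "acyclic_at (Suc j) ?A"
      using min[of "S - {v}"] S by (fastforce simp: P_def)
    moreover have "acyclic_at (Suc j) (star ?KS {v})"
      by (rule acyclic_at_cone[of _ _ v]) (auto simp: star_def)
    moreover have "?A \<inter> star ?KS {v} = {F \<in> K. F \<subseteq> S - {v} \<and> insert v F \<in> K}"
      using v by (auto simp: star_def)
    ultimately have "acyclic_at (Suc j) (?A \<union> star ?KS {v})"
      using L by (intro acyclic_at_Un[OF dA _ down_closed_star[OF dKS]]) simp_all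
    moreover have "?A \<union> star ?KS {v} = ?KS"
      by (auto simp: star_def insert_absorb)
    ultimately show False using S by (simp add: P_def)
  qed
  ultimately show ?thesis using that S unfolding P_def by blast
qed

section \<open>Flag complexes and their minimum degree\<close>

definition flag_complex :: "'a set set \<Rightarrow> bool" where
  "flag_complex K \<longleftrightarrow> (\<forall>F. finite F \<and> (\<forall>u\<in>F. \<forall>v\<in>F. {u, v} \<in> K) \<longrightarrow> F \<in> K)"

lemma flag_complexD:
  assumes "flag_complex K" "finite F" "\<And>u v. u \<in> F \<Longrightarrow> v \<in> F \<Longrightarrow> {u, v} \<in> K"
  shows "F \<in> K"
proof -
  have "finite F \<and> (\<forall>u\<in>F. \<forall>v\<in>F. {u, v} \<in> K) \<longrightarrow> F \<in> K"
    using assms(1) unfolding flag_complex_def by (rule spec)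
  then show ?thesis using assms(2,3) by blast
qed

lemma down_closedD: "down_closed K \<Longrightarrow> F \<in> K \<Longrightarrow> G \<subseteq> F \<Longrightarrow> G \<in> K"
  unfolding down_closed_def by (drule (1) bspec, drule spec, erule (1) mp)

lemma down_closed_link:
  assumes "down_closed K"
  shows "down_closed {F \<in> K. F \<subseteq> S \<and> insert v F \<in> K}"
  unfolding down_closed_def
proof (intro ballI allI impI CollectI conjI)
  fix F G assume F: "F \<in> {F \<in> K. F \<subseteq> S \<and> insert v F \<in> K}" "G \<subseteq> F"
  show "G \<in> K" using F by (intro down_closedD[OF assms, of F G]) blast+
  show "insert v G \<in> K" using F by (intro down_closedD[OF assms, of "insert v F" "insert v G"]) blast+
qed auto

lemma flag_complex_link:
  assumes K: "flag_complex K" "down_closed K" and v: "v \<in> S" "{v} \<in> K"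
  shows "flag_complex {F \<in> K. F \<subseteq> S - {v} \<and> insert v F \<in> K}"
  unfolding flag_complex_def
proof (intro allI impI)
  fix F assume F: "finite F \<and> (\<forall>u\<in>F. \<forall>w\<in>F. {u, w} \<in> {F \<in> K. F \<subseteq> S - {v} \<and> insert v F \<in> K})"
  have F1: "{u, w} \<in> K" "insert v {u, w} \<in> K" "u \<in> S - {v}" if "u \<in> F" "w \<in> F" for u w
    using F that by blast+
  have pair: "{v, u} \<in> K" if "u \<in> F" for u
    using F1(2)[OF that that] by simp
  have "{a, b} \<in> K" if ab: "a \<in> insert v F" "b \<in> insert v F" for a b
  proof -
    consider "a = v" "b = v" | "a = v" "b \<in> F" | "a \<in> F" "b = v" | "a \<in> F" "b \<in> F"
      using ab by blast
    then show ?thesis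
      by cases (use v(2) pair[of a] pair[of b] F1(1)[of a b] in \<open>simp_all add: insert_commute\<close>)
  qed
  moreover have "finite (insert v F)" using F by blast
  ultimately have vF: "insert v F \<in> K"
    using flag_complexD[OF K(1)] by metis
  moreover have "F \<in> K" by (rule down_closedD[OF K(2) vF]) blast
  moreover have "F \<subseteq> S - {v}" using F1(3) by blast
  ultimately show "F \<in> {F \<in> K. F \<subseteq> S - {v} \<and> insert v F \<in> K}" by blast
qed

text \<open>The extremal case is the cross-polytope.\<close>

lemma card_vertices_flag_complex:
  assumes "flag_complex K" "down_closed K" "finite {v. {v} \<in> K}" "\<not> acyclic_at j K"
  shows "2 * j \<le> card {v. {v} \<in> K}"
  using assms
proof (induction j arbitrary: K)
  case (Suc j)
  define V where "V = {v. {v} \<in> K}"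
  have "{F \<in> K. F \<subseteq> V} = K"
  proof (intro equalityI subsetI CollectI conjI)
    fix F x assume "F \<in> K" "x \<in> F"
    then show "x \<in> V"
      using down_closedD[OF Suc.prems(2), of F "{x}"] by (simp add: V_def)
  qed auto
  then have V: "finite V" "\<not> acyclic_at (Suc j) {F \<in> K. F \<subseteq> V}"
    using Suc.prems(3,4) by (simp_all add: V_def)
  obtain S where S: "S \<subseteq> V" "S \<noteq> {}" "\<not> acyclic_at (Suc j) {F \<in> K. F \<subseteq> S}"
    and link: "\<forall>v\<in>S. \<not> acyclic_at j {F \<in> K. F \<subseteq> S - {v} \<and> insert v F \<in> K}"
    by (rule minimal_nonacyclic_subset[OF Suc.prems(2) V]) (rule that)
  obtain v where v: "v \<in> S" using S by blast
  have fS: "finite S" using S Suc.prems(3) finite_subset unfolding V_def by blast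
  define L where "L = {F \<in> K. F \<subseteq> S - {v} \<and> insert v F \<in> K}"
  have vK: "{v} \<in> K" using v S by (auto simp: V_def)
  have L_sub: "{u. {u} \<in> L} \<subseteq> S - {v}" by (auto simp: L_def)
  have le: "2 * j \<le> card {u. {u} \<in> L}"
  proof (rule Suc.IH)
    show "flag_complex L" "down_closed L"
      unfolding L_def using flag_complex_link[OF Suc.prems(1,2) v vK] down_closed_link[OF Suc.prems(2)]
      by auto
    show "finite {u. {u} \<in> L}" using L_sub fS finite_subset by blast
    show "\<not> acyclic_at j L" using bspec[OF link v] by (simp add: L_def)
  qed
  \<comment> \<open>If all other vertices of \<open>S\<close> were neighbours of \<open>v\<close>,
    flagness would make \<open>v\<close> a cone apex for the subcomplex on \<open>S\<close>. So
    beyond the link there are at least two vertices, \<open>v\<close> and a non-neighbour, which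
    gives the factor 2.\<close>
  have "{u. {u} \<in> L} \<noteq> S - {v}"
  proof
    assume eq: "{u. {u} \<in> L} = S - {v}"
    have nb: "{v, u} \<in> K" if "u \<in> S" for u
      using that eq vK by (cases "u = v") (auto simp: L_def)
    have "acyclic_at (Suc j) {F \<in> K. F \<subseteq> S}"
    proof (rule acyclic_at_cone[of _ _ v], safe)
      fix F assume F: "F \<in> K" "F \<subseteq> S" "finite F"
      have "{u, w} \<in> K" if "u \<in> F" "w \<in> F" for u w
        using that by (intro down_closedD[OF Suc.prems(2) F(1)]) auto
      moreover have "{v, u} \<in> K" "{u, v} \<in> K" if "u \<in> F" for u
        using nb[of u] that F(2) insert_commute[of u v "{}"] by auto
      ultimately have "{a, b} \<in> K" if "a \<in> insert v F" "b \<in> insert v F" for a b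
        using that vK by (elim insertE) simp_all
      moreover have "finite (insert v F)" using F(3) by blast
      ultimately show "insert v F \<in> K"
        using flag_complexD[OF Suc.prems(1)] by metis
    qed (use v in auto)
    then show False using S by blast
  qed
  then have "card {u. {u} \<in> L} < card (S - {v})"
    using L_sub fS by (intro psubset_card_mono) auto
  then have "2 * Suc j \<le> card S" using le v fS by simp
  also have "\<dots> \<le> card V" using S Suc.prems(3) by (intro card_mono) (auto simp: V_def)
  finally show ?case by (simp add: V_def)
qed simp

text \<open>In a minimal non-acyclic vertex set each link is again flag and not acyclic one degree
  lower. The vertex bound applied to the link of \<open>v\<close> bounds the number of neighbours of
  \<open>v\<close>.\<close>

lemma flag_complex_min_degree:
  assumes K: "flag_complex K" "down_closed K" and vert: "\<And>v. v \<in> S0 \<Longrightarrow> {v} \<in> K"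
    and S0: "finite S0" "\<not> acyclic_at (Suc j) {F \<in> K. F \<subseteq> S0}"
  obtains S where "S \<subseteq> S0" "S \<noteq> {}" "\<forall>v\<in>S. 2 * j \<le> card {u \<in> S - {v}. {u, v} \<in> K}"
proof -
  obtain S where S: "S \<subseteq> S0" "S \<noteq> {}" "\<not> acyclic_at (Suc j) {F \<in> K. F \<subseteq> S}"
    and link: "\<forall>v\<in>S. \<not> acyclic_at j {F \<in> K. F \<subseteq> S - {v} \<and> insert v F \<in> K}"
    by (rule minimal_nonacyclic_subset[OF K(2) S0]) (rule that)
  have "2 * j \<le> card {u \<in> S - {v}. {u, v} \<in> K}" if v: "v \<in> S" for v
  proof -
    define L where "L = {F \<in> K. F \<subseteq> S - {v} \<and> insert v F \<in> K}"
    have vK: "{v} \<in> K" using v S vert by auto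
    have eq: "{u. {u} \<in> L} = {u \<in> S - {v}. {u, v} \<in> K}"
      using S(1) vert by (auto simp: L_def insert_commute)
    have "2 * j \<le> card {u. {u} \<in> L}"
    proof (rule card_vertices_flag_complex)
      show "flag_complex L" "down_closed L"
        unfolding L_def using flag_complex_link[OF K v vK] down_closed_link[OF K(2)] by auto
      show "finite {u. {u} \<in> L}"
        unfolding eq using finite_subset[OF S(1) S0(1)] by simp
      show "\<not> acyclic_at j L" using bspec[OF link v] by (simp add: L_def)
    qed
    then show ?thesis by (simp add: eq)
  qed
  then show ?thesis using that S by blast
qed

text \<open>A non-bounding cycle with the fewest faces is strongly connected.\<close>

lemma strongly_connected_cycle:
  assumes "\<not> acyclic_at j K"
  obtains z where "z \<in> face_chains j K" "bd_in UNIV z = 0"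
    "\<And>b. b \<in> face_chains (Suc j) K \<Longrightarrow> bd_in UNIV b \<noteq> z"
    "\<And>A. A \<subset> Poly_Mapping.keys z \<Longrightarrow> A \<noteq> {} \<Longrightarrow>
       \<exists>F\<in>A. \<exists>G\<in>Poly_Mapping.keys z - A. \<exists>u\<in>F. \<exists>w\<in>G. F - {u} = G - {w}"
proof -
  define P where "P z \<longleftrightarrow> z \<in> face_chains j K \<and> bd_in UNIV z = 0 \<and>
    (\<forall>b\<in>face_chains (Suc j) K. bd_in UNIV b \<noteq> z)" for z
  obtain z0 where "P z0"
    using assms unfolding acyclic_at_def P_def by blast
  then obtain z where z: "P z" and min: "\<And>y. P y \<Longrightarrow> card (Poly_Mapping.keys z) \<le> card (Poly_Mapping.keys y)"
    using ex_has_least_nat[of P z0 "\<lambda>z. card (Poly_Mapping.keys z)"] by blast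
  have "\<exists>F\<in>A. \<exists>G\<in>Poly_Mapping.keys z - A. \<exists>u\<in>F. \<exists>w\<in>G. F - {u} = G - {w}"
    if A: "A \<subset> Poly_Mapping.keys z" "A \<noteq> {}" for A
  proof (rule ccontr)
    assume sep: "\<not> ?thesis"
    have "Poly_Mapping.keys z \<subseteq> A \<union> (Poly_Mapping.keys z - A)" by blast
    from frag_split[OF this] obtain a b where
      ab: "Poly_Mapping.keys a \<subseteq> A" "Poly_Mapping.keys b \<subseteq> Poly_Mapping.keys z - A" "a + b = z"
      by blast
    have bd: "bd_in UNIV a = - bd_in UNIV b"
      using z ab(3) unfolding P_def by (metis add_eq_0_iff bd_in_add minus_equation_iff)
    then have "Poly_Mapping.keys (bd_in UNIV a) = Poly_Mapping.keys (bd_in UNIV b)" by simp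
    \<comment> \<open>A common ridge would connect \<open>A\<close> to its complement. Being
      negatives of each other with disjoint supports, both boundaries vanish; then \<open>a\<close>
      and \<open>b\<close> are cycles with fewer faces and bound by minimality, hence so does
      \<open>z\<close>.\<close>
    moreover have "Poly_Mapping.keys (bd_in UNIV a) \<inter> Poly_Mapping.keys (bd_in UNIV b) = {}"
    proof (rule ccontr)
      assume "\<not> ?thesis"
      then obtain R where R: "R \<in> Poly_Mapping.keys (bd_in UNIV a)" "R \<in> Poly_Mapping.keys (bd_in UNIV b)"
        by blast
      then obtain F u where F: "F \<in> Poly_Mapping.keys a" "u \<in> F" "R = F - {u}"
        using subsetD[OF keys_bd_in] by blast
      obtain G w where G: "G \<in> Poly_Mapping.keys b" "w \<in> G" "R = G - {w}"
        using R(2) subsetD[OF keys_bd_in] by blast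
      have "F \<in> A" "G \<in> Poly_Mapping.keys z - A" "F - {u} = G - {w}"
        using F G subsetD[OF ab(1)] subsetD[OF ab(2)] by auto
      then show False using sep F(2) G(2) by blast
    qed
    ultimately have 0: "bd_in UNIV a = 0" "bd_in UNIV b = 0" using bd by auto
    have ch: "a \<in> face_chains j K" "b \<in> face_chains j K"
      using ab A z by (auto simp: face_chains_def P_def)
    have bounds: "\<exists>w\<in>face_chains (Suc j) K. bd_in UNIV w = y"
      if "y \<in> face_chains j K" "bd_in UNIV y = 0" "Poly_Mapping.keys y \<subset> Poly_Mapping.keys z" for y
    proof -
      have "card (Poly_Mapping.keys y) < card (Poly_Mapping.keys z)"
        using that by (intro psubset_card_mono) auto
      then show ?thesis using min[of y] that unfolding P_def by fastforce
    qed
    obtain a' b' where "a' \<in> face_chains (Suc j) K" "bd_in UNIV a' = a"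
        "b' \<in> face_chains (Suc j) K" "bd_in UNIV b' = b"
      using bounds[of a] bounds[of b] 0 ch ab A by blast
    then have "a' + b' \<in> face_chains (Suc j) K" "bd_in UNIV (a' + b') = z"
      using ab(3) by (auto simp: bd_in_add face_chains_add)
    then show False using z by (auto simp: P_def)
  qed
  then show ?thesis using that z unfolding P_def by blast
qed

lemma cycle_other_face:
  assumes "bd_in UNIV z = 0" "F \<in> Poly_Mapping.keys z" "finite F" "u \<in> F"
  obtains G w where "G \<in> Poly_Mapping.keys z" "w \<in> G" "G - {w} = F - {u}" "G \<noteq> F"
proof -
  have "F - {u} \<notin> Poly_Mapping.keys (bd_in UNIV z)" using assms(1) by simp
  then show ?thesis using in_keys_bd_in[of F z u UNIV] assms(2-4) that by blast
qed

section \<open>The join of boundaries of simplices\<close>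

text \<open>Deleting one vertex from each block by successive application of \<open>bd_in (B i)\<close> to the full
  simplex gives the fundamental cycle of the join.\<close>

lemma join_of_boundaries:
  fixes B :: "nat \<Rightarrow> 'a::linorder set"
  assumes fin: "\<And>i. i < r \<Longrightarrow> finite (B i)"
    and disj: "\<And>i j. i < r \<Longrightarrow> j < r \<Longrightarrow> i \<noteq> j \<Longrightarrow> B i \<inter> B j = {}"
    and v: "\<And>i. i < r \<Longrightarrow> v i \<in> B i"
    and V: "V = (\<Union>i<r. B i)" and sr: "s \<le> r"
  shows "\<exists>c. (\<forall>i<s. bd_in (B i) c = 0) \<and>
    (\<forall>F\<in>Poly_Mapping.keys c. F \<subseteq> V \<and> card F + s = card V \<and> (\<forall>i<s. \<not> B i \<subseteq> F) \<and>
        (\<forall>i<r. s \<le> i \<longrightarrow> B i \<subseteq> F)) \<and>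
    V - v ` {..<s} \<in> Poly_Mapping.keys c"
  using sr
proof (induction s)
  case 0
  show ?case
    by (rule exI[of _ "frag_of V"]) (auto simp: V)
next
  case (Suc s)
  then have s: "s < r" by simp
  have fV: "finite V" using fin by (auto simp: V)
  obtain c where c: "\<forall>i<s. bd_in (B i) c = 0"
    and keys': "\<forall>F\<in>Poly_Mapping.keys c. F \<subseteq> V \<and> card F + s = card V \<and> (\<forall>i<s. \<not> B i \<subseteq> F) \<and>
        (\<forall>i<r. s \<le> i \<longrightarrow> B i \<subseteq> F)"
    and top: "V - v ` {..<s} \<in> Poly_Mapping.keys c"
    using Suc.IH[OF less_imp_le[OF s]] by (elim exE conjE) (rule that)
  note keys = bspec[OF keys']
  have fk: "finite F" if "F \<in> Poly_Mapping.keys c" for F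
    using keys[OF that] fV finite_subset by blast
  let ?c = "bd_in (B s) c"
  have "bd_in (B i) ?c = 0" if "i < Suc s" for i
  proof (cases "i = s")
    case True
    then show ?thesis using bd_in_bd_in fk by blast
  next
    case False
    then have "i < s" using that by simp
    then have "bd_in (B i) ?c = - bd_in (B s) (bd_in (B i) c)"
      using disj[of i s] s fk by (intro bd_in_anticommute) auto
    then show ?thesis using c \<open>i < s\<close> by simp
  qed
  moreover have "F \<subseteq> V \<and> card F + Suc s = card V \<and> (\<forall>i<Suc s. \<not> B i \<subseteq> F) \<and>
        (\<forall>i<r. Suc s \<le> i \<longrightarrow> B i \<subseteq> F)" if F: "F \<in> Poly_Mapping.keys ?c" for F
  proof -
    obtain G w where G: "G \<in> Poly_Mapping.keys c" "w \<in> G" "w \<in> B s" "F = G - {w}"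
      using F keys_bd_in[of "B s" c] by blast
    have "card G = Suc (card F)" using G fk[OF G(1)] by (metis card_Suc_Diff1)
    moreover have "B i \<subseteq> F" if "i < r" "Suc s \<le> i" for i
      using keys[OF G(1)] that G disj[of i s] s by auto
    moreover have "\<not> B i \<subseteq> F" if "i < Suc s" for i
    proof (cases "i = s")
      case True
      then show ?thesis using G by blast
    next
      case False
      then have "\<not> B i \<subseteq> G" using keys[OF G(1)] that by simp
      then show ?thesis using G by blast
    qed
    ultimately show ?thesis using keys[OF G(1)] G by auto
  qed
  moreover have "V - v ` {..<Suc s} \<in> Poly_Mapping.keys ?c"
  proof -
    have vs: "v s \<in> B s" using v s by blast
    have "v s \<in> V" using vs s by (auto simp: V)
    moreover have "v s \<notin> v ` {..<s}"
    proof
      assume "v s \<in> v ` {..<s}"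
      then obtain i where "i < s" "v s = v i" by blast
      then show False using v[of i] disj[of i s] s vs by auto
    qed
    ultimately have 1: "v s \<in> (V - v ` {..<s}) \<inter> B s" using vs by blast
    \<comment> \<open>Every face of \<open>c\<close> still contains block \<open>s\<close> entirely,
      hence \<open>v s\<close>; as \<open>G - {w}\<close> lacks \<open>v s\<close>, the deleted
      vertex is \<open>v s\<close>. So nothing cancels the new facet.\<close>
    have "G = V - v ` {..<s}"
      if G: "G \<in> Poly_Mapping.keys c" "w \<in> G \<inter> B s" "G - {w} = V - v ` {..<s} - {v s}" for G w
    proof -
      have "v s \<in> G" using keys[OF G(1)] s vs by auto
      then have "w = v s" using G(3) by blast
      then have "G = insert (v s) (V - v ` {..<s} - {v s})"
        using G(3) \<open>v s \<in> G\<close> by (metis insert_Diff)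
      then show ?thesis using 1 by (simp add: insert_absorb)
    qed
    then have "V - v ` {..<s} - {v s} \<in> Poly_Mapping.keys ?c"
      using top fk[OF top] 1 by (intro in_keys_bd_in) auto
    moreover have "V - v ` {..<Suc s} = V - v ` {..<s} - {v s}"
      by (auto simp: lessThan_Suc)
    ultimately show ?thesis by simp
  qed
  ultimately show ?case by blast
qed

lemma bd_in_UN_eq_0:
  fixes B :: "nat \<Rightarrow> 'a::linorder set"
  assumes "\<And>F. F \<in> Poly_Mapping.keys c \<Longrightarrow> finite F"
    and disj: "\<And>i j. i < r \<Longrightarrow> j < r \<Longrightarrow> i \<noteq> j \<Longrightarrow> B i \<inter> B j = {}"
    and "\<And>i. i < r \<Longrightarrow> bd_in (B i) c = 0"
  shows "bd_in (\<Union>i<r. B i) c = 0"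
  using assms(2,3)
proof (induction r)
  case 0
  show ?case by (simp add: bd_in_def frag_extend_eq_0)
next
  case (Suc r)
  have "B i \<inter> B r = {}" if "i < r" for i using that by (intro Suc.prems(1)) auto
  then have "(\<Union>i<r. B i) \<inter> B r = {}" by blast
  then have "bd_in ((\<Union>i<r. B i) \<union> B r) c = bd_in (\<Union>i<r. B i) c + bd_in (B r) c"
    using assms(1) by (rule bd_in_Un[rotated])
  then show ?case using Suc by (simp add: lessThan_Suc Un_commute)
qed

lemma not_acyclic_at_if_maximal_facet:
  fixes B :: "nat \<Rightarrow> 'a::linorder set"
  assumes fin: "\<And>i. i < r \<Longrightarrow> finite (B i)"
    and disj: "\<And>i j. i < r \<Longrightarrow> j < r \<Longrightarrow> i \<noteq> j \<Longrightarrow> B i \<inter> B j = {}"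
    and v: "\<And>i. i < r \<Longrightarrow> v i \<in> B i"
    and V: "V = (\<Union>i<r. B i)"
    and K: "\<And>F. F \<subseteq> V \<Longrightarrow> (\<And>i. i < r \<Longrightarrow> \<not> B i \<subseteq> F) \<Longrightarrow> F \<in> K"
    and max: "\<And>u. u \<notin> V - v ` {..<r} \<Longrightarrow> insert u (V - v ` {..<r}) \<notin> K"
  shows "\<not> acyclic_at (card V - r) K"
proof
  assume "acyclic_at (card V - r) K"
  have fV: "finite V" using fin by (auto simp: V)
  have "\<exists>c. (\<forall>i<r. bd_in (B i) c = 0) \<and>
    (\<forall>F\<in>Poly_Mapping.keys c. F \<subseteq> V \<and> card F + r = card V \<and> (\<forall>i<r. \<not> B i \<subseteq> F) \<and>
        (\<forall>i<r. r \<le> i \<longrightarrow> B i \<subseteq> F)) \<and>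
    V - v ` {..<r} \<in> Poly_Mapping.keys c"
    by (rule join_of_boundaries[where r = r]) (use fin disj v V in \<open>blast+\<close>)
  then obtain c where c': "\<forall>i<r. bd_in (B i) c = 0"
    and keys': "\<forall>F\<in>Poly_Mapping.keys c. F \<subseteq> V \<and> card F + r = card V \<and> (\<forall>i<r. \<not> B i \<subseteq> F) \<and>
        (\<forall>i<r. r \<le> i \<longrightarrow> B i \<subseteq> F)"
    and top: "V - v ` {..<r} \<in> Poly_Mapping.keys c"
    by (elim exE conjE) (rule that)
  note keys = bspec[OF keys']
  have c: "bd_in (B i) c = 0" if "i < r" for i using c' that by simp
  have fk: "finite F" if "F \<in> Poly_Mapping.keys c" for F
    using keys[OF that] fV finite_subset by blast
  have "bd_in UNIV c = bd_in V c"
    by (rule bd_in_cong) (use keys in auto)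
  also have "\<dots> = 0"
    unfolding V using fk disj c by (rule bd_in_UN_eq_0)
  finally have "bd_in UNIV c = 0" .
  moreover have "c \<in> face_chains (card V - r) K"
    unfolding face_chains_def
  proof (intro CollectI ballI conjI)
    fix F assume "F \<in> Poly_Mapping.keys c"
    from keys[OF this] fk[OF this] show "F \<in> K" "finite F" "card F = card V - r"
      by (auto intro: K)
  qed
  ultimately obtain b where b: "b \<in> face_chains (Suc (card V - r)) K" "bd_in UNIV b = c"
    using \<open>acyclic_at (card V - r) K\<close> unfolding acyclic_at_def by blast
  then have "V - v ` {..<r} \<in> Poly_Mapping.keys (bd_in UNIV b)" using top by simp
  from subsetD[OF keys_bd_in this] obtain G w where
    G: "V - v ` {..<r} = G - {w}" "G \<in> Poly_Mapping.keys b" "w \<in> G \<inter> UNIV"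
    by (elim CollectE exE conjE) (rule that)
  have "w \<notin> V - v ` {..<r}" unfolding G(1) by simp
  moreover have "insert w (V - v ` {..<r}) = G" unfolding G(1) using G(3) by blast
  moreover have "G \<in> K" using b(1) G(2) by (simp add: face_chains_def)
  ultimately show False using max[of w] by simp
qed

section \<open>Clique complexes\<close>

text \<open>The facts holding for every sample of the random complex on which the combinatorial
  arguments rest. With \<open>1 \<le> d\<close> all singletons are faces, so the vertex set is
  exactly \<open>{1..n}\<close>.\<close>

definition spans_skeleton :: "nat \<Rightarrow> nat \<Rightarrow> nat set set \<Rightarrow> bool" where
  "spans_skeleton d n K \<longleftrightarrow>
     1 \<le> d \<and> K \<subseteq> Pow {1..n} \<and> (\<forall>F. F \<subseteq> {1..n} \<and> card F \<le> d \<longrightarrow> F \<in> K)"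

definition dfaces_in :: "nat \<Rightarrow> 'a set set \<Rightarrow> 'a set \<Rightarrow> 'a set set" where
  "dfaces_in d K S = {F \<in> K. F \<subseteq> S \<and> card F = d + 1}"

lemma finite_dfaces_in: "finite S \<Longrightarrow> finite (dfaces_in d K S)"
  by (rule finite_subset[of _ "Pow S"]) (auto simp: dfaces_in_def)

lemma mem_clique_complex:
  assumes "spans_skeleton d n K"
  shows "F \<in> clique_complex d K \<longleftrightarrow> F \<subseteq> {1..n} \<and> (\<forall>S\<subseteq>F. card S = d + 1 \<longrightarrow> S \<in> K)"
proof -
  have "{v} \<in> K" if "v \<in> {1..n}" for v
    using assms that unfolding spans_skeleton_def by simp
  then have "\<Union>K = {1..n}"
    using assms unfolding spans_skeleton_def by blast
  then show ?thesis by (simp add: clique_complex_def)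
qed

lemma down_closed_clique_complex: "down_closed (clique_complex d K)"
  unfolding down_closed_def clique_complex_def by (blast intro: subset_trans)

lemma clique_complexD: "F \<in> clique_complex d K \<Longrightarrow> S \<subseteq> F \<Longrightarrow> card S = d + 1 \<Longrightarrow> S \<in> K"
  by (simp add: clique_complex_def)

section \<open>Counting \<open>d\<close>-faces in supports of cycles\<close>

lemma handshake:
  assumes "finite S" "\<And>v. v \<in> S \<Longrightarrow> (d + 1) * m \<le> card {F \<in> dfaces_in d K S. v \<in> F}"
  shows "card S * m \<le> card (dfaces_in d K S)"
proof -
  let ?D = "dfaces_in d K S"
  have fD: "finite ?D" using assms(1) by (rule finite_dfaces_in)
  \<comment> \<open>Double counting of incidences: each face is counted once for each of its
    \<open>d + 1\<close> vertices, which cancels the factor \<open>d + 1\<close> in the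
    degree.\<close>
  have "card S * ((d + 1) * m) \<le> (\<Sum>v\<in>S. card {F \<in> ?D. v \<in> F})"
    using sum_mono[of S "\<lambda>_. (d + 1) * m"] assms by simp
  also have "\<dots> = (\<Sum>F\<in>?D. card {v \<in> S. v \<in> F})"
    by (rule sum_multicount_gen[OF assms(1) fD]) simp
  also have "\<dots> = (\<Sum>F\<in>?D. d + 1)"
  proof (rule sum.cong[OF refl])
    fix F assume "F \<in> ?D"
    then have "{v \<in> S. v \<in> F} = F" "card F = d + 1" by (auto simp: dfaces_in_def)
    then show "card {v \<in> S. v \<in> F} = d + 1" by simp
  qed
  finally have "Suc d * (card S * m) \<le> Suc d * card ?D"
    by (simp add: algebra_simps)
  then show ?thesis by (rule Suc_mult_le_cancel1[THEN iffD1])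
qed

text \<open>Within \<open>F\<close>, the vertex \<open>v\<close> lies in \<open>k choose d\<close>
  faces. A further \<open>k choose (d - 1)\<close> come from neighbouring faces of the cycle: for
  each \<open>(d - 1)\<close>-subset \<open>T\<close> of \<open>F - {v}\<close>, the face across a
  ridge containing \<open>T\<close> and \<open>v\<close> supplies a new vertex \<open>w\<close>, and
  \<open>T\<close> together with \<open>v\<close> and \<open>w\<close> is a face. Pascal's rule adds
  the two numbers.\<close>

lemma card_faces_at_vertex_of_cycle:
  assumes z: "z \<in> face_chains (Suc k) K" "bd_in UNIV z = 0"
    and F: "F \<in> Poly_Mapping.keys z" "v \<in> F" and d: "1 \<le> d" "d \<le> k"
    and X: "finite X" "\<And>G D. G \<in> Poly_Mapping.keys z \<Longrightarrow> D \<subseteq> G \<Longrightarrow> card D = d + 1 \<Longrightarrow> v \<in> D \<Longrightarrow> D \<in> X"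
  shows "Suc k choose d \<le> card X"
proof -
  have fF: "finite F" "card F = Suc k" using z(1) F(1) by (auto simp: face_chains_def)
  define F' where "F' = F - {v}"
  have F': "finite F'" "card F' = k" "F = insert v F'" "v \<notin> F'"
    using fF F(2) by (auto simp: F'_def)
  have "\<exists>w G. w \<notin> F \<and> G \<in> Poly_Mapping.keys z \<and> insert w (F - {u}) \<subseteq> G" if u: "u \<in> F'" for u
  proof -
    have "u \<in> F" using u F' by simp
    obtain G w
      where G: "G \<in> Poly_Mapping.keys z" "w \<in> G" "G - {w} = F - {u}" "G \<noteq> F"
      by (rule cycle_other_face[OF z(2) F(1) fF(1) \<open>u \<in> F\<close>]) (rule that)
    have "w \<notin> F"
    proof
      assume "w \<in> F"
      then have "w = u" using G(3) by blast
      then show False using G(2-4) \<open>u \<in> F\<close> by (metis insert_Diff)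
    qed
    moreover have "insert w (F - {u}) \<subseteq> G" using G(2,3) by (metis insert_Diff order_refl)
    ultimately show ?thesis using G(1) by blast
  qed
  then obtain w G where wG: "\<And>u. u \<in> F' \<Longrightarrow> w u \<notin> F" "\<And>u. u \<in> F' \<Longrightarrow> G u \<in> Poly_Mapping.keys z"
    "\<And>u. u \<in> F' \<Longrightarrow> insert (w u) (F - {u}) \<subseteq> G u"
    by metis
  define A where "A = insert v ` {D. D \<subseteq> F' \<and> card D = d}"
  \<comment> \<open>The vertex exchanged for a new one has to lie outside \<open>T\<close>; it
    exists because \<open>T\<close> has \<open>d - 1 < k\<close> elements.\<close>
  define c where "c T = (SOME u. u \<in> F' - T)" for T
  have c: "c T \<in> F'" "c T \<notin> T" if T: "T \<subseteq> F'" "card T = d - 1" for T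
  proof -
    have "card T \<noteq> card F'" unfolding T(2) F'(2) using d by linarith
    then have "T \<noteq> F'" by blast
    then have "\<exists>u. u \<in> F' - T" using T(1) by blast
    then have "c T \<in> F' - T" unfolding c_def by (rule someI_ex)
    then show "c T \<in> F'" "c T \<notin> T" by auto
  qed
  define h where "h T = insert v (insert (w (c T)) T)" for T
  define B where "B = h ` {T. T \<subseteq> F' \<and> card T = d - 1}"
  have cardA: "card A = k choose d"
  proof -
    have "inj_on (insert v) {D. D \<subseteq> F' \<and> card D = d}"
      using F'(4) by (intro inj_onI) (metis (no_types, lifting) mem_Collect_eq insert_ident subsetD)
    then show ?thesis
      unfolding A_def using F' by (simp add: card_image n_subsets)
  qed
  \<comment> \<open>Both added vertices lie outside \<open>F'\<close>, so \<open>T\<close> can be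
    read off from \<open>h T\<close>; this gives injectivity whatever choices were made.\<close>
  have hF: "h T \<inter> F' = T" if T: "T \<subseteq> F'" "card T = d - 1" for T
    using wG(1)[OF c(1)[OF T]] T F'(3,4) by (auto simp: h_def)
  have cardB: "card B = k choose (d - 1)"
  proof -
    have "inj_on h {T. T \<subseteq> F' \<and> card T = d - 1}"
    proof (rule inj_onI)
      fix x y assume xy: "x \<in> {T. T \<subseteq> F' \<and> card T = d - 1}"
        "y \<in> {T. T \<subseteq> F' \<and> card T = d - 1}" "h x = h y"
      have "h x \<inter> F' = x" "h y \<inter> F' = y" by (rule hF; use xy in blast)+
      then show "x = y" using xy(3) by metis
    qed
    then show ?thesis
      unfolding B_def using F' by (simp add: card_image n_subsets)
  qed
  have "A \<inter> B = {}"
  proof -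
    have "\<not> h T \<subseteq> F" if T: "T \<subseteq> F'" "card T = d - 1" for T
      using wG(1)[OF c(1)[OF T]] by (auto simp: h_def)
    then have "\<not> D \<subseteq> F" if "D \<in> B" for D using that unfolding B_def by blast
    moreover have "D \<subseteq> F" if "D \<in> A" for D using that F'(3) by (auto simp: A_def)
    ultimately show ?thesis by blast
  qed
  moreover have fin: "finite A" "finite B" using F'(1) by (auto simp: A_def B_def)
  ultimately have "card (A \<union> B) = (k choose d) + (k choose (d - 1))"
    by (simp add: card_Un_disjoint cardA cardB)
  also have "\<dots> = Suc k choose d"
    using d by (cases d) auto
  finally have "card (A \<union> B) = Suc k choose d" .
  moreover have "A \<union> B \<subseteq> X"
  proof
    fix D assume "D \<in> A \<union> B"
    then consider D' where "D = insert v D'" "D' \<subseteq> F'" "card D' = d"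
      | T where "D = h T" "T \<subseteq> F'" "card T = d - 1"
      unfolding A_def B_def by blast
    then show "D \<in> X"
    proof cases
      case 1
      have "finite D'" using 1 F'(1) finite_subset by blast
      moreover have "v \<notin> D'" using 1 F'(4) by blast
      ultimately have "card D = d + 1" "D \<subseteq> F" "v \<in> D" using 1 F'(3) by auto
      then show ?thesis by (intro X(2)[OF F(1)])
    next
      case 2
      note T = 2(2,3)
      have "finite T" using T F'(1) finite_subset by blast
      moreover have "v \<notin> T" using T F'(4) by blast
      moreover have w: "w (c T) \<notin> F" using wG(1)[OF c(1)[OF T]] .
      then have "w (c T) \<noteq> v" "w (c T) \<notin> T" using T F'(3) by auto
      ultimately have "card D = d + 1" using 2 d by (simp add: h_def)
      moreover have "D \<subseteq> G (c T)"
      proof (rule order_trans[OF _ wG(3)[OF c(1)[OF T]]])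
        show "D \<subseteq> insert (w (c T)) (F - {c T})"
          using 2 c[OF T] F'(3,4) by (auto simp: h_def)
      qed
      moreover have "v \<in> D" using 2 by (simp add: h_def)
      ultimately show ?thesis using X(2) wG(2)[OF c(1)[OF T]] by blast
    qed
  qed
  ultimately show ?thesis using card_mono[OF X(1)] by metis
qed

text \<open>With \<open>s = k - d + 1\<close> this turns the degree \<open>Suc k choose d\<close>
  into the one required by the handshake count. For \<open>d = 1\<close> it would read
  \<open>2 * s \<le> s + 1\<close>, which fails from \<open>s = 2\<close> on; this is what singles
  out graphs.\<close>

lemma binomial_ge_mult:
  assumes "2 \<le> d"
  shows "(d + 1) * s \<le> (d + s) choose d"
  using assms
proof (induction d rule: dec_induct)
  case base
  have "2 * (3 * s) \<le> (s + 2) * (s + 1)"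
  proof (cases "s \<le> 2")
    case True
    then have "s = 0 \<or> s = 1 \<or> s = 2" by auto
    then show ?thesis by auto
  next
    case False
    then have "3 * s \<le> s * s" by (intro mult_right_mono) auto
    moreover have "(s + 2) * (s + 1) = s * s + 3 * s + 2" by (simp add: algebra_simps)
    ultimately show ?thesis by linarith
  qed
  then show ?case by (simp add: choose_two add.commute)
next
  case (step d)
  show ?case
  proof (cases s)
    case 0
    then show ?thesis by simp
  next
    case (Suc s')
    have "Suc d + s choose Suc d = (d + s choose d) + (d + s choose Suc d)"
      by simp
    \<comment> \<open>By symmetry the coefficient is \<open>d + s choose (s - 1)\<close>, which is
      at least \<open>s choose (s - 1) = s\<close>.\<close>
    moreover have "s \<le> d + s choose Suc d"
    proof -
      have "d + s choose Suc d = d + s choose s'"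
        using binomial_symmetric[of "Suc d" "d + s"] Suc by simp
      moreover have "Suc s' choose s' \<le> d + s choose s'"
        using Suc by (intro binomial_right_mono) auto
      ultimately show ?thesis using Suc by simp
    qed
    ultimately show ?thesis using step.IH by simp
  qed
qed

lemma flag_complex_clique_complex_1: "flag_complex (clique_complex 1 K)"
  unfolding flag_complex_def
proof (intro allI impI)
  fix F assume F: "finite F \<and> (\<forall>u\<in>F. \<forall>v\<in>F. {u, v} \<in> clique_complex 1 K)"
  then have pair: "{u, v} \<in> clique_complex 1 K" if "u \<in> F" "v \<in> F" for u v using that by blast
  have "S \<in> K" if S: "S \<subseteq> F" "card S = 1 + 1" for S
  proof -
    obtain u v where "S = {u, v}" using S(2) unfolding one_add_one card_2_iff by blast
    then show ?thesis using clique_complexD[of "{u, v}" 1 K S] pair[of u v] S by blast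
  qed
  moreover have "F \<subseteq> \<Union>K"
    using pair by (fastforce simp: clique_complex_def)
  ultimately show "F \<in> clique_complex 1 K" by (simp add: clique_complex_def)
qed

text \<open>Each \<open>d\<close>-subset of the ridge \<open>G - {w}\<close> together with
  \<open>w\<close> is a face because \<open>G\<close> is a clique, and it is new because it contains
  \<open>w\<close>.\<close>

lemma card_dfaces_in_insert:
  assumes G: "G \<in> clique_complex d K" "finite G" "card G = Suc k" "w \<in> G" "G - {w} \<subseteq> T"
    and T: "finite T" "w \<notin> T"
  shows "card (dfaces_in d K T) + (k choose d) \<le> card (dfaces_in d K (insert w T))"
proof -
  let ?B = "insert w ` {D. D \<subseteq> G - {w} \<and> card D = d}"
  have "inj_on (insert w) {D. D \<subseteq> G - {w} \<and> card D = d}"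
  proof (rule inj_onI, clarify)
    fix D E assume "D \<subseteq> G - {w}" "E \<subseteq> G - {w}" "insert w D = insert w E"
    then show "D = E" by blast
  qed
  moreover have "card (G - {w}) = k" using G by simp
  ultimately have cB: "card ?B = k choose d"
    using G(2) by (simp add: card_image n_subsets)
  have "dfaces_in d K T \<inter> ?B = {}"
    using T(2) by (auto simp: dfaces_in_def)
  moreover have fB: "finite ?B" using G(2) by auto
  ultimately have "card (dfaces_in d K T \<union> ?B) = card (dfaces_in d K T) + (k choose d)"
    using cB finite_dfaces_in[OF T(1)] by (simp add: card_Un_disjoint)
  moreover have "dfaces_in d K T \<union> ?B \<subseteq> dfaces_in d K (insert w T)"
  proof (rule Un_least)
    show "dfaces_in d K T \<subseteq> dfaces_in d K (insert w T)" by (auto simp: dfaces_in_def)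
    show "?B \<subseteq> dfaces_in d K (insert w T)"
    proof
      fix X assume "X \<in> ?B"
      then obtain D where D: "X = insert w D" "D \<subseteq> G - {w}" "card D = d" by blast
      then have "finite D" "w \<notin> D" "X \<subseteq> G" using G(2,4) finite_subset by blast+
      then have "card X = d + 1" using D by simp
      then show "X \<in> dfaces_in d K (insert w T)"
        using clique_complexD[OF G(1) \<open>X \<subseteq> G\<close>] D G(5) by (auto simp: dfaces_in_def)
    qed
  qed
  ultimately show ?thesis
    using card_mono[OF finite_dfaces_in, of "insert w T" "dfaces_in d K T \<union> ?B" d K] T(1) by simp
qed

text \<open>Either the support of a strongly connected cycle is large, and then growing it vertex by
  vertex produces a dense set of prescribed size, or it is small and itself contains a dense set.\<close>

lemma dense_subset_if_not_acyclic:
  assumes K: "spans_skeleton d n K" and dk: "d \<le> k"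
    and na: "\<not> acyclic_at (Suc k) (clique_complex d K)" and J: "Suc k \<le> J"
  shows "(\<exists>S\<subseteq>{1..n}. card S = J \<and> (J - Suc k) * (k choose d) \<le> card (dfaces_in d K S)) \<or>
    (\<exists>S\<subseteq>{1..n}. S \<noteq> {} \<and> card S \<le> J \<and> card S * (k - d + 1) \<le> card (dfaces_in d K S))"
proof -
  let ?C = "clique_complex d K"
  have d1: "1 \<le> d" using K by (simp add: spans_skeleton_def)
  from na obtain z where z: "z \<in> face_chains (Suc k) ?C" "bd_in UNIV z = 0"
    and nb: "\<And>b. b \<in> face_chains (Suc (Suc k)) ?C \<Longrightarrow> bd_in UNIV b \<noteq> z"
    and conn: "\<And>A. A \<subset> Poly_Mapping.keys z \<Longrightarrow> A \<noteq> {} \<Longrightarrow>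
       \<exists>F\<in>A. \<exists>G\<in>Poly_Mapping.keys z - A. \<exists>u\<in>F. \<exists>w\<in>G. F - {u} = G - {w}"
    using strongly_connected_cycle by blast
  have key: "F \<in> ?C" "finite F" "card F = Suc k" "F \<subseteq> {1..n}" if "F \<in> Poly_Mapping.keys z" for F
    using z(1) that mem_clique_complex[OF K, of F] by (auto simp: face_chains_def)
  have "z \<noteq> 0" using nb[of 0] by (auto simp: face_chains_def)
  then obtain F0 where F0: "F0 \<in> Poly_Mapping.keys z" by fastforce
  define T0 where "T0 = \<Union>(Poly_Mapping.keys z)"
  have T0n: "T0 \<subseteq> {1..n}"
    unfolding T0_def by (rule Union_least) (rule key(4))
  have T0: "finite T0" "T0 \<subseteq> {1..n}"
    using finite_subset[OF T0n] T0n by simp_all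
  \<comment> \<open>Growth starts from a single face \<open>F0\<close> whose own
    \<open>d\<close>-faces are not counted, hence \<open>m - Suc k\<close>. Keeping some face of the
    cycle inside \<open>T\<close> makes strong connectivity applicable: a face outside then shares a
    ridge with one inside and sticks out of \<open>T\<close> by exactly one vertex.\<close>
  have grow: "\<exists>T\<subseteq>T0. card T = m \<and> (m - Suc k) * (k choose d) \<le> card (dfaces_in d K T) \<and>
      (\<exists>F\<in>Poly_Mapping.keys z. F \<subseteq> T)"
    if "Suc k \<le> m" "m \<le> card T0" for m
    using that
  proof (induction m rule: dec_induct)
    case base
    have "F0 \<subseteq> T0" using F0 by (auto simp: T0_def)
    then show ?case using F0 key(3)[OF F0] by (intro exI[of _ F0]) auto
  next
    case (step m)
    then obtain T where T: "T \<subseteq> T0" "card T = m"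
      "(m - Suc k) * (k choose d) \<le> card (dfaces_in d K T)" "\<exists>F\<in>Poly_Mapping.keys z. F \<subseteq> T"
      by auto
    have fT: "finite T" using T(1) T0(1) finite_subset by blast
    define A where "A = {F \<in> Poly_Mapping.keys z. F \<subseteq> T}"
    have "A \<noteq> Poly_Mapping.keys z"
    proof
      assume "A = Poly_Mapping.keys z"
      then have "T0 \<subseteq> T" by (auto simp: A_def T0_def)
      then have "T = T0" using T(1) by blast
      then show False using T(2) step.prems step.hyps by simp
    qed
    then have "A \<subset> Poly_Mapping.keys z" by (auto simp: A_def)
    moreover have "A \<noteq> {}" using T(4) by (auto simp: A_def)
    ultimately have "\<exists>F\<in>A. \<exists>G\<in>Poly_Mapping.keys z - A. \<exists>u\<in>F. \<exists>w\<in>G. F - {u} = G - {w}"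
      by (rule conn)
    then obtain F G u w where FG: "F \<in> A" "G \<in> Poly_Mapping.keys z - A" "u \<in> F" "w \<in> G"
      "F - {u} = G - {w}"
      by (elim bexE) (rule that)
    have sub: "G - {w} \<subseteq> T" using FG(1,5) by (auto simp: A_def)
    have "\<not> G \<subseteq> T" using FG(2) by (auto simp: A_def)
    then have w: "w \<notin> T" using sub by blast
    have G: "G \<in> Poly_Mapping.keys z" using FG(2) by blast
    have "card (dfaces_in d K T) + (k choose d) \<le> card (dfaces_in d K (insert w T))"
      using key[OF G] FG(4) sub fT w by (intro card_dfaces_in_insert) auto
    moreover have "Suc m - Suc k = Suc (m - Suc k)" using step.hyps by simp
    ultimately have "(Suc m - Suc k) * (k choose d) \<le> card (dfaces_in d K (insert w T))"
      using T(3) by simp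
    moreover have "card (insert w T) = Suc m" using fT w T(2) by simp
    moreover have "insert w T \<subseteq> T0" using T(1) FG(4) G by (auto simp: T0_def)
    moreover have "\<exists>F\<in>Poly_Mapping.keys z. F \<subseteq> insert w T" using T(4) by blast
    ultimately show ?case by blast
  qed
  show ?thesis
  proof (cases "J \<le> card T0")
    case True
    then show ?thesis using grow[OF J] T0(2) by (meson order_trans)
  next
    case False
    have "\<exists>S\<subseteq>T0. S \<noteq> {} \<and> card S * (k - d + 1) \<le> card (dfaces_in d K S)"
    proof (cases "d = 1")
      case True
      \<comment> \<open>The cycle \<open>z\<close> lives on \<open>T0\<close>, and a filling there
        would also be a filling in the whole clique complex.\<close>
      have na0: "\<not> acyclic_at (Suc k) {F \<in> ?C. F \<subseteq> T0}"
      proof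
        assume ac: "acyclic_at (Suc k) {F \<in> ?C. F \<subseteq> T0}"
        have "z \<in> face_chains (Suc k) {F \<in> ?C. F \<subseteq> T0}"
          using z(1) by (auto simp: face_chains_def T0_def)
        then obtain b where "b \<in> face_chains (Suc (Suc k)) {F \<in> ?C. F \<subseteq> T0}" "bd_in UNIV b = z"
          using ac z(2) unfolding acyclic_at_def by blast
        moreover from this have "b \<in> face_chains (Suc (Suc k)) ?C" by (auto simp: face_chains_def)
        ultimately show False using nb by blast
      qed
      have vert: "{v} \<in> ?C" if "v \<in> T0" for v
      proof -
        have "card S \<noteq> d + 1" if "S \<subseteq> {v}" for S
          using card_mono[OF _ that] d1 by simp
        then show ?thesis
          using that T0(2) unfolding mem_clique_complex[OF K] by blast
      qed
      have "flag_complex ?C" using flag_complex_clique_complex_1[of K] True by simp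
      from flag_complex_min_degree[OF this down_closed_clique_complex vert T0(1) na0]
      obtain S where S: "S \<subseteq> T0" "S \<noteq> {}"
        and deg: "\<forall>v\<in>S. 2 * k \<le> card {u \<in> S - {v}. {u, v} \<in> ?C}"
        by blast
      have fS: "finite S" using S T0 finite_subset by blast
      have "(d + 1) * (k - d + 1) \<le> card {F \<in> dfaces_in d K S. v \<in> F}" if v: "v \<in> S" for v
      proof -
        have "2 * k \<le> card {u \<in> S - {v}. {u, v} \<in> ?C}" by (rule bspec[OF deg v])
        also have "\<dots> = card ((\<lambda>u. {u, v}) ` {u \<in> S - {v}. {u, v} \<in> ?C})"
          by (rule card_image[symmetric]) (auto simp: inj_on_def doubleton_eq_iff)
        also have "\<dots> \<le> card {F \<in> dfaces_in d K S. v \<in> F}"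
        proof (rule card_mono)
          show "finite {F \<in> dfaces_in d K S. v \<in> F}" using finite_dfaces_in[OF fS] by simp
          show "(\<lambda>u. {u, v}) ` {u \<in> S - {v}. {u, v} \<in> ?C} \<subseteq> {F \<in> dfaces_in d K S. v \<in> F}"
          proof (rule image_subsetI)
            fix u assume "u \<in> {u \<in> S - {v}. {u, v} \<in> ?C}"
            then have u: "u \<in> S" "{u, v} \<in> ?C" "u \<noteq> v" by auto
            then have "{u, v} \<in> K" using True by (intro clique_complexD[OF u(2)]) auto
            then show "{u, v} \<in> {F \<in> dfaces_in d K S. v \<in> F}"
              using u v True by (simp add: dfaces_in_def)
          qed
        qed
        finally show ?thesis using True dk by simp
      qed
      then have "card S * (k - d + 1) \<le> card (dfaces_in d K S)"
        by (rule handshake[OF fS])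
      then show ?thesis using S by blast
    next
      case False
      then have d2: "2 \<le> d" using d1 by simp
      \<comment> \<open>For d \<ge> 2 every vertex of the support already has the required degree,
        so no passage to a smaller vertex set is made.\<close>
      have "(d + 1) * (k - d + 1) \<le> card {F \<in> dfaces_in d K T0. v \<in> F}" if v: "v \<in> T0" for v
      proof -
        obtain F where F: "F \<in> Poly_Mapping.keys z" "v \<in> F" using v by (auto simp: T0_def)
        have "(d + 1) * (k - d + 1) \<le> (d + (k - d + 1)) choose d"
          by (rule binomial_ge_mult[OF d2])
        also have "d + (k - d + 1) = Suc k" using dk by simp
        also have "Suc k choose d \<le> card {F \<in> dfaces_in d K T0. v \<in> F}"
        proof (rule card_faces_at_vertex_of_cycle[OF z F d1 dk])
          show "finite {F \<in> dfaces_in d K T0. v \<in> F}" using finite_dfaces_in[OF T0(1)] by simp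
          fix G D assume GD: "G \<in> Poly_Mapping.keys z" "D \<subseteq> G" "card D = d + 1" "v \<in> D"
          then have "D \<in> K" using clique_complexD[OF key(1)] by blast
          then show "D \<in> {F \<in> dfaces_in d K T0. v \<in> F}"
            using GD by (auto simp: dfaces_in_def T0_def)
        qed
        finally show ?thesis .
      qed
      then have "card T0 * (k - d + 1) \<le> card (dfaces_in d K T0)"
        by (rule handshake[OF T0(1)])
      moreover have "F0 \<noteq> {}" using key(3)[OF F0] by auto
      then have "T0 \<noteq> {}" using F0 unfolding T0_def by blast
      ultimately show ?thesis by blast
    qed
    then obtain S where S: "S \<subseteq> T0" "S \<noteq> {}" "card S * (k - d + 1) \<le> card (dfaces_in d K S)"
      by blast
    moreover have "card S \<le> J" using card_mono[OF T0(1) S(1)] False by simp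
    ultimately show ?thesis using T0(2) by (meson order_trans)
  qed
qed

text \<open>A \<open>(d + 1)\<close>-subset of \<open>insert v F\<close> either lies in the clique
  \<open>F\<close> or consists of \<open>v\<close> and a \<open>d\<close>-subset of
  \<open>W\<close>; hence a common neighbour of all \<open>d\<close>-subsets of \<open>W\<close> is
  an apex for the faces inside \<open>W\<close>.\<close>

lemma acyclic_at_if_common_neighbours:
  assumes K: "spans_skeleton d n K" and n: "2 * j \<le> n"
    and nb: "\<And>W. W \<subseteq> {1..n} \<Longrightarrow> card W = 2 * j \<Longrightarrow>
      \<exists>v\<in>{1..n} - W. \<forall>D\<subseteq>W. card D = d \<longrightarrow> insert v D \<in> K"
  shows "acyclic_at j (clique_complex d K)"
proof (rule acyclic_at_if_coned)
  let ?C = "clique_complex d K"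
  show "down_closed ?C" by (rule down_closed_clique_complex)
  show "finite (\<Union>?C)"
    by (rule finite_subset[of _ "{1..n}"]) (use mem_clique_complex[OF K] in blast, simp)
  show "{} \<in> ?C" by (simp add: mem_clique_complex[OF K])
  show "coned_up_to (2 * j) ?C"
    unfolding coned_up_to_def
  proof (intro allI impI)
    fix W :: "nat set" assume W: "finite W \<and> card W \<le> 2 * j"
    \<comment> \<open>The part of \<open>W\<close> among the vertices is padded to exactly
      \<open>2 * j\<close> elements, so that only sets of one size enter the later union
      bound.\<close>
    have "card (W \<inter> {1..n}) \<le> 2 * j" using W by (meson card_mono inf_le1 order_trans)
    then obtain W' where W': "W \<inter> {1..n} \<subseteq> W'" "W' \<subseteq> {1..n}" "card W' = 2 * j"
      using exists_subset_between[of "W \<inter> {1..n}" "2 * j" "{1..n}"] n by auto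
    obtain v where v: "v \<in> {1..n}" "v \<notin> W'" "\<forall>D\<subseteq>W'. card D = d \<longrightarrow> insert v D \<in> K"
      using nb[OF W'(2,3)] by blast
    have "insert v F \<in> ?C" if F: "F \<in> ?C" "F \<subseteq> W" for F
    proof -
      have Fn: "F \<subseteq> {1..n}" using F(1) mem_clique_complex[OF K] by blast
      then have FW: "F \<subseteq> W'" using F(2) W'(1) by blast
      have "S \<in> K" if S: "S \<subseteq> insert v F" "card S = d + 1" for S
      proof (cases "v \<in> S")
        case True
        have "S - {v} \<subseteq> W'" using S(1) FW by blast
        moreover have "card (S - {v}) = d" using S(2) True by simp
        ultimately have "insert v (S - {v}) \<in> K" using v(3) by blast
        then show ?thesis using True by (simp add: insert_absorb)
      next
        case False
        then have "S \<subseteq> F" using S(1) by blast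
        then show ?thesis using clique_complexD[OF F(1)] S(2) by blast
      qed
      then show ?thesis using v(1) Fn by (simp add: mem_clique_complex[OF K])
    qed
    then show "\<exists>v. \<forall>F\<in>?C. F \<subseteq> W \<longrightarrow> insert v F \<in> ?C" by blast
  qed
qed

section \<open>Probabilities of face patterns\<close>

abbreviation ksets :: "nat \<Rightarrow> nat \<Rightarrow> nat set set" where
  "ksets m n \<equiv> {F. F \<subseteq> {1..n} \<and> card F = m}"

lemma finite_ksets: "finite (ksets m n)"
  by (rule finite_subset[of _ "Pow {1..n}"]) auto

lemma prob_faces_subset:
  assumes "0 \<le> p" "p \<le> 1" "A \<subseteq> ksets (d + 1) n"
  shows "measure_pmf.prob (random_complex d n p) {K. A \<subseteq> K} = p ^ card A"
proof -
  let ?E = "ksets (d + 1) n"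
  have "measure_pmf.prob (random_complex d n p) {K. A \<subseteq> K} =
      measure_pmf.prob (Pi_pmf ?E False (\<lambda>_. bernoulli_pmf p))
        (Pi ?E (\<lambda>F. if F \<in> A then {True} else UNIV))"
    unfolding random_complex_def measure_map_pmf
    by (rule arg_cong[where f = "measure_pmf.prob _"])
      (use assms(3) in \<open>auto simp: Pi_iff subset_iff split: if_splits\<close>)
  also have "\<dots> = (\<Prod>F\<in>?E. measure_pmf.prob (bernoulli_pmf p) (if F \<in> A then {True} else UNIV))"
    by (rule measure_Pi_pmf_Pi[OF finite_ksets])
  also have "\<dots> = (\<Prod>F\<in>?E. if F \<in> A then p else 1)"
    using assms(1,2) by (intro prod.cong) (auto simp: measure_pmf_single)
  also have "\<dots> = (\<Prod>F\<in>?E \<inter> A. p)"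
    by (rule prod.inter_restrict[OF finite_ksets, symmetric])
  also have "?E \<inter> A = A" using assms(3) by blast
  finally show ?thesis by simp
qed

text \<open>Avoiding one more \<open>B i\<close> removes the event with \<open>A\<close> enlarged to
  \<open>A \<union> B i\<close>; disjointness makes exponents add, so each step contributes a factor
  \<open>1 - p ^ card (B i)\<close>.\<close>

lemma prob_faces_subset_avoiding:
  assumes p: "0 \<le> p" "p \<le> 1" and I: "finite I"
    and A: "A \<subseteq> ksets (d + 1) n" "\<And>i. i \<in> I \<Longrightarrow> B i \<subseteq> ksets (d + 1) n"
    and disj: "\<And>i. i \<in> I \<Longrightarrow> A \<inter> B i = {}"
      "\<And>i j. i \<in> I \<Longrightarrow> j \<in> I \<Longrightarrow> i \<noteq> j \<Longrightarrow> B i \<inter> B j = {}"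
  shows "measure_pmf.prob (random_complex d n p) {K. A \<subseteq> K \<and> (\<forall>i\<in>I. \<not> B i \<subseteq> K)} =
    p ^ card A * (\<Prod>i\<in>I. 1 - p ^ card (B i))"
  using I A disj
proof (induction I arbitrary: A rule: finite_induct)
  case empty
  then show ?case using prob_faces_subset[OF p] by simp
next
  case (insert i I)
  let ?P = "measure_pmf.prob (random_complex d n p)"
  have fin: "finite A" "finite (B i)"
    using finite_subset[OF insert.prems(1) finite_ksets]
      finite_subset[OF insert.prems(2) finite_ksets] by simp_all
  have "{K. A \<subseteq> K \<and> (\<forall>j\<in>insert i I. \<not> B j \<subseteq> K)} =
      {K. A \<subseteq> K \<and> (\<forall>j\<in>I. \<not> B j \<subseteq> K)} - {K. A \<union> B i \<subseteq> K \<and> (\<forall>j\<in>I. \<not> B j \<subseteq> K)}"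
    by auto
  then have "?P {K. A \<subseteq> K \<and> (\<forall>j\<in>insert i I. \<not> B j \<subseteq> K)} =
      ?P {K. A \<subseteq> K \<and> (\<forall>j\<in>I. \<not> B j \<subseteq> K)} - ?P {K. A \<union> B i \<subseteq> K \<and> (\<forall>j\<in>I. \<not> B j \<subseteq> K)}"
    by (simp only:) (rule measure_pmf.finite_measure_Diff; auto)
  also have "?P {K. A \<subseteq> K \<and> (\<forall>j\<in>I. \<not> B j \<subseteq> K)} = p ^ card A * (\<Prod>j\<in>I. 1 - p ^ card (B j))"
    using insert.prems by (intro insert.IH) auto
  also have "?P {K. A \<union> B i \<subseteq> K \<and> (\<forall>j\<in>I. \<not> B j \<subseteq> K)} =
      p ^ card (A \<union> B i) * (\<Prod>j\<in>I. 1 - p ^ card (B j))"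
  proof (rule insert.IH)
    show "A \<union> B i \<subseteq> ksets (d + 1) n" using insert.prems(1,2) by simp
    fix j assume j: "j \<in> I"
    then have "i \<noteq> j" using insert.hyps by blast
    then have "A \<inter> B j = {}" "B i \<inter> B j = {}" using insert.prems(3,4) j by simp_all
    then show "(A \<union> B i) \<inter> B j = {}" by blast
  qed (use insert.prems in auto)
  also have "card (A \<union> B i) = card A + card (B i)"
    using fin insert.prems(3)[of i] by (simp add: card_Un_disjoint)
  also have "p ^ card A * (\<Prod>j\<in>I. 1 - p ^ card (B j)) -
      p ^ (card A + card (B i)) * (\<Prod>j\<in>I. 1 - p ^ card (B j)) =
      p ^ card A * (\<Prod>j\<in>insert i I. 1 - p ^ card (B j))"
    using insert.hyps by (simp add: power_add algebra_simps)
  finally show ?case .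
qed

lemma prob_UN_le:
  fixes c :: real
  assumes "finite I" "X \<subseteq> (\<Union>i\<in>I. Y i)" "\<And>i. i \<in> I \<Longrightarrow> measure_pmf.prob M (Y i) \<le> c"
  shows "measure_pmf.prob M X \<le> card I * c"
proof -
  have "measure_pmf.prob M X \<le> measure_pmf.prob M (\<Union>i\<in>I. Y i)"
    by (rule measure_pmf.finite_measure_mono) (use assms(2) in auto)
  also have "\<dots> \<le> (\<Sum>i\<in>I. measure_pmf.prob M (Y i))"
    by (rule measure_UNION_le) (use assms(1) in auto)
  also have "\<dots> \<le> card I * c"
    using sum_mono[OF assms(3)] by simp
  finally show ?thesis .
qed

lemma spans_skeleton_random_complex:
  assumes "1 \<le> d" "K \<in> set_pmf (random_complex d n p)"
  shows "spans_skeleton d n K"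
  using assms unfolding spans_skeleton_def random_complex_def by auto

definition dense_event :: "nat \<Rightarrow> nat \<Rightarrow> nat \<Rightarrow> nat \<Rightarrow> nat set set set" where
  "dense_event d n j e = {K. \<exists>S\<subseteq>{1..n}. card S = j \<and> e \<le> card (dfaces_in d K S)}"

text \<open>Union bound over the vertex set \<open>S\<close> and a family of \<open>e\<close> faces
  in it. The factor \<open>2 ^ 2 ^ j\<close> crudely counts all families of subsets of a
  \<open>j\<close>-set; only its independence of \<open>n\<close> matters.\<close>

lemma prob_dense_event:
  assumes "0 \<le> p" "p \<le> 1"
  shows "measure_pmf.prob (random_complex d n p) (dense_event d n j e) \<le> real n ^ j * 2 ^ 2 ^ j * p ^ e"
proof -
  define I where "I = (SIGMA S:ksets j n. {A. A \<subseteq> ksets (d + 1) n \<inter> Pow S \<and> card A = e})"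
  have fI: "finite I"
    unfolding I_def by (intro finite_SigmaI finite_ksets) (auto intro: finite_subset[OF _ finite_ksets])
  have "card I = (\<Sum>S\<in>ksets j n. card {A. A \<subseteq> ksets (d + 1) n \<inter> Pow S \<and> card A = e})"
    unfolding I_def by (rule card_SigmaI)
      (auto intro: finite_ksets finite_subset[OF _ finite_Pow_iff[THEN iffD2, OF finite_ksets]])
  also have "\<dots> \<le> (\<Sum>S\<in>ksets j n. 2 ^ 2 ^ j)"
  proof (rule sum_mono)
    fix S assume S: "S \<in> ksets j n"
    then have fS: "finite S" using finite_subset by blast
    have "card {A. A \<subseteq> ksets (d + 1) n \<inter> Pow S \<and> card A = e} \<le> card (Pow (Pow S))"
      using fS by (intro card_mono) auto
    also have "\<dots> = 2 ^ 2 ^ j" using fS S by (simp add: card_Pow)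
    finally show "card {A. A \<subseteq> ksets (d + 1) n \<inter> Pow S \<and> card A = e} \<le> 2 ^ 2 ^ j" .
  qed
  also have "\<dots> = (n choose j) * 2 ^ 2 ^ j"
    using n_subsets[of "{1..n}" j] by simp
  also have "\<dots> \<le> n ^ j * 2 ^ 2 ^ j"
    by (cases "j \<le> n") (auto simp: binomial_le_pow binomial_eq_0)
  finally have "card I \<le> n ^ j * 2 ^ 2 ^ j" .
  then have cI: "real (card I) \<le> real n ^ j * 2 ^ 2 ^ j"
    by (metis (mono_tags, lifting) of_nat_le_iff of_nat_mult of_nat_numeral of_nat_power)
  have "measure_pmf.prob (random_complex d n p) (dense_event d n j e) \<le> card I * p ^ e"
  proof (rule prob_UN_le[OF fI])
    show "dense_event d n j e \<subseteq> (\<Union>i\<in>I. {K. snd i \<subseteq> K})"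
    proof
      fix K assume "K \<in> dense_event d n j e"
      then obtain S where S: "S \<subseteq> {1..n}" "card S = j" "e \<le> card (dfaces_in d K S)"
        by (auto simp: dense_event_def)
      then obtain A where A: "A \<subseteq> dfaces_in d K S" "card A = e"
        by (metis obtain_subset_with_card_n)
      then have "A \<subseteq> ksets (d + 1) n \<inter> Pow S" "A \<subseteq> K"
        using S(1) by (auto simp: dfaces_in_def)
      then have "(S, A) \<in> I" using S A by (simp add: I_def)
      then show "K \<in> (\<Union>i\<in>I. {K. snd i \<subseteq> K})" using \<open>A \<subseteq> K\<close> by force
    qed
    fix i assume "i \<in> I"
    then have "snd i \<subseteq> ksets (d + 1) n" "card (snd i) = e" by (auto simp: I_def)
    then show "measure_pmf.prob (random_complex d n p) {K. snd i \<subseteq> K} \<le> p ^ e"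
      using prob_faces_subset[OF assms] by simp
  qed
  also have "\<dots> \<le> real n ^ j * 2 ^ 2 ^ j * p ^ e"
    by (intro mult_right_mono cI) (use assms in simp)
  finally show ?thesis .
qed

section \<open>Asymptotics\<close>

text \<open>The implication is required only for samples in the support and for large
  \<open>n\<close>, so it can be supplied by deterministic combinatorics; probability enters through
  \<open>Bad\<close> alone.\<close>

lemma asymptotically_almost_surelyI:
  assumes bad: "(\<lambda>n. measure_pmf.prob (M n) (Bad n)) \<longlonglongrightarrow> 0"
    and good: "\<forall>\<^sub>F n in sequentially. \<forall>x\<in>set_pmf (M n). x \<notin> Bad n \<longrightarrow> P x"
  shows "asymptotically_almost_surely M P"
  unfolding asymptotically_almost_surely_def
proof (rule tendsto_sandwich[of "\<lambda>n. 1 - measure_pmf.prob (M n) (Bad n)" _ _ "\<lambda>_. 1"])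
  show "\<forall>\<^sub>F n in sequentially. 1 - measure_pmf.prob (M n) (Bad n) \<le> measure_pmf.prob (M n) {x. P x}"
    using good
  proof eventually_elim
    case (elim n)
    have "1 - measure_pmf.prob (M n) (Bad n) = measure_pmf.prob (M n) (- Bad n)"
      by (simp add: measure_pmf.prob_compl[of "Bad n", simplified] Compl_eq_Diff_UNIV)
    also have "\<dots> = measure_pmf.prob (M n) (- Bad n \<inter> set_pmf (M n))"
      by (simp add: measure_Int_set_pmf)
    also have "\<dots> \<le> measure_pmf.prob (M n) {x. P x}"
      by (rule measure_pmf.finite_measure_mono) (use elim in auto)
    finally show ?case .
  qed
  show "(\<lambda>n. 1 - measure_pmf.prob (M n) (Bad n)) \<longlonglongrightarrow> 1"
    using tendsto_diff[OF tendsto_const[of 1] bad] by simp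
qed auto

text \<open>Capping at 1 keeps this a probability for positive \<alpha>; for
  \<open>n \<ge> 1\<close> it amounts to replacing \<alpha> by
  \<open>min \<alpha> 0\<close>.\<close>

definition edge_prob :: "real \<Rightarrow> nat \<Rightarrow> real" where
  "edge_prob \<alpha> n = min 1 (real n powr \<alpha>)"

lemma edge_prob_bounds: "0 \<le> edge_prob \<alpha> n" "edge_prob \<alpha> n \<le> 1"
  by (auto simp: edge_prob_def)

lemma edge_prob_eq: "1 \<le> n \<Longrightarrow> edge_prob \<alpha> n = real n powr min \<alpha> 0"
proof (cases "\<alpha> \<le> 0")
  case True
  assume "1 \<le> n"
  then have "real n powr \<alpha> \<le> real n powr 0" using True by (intro powr_mono) auto
  then show ?thesis using True \<open>1 \<le> n\<close> by (simp add: edge_prob_def min_def)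
next
  case False
  assume "1 \<le> n"
  then have "real n powr 0 \<le> real n powr \<alpha>" using False by (intro powr_mono) auto
  then show ?thesis using False \<open>1 \<le> n\<close> by (simp add: edge_prob_def min_def)
qed

lemma power_edge_prob:
  assumes "\<alpha> \<le> 0" "1 \<le> n"
  shows "real n ^ j * edge_prob \<alpha> n ^ e = real n powr (real j + \<alpha> * real e)"
  using assms by (simp add: edge_prob_eq min_absorb1 powr_add powr_power powr_realpow mult.commute)

lemma power_edge_prob_tendsto_0:
  assumes "\<alpha> \<le> 0" "real j + \<alpha> * real e < 0"
  shows "(\<lambda>n. real n ^ j * edge_prob \<alpha> n ^ e) \<longlonglongrightarrow> 0"
proof -
  have "(\<lambda>n. real n powr (real j + \<alpha> * real e)) \<longlonglongrightarrow> 0"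
    by (rule tendsto_neg_powr[OF assms(2) filterlim_real_sequentially])
  then show ?thesis
    by (rule Lim_transform_eventually)
      (use eventually_ge_at_top[of 1] in \<open>eventually_elim; simp add: power_edge_prob[OF assms(1)]\<close>)
qed

lemma dense_event_tendsto_0:
  assumes "\<alpha> \<le> 0" "real j + \<alpha> * real e < 0"
  shows "(\<lambda>n. measure_pmf.prob (random_complex d n (edge_prob \<alpha> n)) (dense_event d n j e)) \<longlonglongrightarrow> 0"
proof (rule tendsto_sandwich[OF _ _ tendsto_const])
  show "(\<lambda>n. 2 ^ 2 ^ j * (real n ^ j * edge_prob \<alpha> n ^ e)) \<longlonglongrightarrow> 0"
    by (rule tendsto_mult_right_zero[OF power_edge_prob_tendsto_0[OF assms]])
  show "\<forall>\<^sub>F n in sequentially. measure_pmf.prob (random_complex d n (edge_prob \<alpha> n)) (dense_event d n j e)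
      \<le> 2 ^ 2 ^ j * (real n ^ j * edge_prob \<alpha> n ^ e)"
    using prob_dense_event[OF edge_prob_bounds] by (intro always_eventually allI) (simp add: mult.commute mult.left_commute)
qed auto

section \<open>Vanishing homology\<close>

lemma trivial_homology_random_complex:
  assumes "1 \<le> d" "K \<in> set_pmf (random_complex d n p)"
  shows "trivial_group (reduced_simplicial_homology k (clique_complex d K)) \<longleftrightarrow>
    acyclic_at (Suc k) (clique_complex d K)"
  using trivial_homology_iff_acyclic_at simplicial_complex_clique_complex
    simplicial_complex_random_complex assms by blast

lemma dense_events_tendsto_0:
  assumes "finite I" "\<alpha> \<le> 0" "\<And>j e. (j, e) \<in> I \<Longrightarrow> real j + \<alpha> * real e < 0"
  shows "(\<lambda>n. measure_pmf.prob (random_complex d n (edge_prob \<alpha> n)) (\<Union>(j, e)\<in>I. dense_event d n j e))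
    \<longlonglongrightarrow> 0"
proof (rule tendsto_sandwich[OF _ _ tendsto_const])
  let ?P = "\<lambda>n. measure_pmf.prob (random_complex d n (edge_prob \<alpha> n))"
  show "(\<lambda>n. \<Sum>(j, e)\<in>I. ?P n (dense_event d n j e)) \<longlonglongrightarrow> 0"
    by (rule tendsto_null_sum) (use dense_event_tendsto_0[OF assms(2)] assms(3) in auto)
  show "\<forall>\<^sub>F n in sequentially. ?P n (\<Union>(j, e)\<in>I. dense_event d n j e) \<le> (\<Sum>(j, e)\<in>I. ?P n (dense_event d n j e))"
    unfolding case_prod_unfold by (intro always_eventually allI measure_UNION_le assms(1)) simp
qed auto

text \<open>A \<open>k\<close>-face requires all \<open>Suc k choose Suc d\<close> of its
  \<open>d\<close>-faces. By the absorption identity, the exponent of \<open>n\<close> in the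
  expected number of \<open>k\<close>-faces is a positive multiple of
  \<open>d + 1 + \<alpha> * (k choose d)\<close>, which is negative.\<close>

lemma trivial_homology_no_faces:
  assumes d: "1 \<le> d" "d \<le> k" and \<alpha>: "\<alpha> < - (real d + 1) / real (k choose d)"
  shows "asymptotically_almost_surely (\<lambda>n. random_complex d n (edge_prob \<alpha> n))
    (\<lambda>X. trivial_group (reduced_simplicial_homology k (clique_complex d X)))"
proof (rule asymptotically_almost_surelyI)
  let ?e = "Suc k choose Suc d"
  have C: "0 < real (k choose d)" using d by simp
  then have neg: "\<alpha> * real (k choose d) < - (real d + 1)"
    using \<alpha> by (simp add: pos_less_divide_eq)
  have eq: "(real d + 1) * real ?e = (real k + 1) * real (k choose d)"
    using Suc_times_binomial[of d k] by (metis of_nat_Suc of_nat_mult add.commute)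
  have "(real d + 1) * (real (Suc k) + \<alpha> * real ?e) =
      (real k + 1) * (real d + 1) + \<alpha> * ((real d + 1) * real ?e)" by (simp add: algebra_simps)
  also have "\<dots> = (real k + 1) * ((real d + 1) + \<alpha> * real (k choose d))"
    unfolding eq by (simp add: algebra_simps)
  also have "\<dots> < 0" using neg by (intro mult_pos_neg) auto
  finally have "real (Suc k) + \<alpha> * real ?e < 0"
    by (simp add: mult_less_0_iff del: of_nat_Suc)
  moreover have "\<alpha> \<le> 0" using neg C by (smt (verit) mult_nonneg_nonneg of_nat_0_le_iff)
  ultimately show "(\<lambda>n. measure_pmf.prob (random_complex d n (edge_prob \<alpha> n)) (dense_event d n (Suc k) ?e))
      \<longlonglongrightarrow> 0"
    by (intro dense_event_tendsto_0)
  show "\<forall>\<^sub>F n in sequentially. \<forall>K\<in>set_pmf (random_complex d n (edge_prob \<alpha> n)).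
      K \<notin> dense_event d n (Suc k) ?e \<longrightarrow>
      trivial_group (reduced_simplicial_homology k (clique_complex d K))"
  proof (intro always_eventually allI ballI impI)
    fix n K assume K: "K \<in> set_pmf (random_complex d n (edge_prob \<alpha> n))"
      "K \<notin> dense_event d n (Suc k) ?e"
    have sk: "spans_skeleton d n K" using spans_skeleton_random_complex d(1) K(1) by blast
    have "False" if F: "F \<in> clique_complex d K" "finite F" "card F = Suc k" for F
    proof -
      have "dfaces_in d K F = {S. S \<subseteq> F \<and> card S = d + 1}"
        using clique_complexD[OF F(1)] by (auto simp: dfaces_in_def)
      then have "card (dfaces_in d K F) = ?e"
        using n_subsets[OF F(2), of "d + 1"] F(3) by simp
      moreover have "F \<subseteq> {1..n}" using mem_clique_complex[OF sk] F(1) by blast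
      ultimately have "K \<in> dense_event d n (Suc k) ?e"
        using F(3) unfolding dense_event_def by (intro CollectI exI[of _ F]) simp
      then show False using K(2) by blast
    qed
    then have "acyclic_at (Suc k) (clique_complex d K)"
      by (intro acyclic_at_cone) blast
    then show "trivial_group (reduced_simplicial_homology k (clique_complex d K))"
      using trivial_homology_random_complex[OF d(1) K(1)] by simp
  qed
qed

section \<open>The sparse range\<close>

lemma binomial_ge_diff:
  assumes "1 \<le> d" "d \<le> k"
  shows "k - d + 1 \<le> k choose d"
  using assms(2)
proof (induction k rule: dec_induct)
  case (step k)
  obtain d' where d': "d = Suc d'" using assms(1) by (cases d) auto
  have "1 \<le> k choose d'" using step.hyps d' by (simp add: Suc_le_eq)
  moreover have "Suc k choose d = (k choose d') + (k choose d)" unfolding d' by simp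
  ultimately show ?case using step.IH step.hyps by linarith
qed simp

lemma trivial_homology_sparse:
  assumes d: "1 \<le> d" "d \<le> k" and \<alpha>: "\<alpha> < - 1 / (real k - real d + 1)"
  shows "asymptotically_almost_surely (\<lambda>n. random_complex d n (edge_prob \<alpha> n))
    (\<lambda>X. trivial_group (reduced_simplicial_homology k (clique_complex d X)))"
proof -
  define s b where "s = k - d + 1" and "b = k choose d"
  have rs: "real s = real k - real d + 1" using d by (simp add: s_def of_nat_diff)
  have s0: "0 < real s" by (simp add: s_def)
  have neg: "\<alpha> * real s < - 1"
    using \<alpha> s0 unfolding rs by (simp only: pos_less_divide_eq)
  then have \<alpha>0: "\<alpha> < 0" using s0 by (smt (verit) mult_nonneg_nonneg)
  \<comment> \<open>Each vertex gained by growth brings \<open>b\<close> faces, at least the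
    critical density \<open>s\<close>; so growth lowers the exponent of the expected count.\<close>
  have "real s \<le> real b" unfolding s_def b_def using binomial_ge_diff[OF d] of_nat_mono by blast
  then have nb: "1 + \<alpha> * real b < 0"
    using mult_left_mono_neg[of "real s" "real b" \<alpha>] \<alpha>0 neg by linarith
  \<comment> \<open>The size \<open>J\<close> is chosen so that
    \<open>J + \<alpha> * (J - Suc k) * b < 0\<close>: since \<open>1 + \<alpha> * b < 0\<close>, a
    large \<open>J\<close> outweighs the missing faces of the initial \<open>Suc k\<close>
    vertices.\<close>
  obtain J0 :: nat where J0: "\<alpha> * (real (Suc k) * real b) / (1 + \<alpha> * real b) < real J0"
    using reals_Archimedean2 by blast
  define J where "J = max J0 (Suc k)"
  have J: "Suc k \<le> J" by (simp add: J_def)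
  have "\<alpha> * (real (Suc k) * real b) / (1 + \<alpha> * real b) < real J"
    using J0 by (simp add: J_def)
  then have "real J * (1 + \<alpha> * real b) < \<alpha> * (real (Suc k) * real b)"
    using nb by (simp add: neg_divide_less_eq)
  then have Jneg: "real J + \<alpha> * real ((J - Suc k) * b) < 0"
    unfolding of_nat_mult of_nat_diff[OF J] by (simp add: algebra_simps)
  \<comment> \<open>One entry for the grown set of size exactly \<open>J\<close>, and one for each
    possible size of a dense set within a small support. The list does not depend on
    \<open>n\<close>, so finitely many limits suffice.\<close>
  define I where "I = insert (J, (J - Suc k) * b) ((\<lambda>m. (m, m * s)) ` {1..J})"
  define Bad where "Bad n = (\<Union>(j, e)\<in>I. dense_event d n j e)" for n
  show ?thesis
  proof (rule asymptotically_almost_surelyI[where Bad = Bad])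
    show "(\<lambda>n. measure_pmf.prob (random_complex d n (edge_prob \<alpha> n)) (Bad n)) \<longlonglongrightarrow> 0"
      unfolding Bad_def
    proof (rule dense_events_tendsto_0)
      fix j e assume "(j, e) \<in> I"
      then consider "j = J" "e = (J - Suc k) * b" | "1 \<le> j" "e = j * s"
        by (auto simp: I_def)
      then show "real j + \<alpha> * real e < 0"
      proof cases
        case 1
        show ?thesis unfolding 1 by (rule Jneg)
      next
        case 2
        have "real j * (1 + \<alpha> * real s) < 0" using 2 neg by (intro mult_pos_neg) auto
        then show ?thesis using 2 by (simp add: algebra_simps)
      qed
    qed (use \<alpha>0 in \<open>auto simp: I_def\<close>)
    show "\<forall>\<^sub>F n in sequentially. \<forall>K\<in>set_pmf (random_complex d n (edge_prob \<alpha> n)).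
        K \<notin> Bad n \<longrightarrow> trivial_group (reduced_simplicial_homology k (clique_complex d K))"
    proof (intro always_eventually allI ballI impI, rule ccontr)
      fix n K assume K: "K \<in> set_pmf (random_complex d n (edge_prob \<alpha> n))" "K \<notin> Bad n"
        "\<not> trivial_group (reduced_simplicial_homology k (clique_complex d K))"
      have "spans_skeleton d n K" using spans_skeleton_random_complex d(1) K(1) by blast
      moreover have "\<not> acyclic_at (Suc k) (clique_complex d K)"
        using trivial_homology_random_complex[OF d(1) K(1)] K(3) by simp
      ultimately consider
        S where "S \<subseteq> {1..n}" "card S = J" "(J - Suc k) * b \<le> card (dfaces_in d K S)"
        | S where "S \<subseteq> {1..n}" "S \<noteq> {}" "card S \<le> J" "card S * s \<le> card (dfaces_in d K S)"
        using dense_subset_if_not_acyclic[OF _ d(2) _ J] unfolding s_def b_def by metis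
      then have "K \<in> Bad n"
      proof cases
        case 1
        then have "K \<in> dense_event d n J ((J - Suc k) * b)" by (auto simp: dense_event_def)
        then show ?thesis by (auto simp: Bad_def I_def)
      next
        case 2
        then have "K \<in> dense_event d n (card S) (card S * s)" by (auto simp: dense_event_def)
        moreover have "card S \<in> {1..J}"
          using 2 finite_subset[OF 2(1)] by (auto simp: Suc_le_eq card_gt_0_iff)
        ultimately show ?thesis by (auto simp: Bad_def I_def)
      qed
      then show False using K(2) by blast
    qed
  qed
qed

section \<open>The dense range\<close>

lemma power_times_exp_tendsto_0:
  fixes c \<gamma> :: real
  assumes "0 < \<gamma>"
  shows "(\<lambda>n::nat. real n ^ m * exp (c - real n powr \<gamma>)) \<longlonglongrightarrow> 0"
  using assms by real_asymp

text \<open>For \<open>v\<close> outside \<open>W\<close>, these are the faces whose presence makes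
  \<open>v\<close> a common neighbour of all \<open>d\<close>-subsets of \<open>W\<close>.\<close>

definition coface :: "nat \<Rightarrow> 'a set \<Rightarrow> 'a \<Rightarrow> 'a set set" where
  "coface d W v = insert v ` {D. D \<subseteq> W \<and> card D = d}"

lemma coface_subset_ksets:
  assumes "W \<subseteq> {1..n}" "v \<in> {1..n}" "v \<notin> W"
  shows "coface d W v \<subseteq> ksets (d + 1) n"
proof
  fix F assume "F \<in> coface d W v"
  then obtain D where D: "F = insert v D" "D \<subseteq> W" "card D = d" by (auto simp: coface_def)
  have "finite D" by (rule finite_subset[of _ "{1..n}"]) (use D assms in auto)
  moreover have "v \<notin> D" using D assms by blast
  ultimately show "F \<in> ksets (d + 1) n" using D assms by auto
qed

lemma card_coface:
  assumes "finite W" "v \<notin> W"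
  shows "card (coface d W v) = card W choose d"
proof -
  have "inj_on (insert v) {D. D \<subseteq> W \<and> card D = d}"
  proof (rule inj_onI)
    fix D E assume DE: "D \<in> {D. D \<subseteq> W \<and> card D = d}" "E \<in> {D. D \<subseteq> W \<and> card D = d}"
      "insert v D = insert v E"
    then have "v \<notin> D" "v \<notin> E" using assms(2) by auto
    then show "D = E" using DE(3) by (metis insert_ident)
  qed
  then show ?thesis using n_subsets[OF assms(1)] by (simp add: coface_def card_image)
qed

lemma disjoint_coface:
  assumes "v \<notin> W" "w \<notin> W" "v \<noteq> w"
  shows "coface d W v \<inter> coface d W w = {}"
proof -
  have False if F: "F \<in> coface d W v" "F \<in> coface d W w" for F
  proof -
    have "v \<in> F" using F(1) by (auto simp: coface_def)
    moreover have "F \<subseteq> insert w W" using F(2) by (auto simp: coface_def)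
    ultimately show False using assms by blast
  qed
  then show ?thesis by blast
qed

text \<open>For a fixed \<open>W\<close>, the outside vertices are independent trials with success
  probability \<open>p ^ b\<close>, as their coface sets are disjoint. All fail with probability at
  most \<open>exp (c - n * p ^ b)\<close>; since \<open>n * p ^ b\<close> is a positive power of
  \<open>n\<close>, this beats the at most \<open>n ^ c\<close> choices of \<open>W\<close>.\<close>

lemma trivial_homology_dense:
  assumes d: "1 \<le> d" "d \<le> k" and \<alpha>: "- 1 / real ((2 * k + 2) choose d) < \<alpha>"
  shows "asymptotically_almost_surely (\<lambda>n. random_complex d n (edge_prob \<alpha> n))
    (\<lambda>X. trivial_group (reduced_simplicial_homology k (clique_complex d X)))"
proof -
  \<comment> \<open>\<open>c\<close> is \<open>2 * Suc k\<close>, the coning budget for faces with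
    \<open>Suc k\<close> vertices; \<open>\<beta>\<close> is the effective exponent of the capped
    probability.\<close>
  define c b \<beta> where "c = 2 * k + 2" and "b = c choose d" and "\<beta> = min \<alpha> 0"
  have b: "0 < real b" using d by (simp add: b_def c_def)
  have "- 1 / real b < \<beta>" using \<alpha> b by (auto simp: \<beta>_def b_def c_def)
  then have "- 1 < \<beta> * real b" using b by (simp only: pos_divide_less_eq)
  then have \<gamma>: "0 < 1 + \<beta> * real b" by simp
  define Bad where "Bad n = {K. \<exists>W\<in>ksets c n. \<forall>v\<in>{1..n} - W. \<not> coface d W v \<subseteq> K}" for n
  show ?thesis
  proof (rule asymptotically_almost_surelyI[where Bad = Bad])
    show "(\<lambda>n. measure_pmf.prob (random_complex d n (edge_prob \<alpha> n)) (Bad n)) \<longlonglongrightarrow> 0"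
    proof (rule tendsto_sandwich[OF _ _ tendsto_const power_times_exp_tendsto_0[OF \<gamma>, of c "real c"]])
      show "\<forall>\<^sub>F n in sequentially. measure_pmf.prob (random_complex d n (edge_prob \<alpha> n)) (Bad n)
          \<le> real n ^ c * exp (real c - real n powr (1 + \<beta> * real b))"
        using eventually_ge_at_top[of "max 1 c"]
      proof eventually_elim
        case (elim n)
        define p where "p = edge_prob \<alpha> n"
        have p: "0 \<le> p" "p \<le> 1" using edge_prob_bounds by (auto simp: p_def)
        have n: "1 \<le> n" "c \<le> n" using elim by auto
        have "measure_pmf.prob (random_complex d n p) (Bad n) \<le>
            card (ksets c n) * (1 - p ^ b) ^ (n - c)"
        proof (rule prob_UN_le[OF finite_ksets])
          show "Bad n \<subseteq> (\<Union>W\<in>ksets c n. {K. {} \<subseteq> K \<and> (\<forall>v\<in>{1..n} - W. \<not> coface d W v \<subseteq> K)})"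
            by (auto simp: Bad_def)
          fix W assume W: "W \<in> ksets c n"
          then have fW: "finite W" using finite_subset by blast
          have "measure_pmf.prob (random_complex d n p)
              {K. {} \<subseteq> K \<and> (\<forall>v\<in>{1..n} - W. \<not> coface d W v \<subseteq> K)} =
              p ^ card ({} :: nat set set) * (\<Prod>v\<in>{1..n} - W. 1 - p ^ card (coface d W v))"
          proof (rule prob_faces_subset_avoiding[OF p])
            show "coface d W v \<subseteq> ksets (d + 1) n" if "v \<in> {1..n} - W" for v
              using that W by (intro coface_subset_ksets) auto
            show "coface d W v \<inter> coface d W w = {}"
              if "v \<in> {1..n} - W" "w \<in> {1..n} - W" "v \<noteq> w" for v w
              using that by (intro disjoint_coface) auto
          qed auto
          also have "(\<Prod>v\<in>{1..n} - W. 1 - p ^ card (coface d W v)) = (\<Prod>v\<in>{1..n} - W. 1 - p ^ b)"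
            using W by (intro prod.cong refl) (simp add: card_coface[OF fW] b_def)
          also have "p ^ card ({} :: nat set set) * \<dots> = (1 - p ^ b) ^ card ({1..n} - W)"
            by simp
          also have "card ({1..n} - W) = n - c"
            using W fW by (simp add: card_Diff_subset)
          finally show "measure_pmf.prob (random_complex d n p)
              {K. {} \<subseteq> K \<and> (\<forall>v\<in>{1..n} - W. \<not> coface d W v \<subseteq> K)} \<le> (1 - p ^ b) ^ (n - c)"
            by simp
        qed
        also have "\<dots> \<le> real n ^ c * exp (real c - real n powr (1 + \<beta> * real b))"
        proof (rule mult_mono)
          show "real (card (ksets c n)) \<le> real n ^ c"
            using n_subsets[of "{1..n}" c] binomial_le_pow[OF n(2)]
            by (metis (mono_tags, lifting) card_atLeastAtMost diff_Suc_1 finite_atLeastAtMost of_nat_le_iff of_nat_power)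
          have pb: "p ^ b \<le> 1" "0 \<le> p ^ b" using p by (auto intro: power_le_one)
          have "(1 - p ^ b) ^ (n - c) \<le> exp (- (p ^ b)) ^ (n - c)"
            using exp_ge_add_one_self[of "- (p ^ b)"] pb by (intro power_mono) auto
          also have "\<dots> = exp (real (n - c) * - (p ^ b))" by (simp only: exp_of_nat_mult)
          also have "\<dots> \<le> exp (real c - real n powr (1 + \<beta> * real b))"
          proof -
            have "real n * p ^ b = real n powr (1 + \<beta> * real b)"
              using n by (simp add: p_def edge_prob_eq \<beta>_def powr_add powr_power mult.commute)
            \<comment> \<open>Replacing the \<open>n - c\<close> trials by \<open>n\<close> costs at
              most \<open>c\<close> in the exponent because \<open>p ^ b \<le> 1\<close>.\<close>
            moreover have "real c * p ^ b \<le> real c"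
              using pb by (simp add: mult_left_le)
            ultimately show ?thesis unfolding of_nat_diff[OF n(2)] by (simp add: algebra_simps)
          qed
          finally show "(1 - p ^ b) ^ (n - c) \<le> exp (real c - real n powr (1 + \<beta> * real b))" .
          show "0 \<le> (1 - p ^ b) ^ (n - c)" using pb by simp
        qed simp
        finally show ?case by (simp add: p_def)
      qed
    qed auto
    show "\<forall>\<^sub>F n in sequentially. \<forall>K\<in>set_pmf (random_complex d n (edge_prob \<alpha> n)).
        K \<notin> Bad n \<longrightarrow> trivial_group (reduced_simplicial_homology k (clique_complex d K))"
      using eventually_ge_at_top[of c]
    proof (eventually_elim, intro ballI impI)
      fix n K assume n: "c \<le> n" and K: "K \<in> set_pmf (random_complex d n (edge_prob \<alpha> n))" "K \<notin> Bad n"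
      have "acyclic_at (Suc k) (clique_complex d K)"
      proof (rule acyclic_at_if_common_neighbours)
        show "spans_skeleton d n K" using spans_skeleton_random_complex d(1) K(1) by blast
        show "2 * Suc k \<le> n" using n by (simp add: c_def)
        fix W assume "W \<subseteq> {1..n}" "card W = 2 * Suc k"
        then have "W \<in> ksets c n" by (simp add: c_def)
        then obtain v where "v \<in> {1..n} - W" "coface d W v \<subseteq> K"
          using K(2) unfolding Bad_def by blast
        then show "\<exists>v\<in>{1..n} - W. \<forall>D\<subseteq>W. card D = d \<longrightarrow> insert v D \<in> K"
          by (intro bexI[of _ v]) (auto simp: coface_def)
      qed
      then show "trivial_group (reduced_simplicial_homology k (clique_complex d K))"
        using trivial_homology_random_complex[OF d(1) K(1)] by simp
    qed
  qed
qed

section \<open>The second moment method\<close>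

text \<open>Chebyshev and Markov in one estimate. With \<open>N\<close> the number of events
  \<open>A x\<close> that occur and \<open>Nb\<close> the same for \<open>B x\<close>, the event
  forces \<open>N \<le> Nb\<close>. So either \<open>N\<close> is at most half its mean \<mu>,
  costing \<open>4 * \<epsilon>\<close>, or \<open>Nb\<close> exceeds half of \<mu>, costing
  \<open>2 * \<delta>\<close>.\<close>

lemma second_moment_bound:
  fixes M :: "'a pmf" and A B :: "'b \<Rightarrow> 'a set" and a \<epsilon> \<delta> :: real
  assumes X: "finite X" "X \<noteq> {}" and a: "0 < a"
    and PA: "\<And>x. x \<in> X \<Longrightarrow> measure_pmf.prob M (A x) = a"
    and PAA: "(\<Sum>x\<in>X. \<Sum>y\<in>X. measure_pmf.prob M (A x \<inter> A y)) \<le> (1 + \<epsilon>) * (card X * a)\<^sup>2"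
    and PB: "\<And>x. x \<in> X \<Longrightarrow> measure_pmf.prob M (B x) \<le> \<delta> * a"
  shows "measure_pmf.prob M {K. \<forall>x\<in>X. K \<in> A x \<longrightarrow> K \<in> B x} \<le> 4 * \<epsilon> + 2 * \<delta>"
proof -
  define \<mu> where "\<mu> = card X * a"
  have \<mu>: "0 < \<mu>" using X a by (simp add: \<mu>_def card_gt_0_iff)
  define E where "E = {K. \<forall>x\<in>X. K \<in> A x \<longrightarrow> K \<in> B x}"
  define N Nb :: "'a \<Rightarrow> real" where "N K = (\<Sum>x\<in>X. indicator (A x) K)"
    and "Nb K = (\<Sum>x\<in>X. indicator (B x) K)" for K
  \<comment> \<open>The expanded form of
    \<open>4 * ((N - \<mu>) / \<mu>)^2 + 2 * Nb / \<mu>\<close>, a pointwise upper bound for the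
    indicator of the event, written so that the expectation can be taken term by term.\<close>
  define Z where "Z K = 4 / \<mu>\<^sup>2 * (\<Sum>x\<in>X. \<Sum>y\<in>X. indicator (A x \<inter> A y) K) - 8 / \<mu> * N K + 4 + 2 / \<mu> * Nb K"
    for K
  have N2: "(N K)\<^sup>2 = (\<Sum>x\<in>X. \<Sum>y\<in>X. indicator (A x \<inter> A y) K)" for K
    by (simp add: N_def power2_eq_square sum_product indicator_inter_arith)
  have Z: "Z K = 4 * ((N K - \<mu>) / \<mu>)\<^sup>2 + 2 * (Nb K / \<mu>)" for K
    using \<mu> by (simp add: Z_def N2[symmetric] field_simps power2_eq_square)
  have Nb0: "0 \<le> Nb K" for K by (simp add: Nb_def sum_nonneg)
  have ZE: "indicator E K \<le> Z K" for K
  proof (cases "K \<in> E")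
    case True
    then have le: "N K \<le> Nb K"
      unfolding N_def Nb_def E_def by (intro sum_mono) (auto simp: indicator_def)
    show ?thesis
    proof (cases "N K \<le> \<mu> / 2")
      case True
      then have "1 / 2 \<le> (\<mu> - N K) / \<mu>" using \<mu> by (simp add: field_simps)
      then have "(1 / 2)\<^sup>2 \<le> ((\<mu> - N K) / \<mu>)\<^sup>2" by (intro power_mono) auto
      then have "1 \<le> 4 * ((N K - \<mu>) / \<mu>)\<^sup>2"
        by (simp add: power2_eq_square field_simps)
      moreover have "0 \<le> 2 * (Nb K / \<mu>)" using Nb0 \<mu> by simp
      ultimately have "1 \<le> Z K" unfolding Z by linarith
      then show ?thesis by (simp add: indicator_def)
    next
      case False
      then have "1 \<le> 2 * (Nb K / \<mu>)" using le \<mu> by (simp add: field_simps)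
      moreover have "0 \<le> 4 * ((N K - \<mu>) / \<mu>)\<^sup>2" by simp
      ultimately have "1 \<le> Z K" unfolding Z by linarith
      then show ?thesis by (simp add: indicator_def)
    qed
  next
    case False
    then show ?thesis unfolding Z using Nb0[of K] \<mu> by (simp add: indicator_def)
  qed
  have int: "integrable (measure_pmf M) (indicator S :: 'a \<Rightarrow> real)" for S
    by (rule measure_pmf.integrable_const_bound[where B = 1]) auto
  have "measure_pmf.prob M E = measure_pmf.expectation M (indicator E)"
    by simp
  also have "\<dots> \<le> measure_pmf.expectation M Z"
    unfolding Z_def N_def Nb_def
    by (intro integral_mono int Bochner_Integration.integrable_add Bochner_Integration.integrable_diff
        Bochner_Integration.integrable_mult_right Bochner_Integration.integrable_sum)
      (use ZE in \<open>simp_all add: Z_def N_def Nb_def\<close>)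
  also have "\<dots> = 4 / \<mu>\<^sup>2 * (\<Sum>x\<in>X. \<Sum>y\<in>X. measure_pmf.prob M (A x \<inter> A y)) -
      8 / \<mu> * (\<Sum>x\<in>X. measure_pmf.prob M (A x)) + 4 + 2 / \<mu> * (\<Sum>x\<in>X. measure_pmf.prob M (B x))"
    unfolding Z_def N_def Nb_def by (simp add: int)
  also have "(\<Sum>x\<in>X. measure_pmf.prob M (A x)) = \<mu>"
    using PA by (simp add: \<mu>_def)
  also have "4 / \<mu>\<^sup>2 * (\<Sum>x\<in>X. \<Sum>y\<in>X. measure_pmf.prob M (A x \<inter> A y)) \<le> 4 / \<mu>\<^sup>2 * ((1 + \<epsilon>) * \<mu>\<^sup>2)"
    using PAA by (intro mult_left_mono) (auto simp: \<mu>_def)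
  also have "2 / \<mu> * (\<Sum>x\<in>X. measure_pmf.prob M (B x)) \<le> 2 / \<mu> * (\<delta> * \<mu>)"
    using sum_mono[OF PB, of X] \<mu> by (intro mult_left_mono) (auto simp: \<mu>_def algebra_simps)
  also have "4 / \<mu>\<^sup>2 * ((1 + \<epsilon>) * \<mu>\<^sup>2) - 8 / \<mu> * \<mu> + 4 + 2 / \<mu> * (\<delta> * \<mu>) = 4 * \<epsilon> + 2 * \<delta>"
    using \<mu> by (simp add: field_simps)
  finally show ?thesis by (simp add: E_def)
qed

section \<open>Joins of simplex boundaries as hypergraphs\<close>

text \<open>The vertex set \<open>{..<(d + 1) * r}\<close> is cut into \<open>r\<close> blocks of size \<open>d + 1\<close>; the
  join of the boundaries of the blocks is the clique complex of \<open>join_faces d r\<close>.\<close>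

definition block :: "nat \<Rightarrow> nat \<Rightarrow> nat set" where
  "block d i = {(d + 1) * i..<(d + 1) * Suc i}"

definition join_faces :: "nat \<Rightarrow> nat \<Rightarrow> nat set set" where
  "join_faces d r = {S. S \<subseteq> {..<(d + 1) * r} \<and> card S = d + 1} - block d ` {..<r}"

lemma card_block: "card (block d i) = d + 1"
  by (simp add: block_def flip: diff_mult_distrib2)

lemma mem_block: "v \<in> block d i \<longleftrightarrow> v div (d + 1) = i"
proof
  assume "v \<in> block d i"
  then show "v div (d + 1) = i"
    unfolding block_def atLeastLessThan_iff by (intro div_nat_eqI) blast+
next
  assume "v div (d + 1) = i"
  then show "v \<in> block d i"
    using times_div_less_eq_dividend[of "d + 1" v] dividend_less_times_div[of "d + 1" v]
    by (simp add: block_def)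
qed

lemma block_subset: "i < r \<Longrightarrow> block d i \<subseteq> {..<(d + 1) * r}"
proof
  fix v assume i: "i < r" and v: "v \<in> block d i"
  have "v < (d + 1) * Suc i" using v by (simp only: block_def atLeastLessThan_iff)
  also have "\<dots> \<le> (d + 1) * r" using i by (intro mult_le_mono2) simp
  finally show "v \<in> {..<(d + 1) * r}" by (simp only: lessThan_iff)
qed

lemma inj_block: "inj (block d)"
proof (rule injI)
  fix i j assume eq: "block d i = block d j"
  have "(d + 1) * i \<in> block d i" by (simp add: block_def)
  moreover from this have "(d + 1) * i \<in> block d j" unfolding eq .
  ultimately show "i = j" unfolding mem_block by (rule trans[OF sym])
qed

lemma finite_join_faces: "finite (join_faces d r)"
  by (rule finite_subset[of _ "Pow {..<(d + 1) * r}"]) (auto simp: join_faces_def)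

lemma card_join_faces: "card (join_faces d r) + r = ((d + 1) * r) choose (d + 1)"
proof -
  let ?A = "{S. S \<subseteq> {..<(d + 1) * r} \<and> card S = d + 1}"
  have sub: "block d ` {..<r} \<subseteq> ?A" using block_subset card_block by blast
  have "card (block d ` {..<r}) = r"
    using card_image[OF inj_on_subset[OF inj_block]] by fastforce
  moreover have A: "card ?A = ((d + 1) * r) choose (d + 1)"
    using n_subsets[of "{..<(d + 1) * r}" "d + 1"] by simp
  moreover have "finite ?A" by (rule finite_subset[of _ "Pow {..<(d + 1) * r}"]) auto
  then have "card (block d ` {..<r}) \<le> card ?A" using sub card_mono by blast
  ultimately show ?thesis
    unfolding join_faces_def using card_Diff_subset[OF _ sub] by simp
qed

text \<open>The second factor is the common degree: all \<open>(d + 1)\<close>-sets through a vertex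
  except its own block. The identity follows from the total count by absorption.\<close>

lemma card_join_faces_regular:
  assumes "1 \<le> r"
  shows "(d + 1) * card (join_faces d r) = ((d + 1) * r) * ((((d + 1) * r - 1) choose d) - 1)"
proof -
  obtain n where n: "(d + 1) * r = Suc n" using assms by (cases "(d + 1) * r") auto
  have "(d + 1) * (card (join_faces d r) + r) = (d + 1) * (Suc n choose Suc d)"
    unfolding card_join_faces n by simp
  also have "\<dots> = Suc n * (n choose d)" using Suc_times_binomial[of d n] by simp
  finally have "(d + 1) * card (join_faces d r) + Suc n = Suc n * (n choose d)"
    unfolding n[symmetric] by (simp add: algebra_simps)
  then have "(d + 1) * card (join_faces d r) = Suc n * (n choose d) - Suc n" by linarith
  then show ?thesis unfolding n by (simp add: diff_mult_distrib2)
qed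

lemma degree_join_faces_le:
  assumes "i < (d + 1) * r"
  shows "card {S \<in> join_faces d r. i \<in> S} \<le> (((d + 1) * r - 1) choose d) - 1"
proof -
  let ?m = "(d + 1) * r" and ?b = "block d (i div (d + 1))"
  let ?D = "{D. D \<subseteq> {..<?m} - {i} \<and> card D = d}"
  have "i div (d + 1) < r" using assms by (simp add: less_mult_imp_div_less mult.commute)
  then have b: "?b \<subseteq> {..<?m}" "?b \<in> block d ` {..<r}" using block_subset by auto
  have ib: "i \<in> ?b" by (simp add: mem_block)
  have "?b - {i} \<in> ?D" using b ib card_block by (auto simp: card_Diff_singleton)
  moreover have "finite ?D" by (rule finite_subset[of _ "Pow {..<?m}"]) auto
  moreover have "card ?D = (?m - 1) choose d"
    using n_subsets[of "{..<?m} - {i}" d] assms by simp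
  ultimately have "card (?D - {?b - {i}}) = ((?m - 1) choose d) - 1" "finite (?D - {?b - {i}})"
    by (simp_all add: card_Diff_singleton)
  moreover have "card {S \<in> join_faces d r. i \<in> S} \<le> card (?D - {?b - {i}})"
  proof (rule card_inj_on_le[where f = "\<lambda>S. S - {i}"])
    show "inj_on (\<lambda>S. S - {i}) {S \<in> join_faces d r. i \<in> S}"
      by (intro inj_onI) (metis (mono_tags, lifting) insert_Diff mem_Collect_eq)
    show "(\<lambda>S. S - {i}) ` {S \<in> join_faces d r. i \<in> S} \<subseteq> ?D - {?b - {i}}"
    proof (rule image_subsetI)
      fix S assume "S \<in> {S \<in> join_faces d r. i \<in> S}"
      then have S: "S \<subseteq> {..<?m}" "card S = d + 1" "S \<notin> block d ` {..<r}" "i \<in> S"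
        by (auto simp: join_faces_def)
      have "S - {i} \<noteq> ?b - {i}"
      proof
        assume "S - {i} = ?b - {i}"
        then have "S = ?b" using S(4) ib by (metis insert_Diff)
        then show False using S(3) b(2) by simp
      qed
      then show "S - {i} \<in> ?D - {?b - {i}}" using S by auto
    qed
  qed fact
  ultimately show ?thesis by simp
qed

text \<open>The hypergraph is regular, so no induced subhypergraph has larger average degree.\<close>

lemma join_faces_balanced:
  assumes "1 \<le> r" "W \<subseteq> {..<(d + 1) * r}"
  shows "card {S \<in> join_faces d r. S \<subseteq> W} * ((d + 1) * r) \<le> card W * card (join_faces d r)"
proof -
  let ?m = "(d + 1) * r" and ?H = "{S \<in> join_faces d r. S \<subseteq> W}"
  let ?D = "((?m - 1) choose d) - 1"
  have fW: "finite W" using assms(2) finite_subset by blast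
  have fH: "finite ?H" using finite_join_faces[of d r] by simp
  have "(d + 1) * card ?H = (\<Sum>S\<in>?H. card {i \<in> W. i \<in> S})"
  proof -
    have "card {i \<in> W. i \<in> S} = d + 1" if "S \<in> ?H" for S
    proof -
      have "{i \<in> W. i \<in> S} = S" using that by blast
      then show ?thesis using that by (simp add: join_faces_def)
    qed
    then show ?thesis by simp
  qed
  also have "\<dots> = (\<Sum>i\<in>W. card {S \<in> ?H. i \<in> S})"
    using sum_multicount_gen[OF fH fW, of "\<lambda>S i. i \<in> S" "\<lambda>i. card {S \<in> ?H. i \<in> S}"] by simp
  also have "\<dots> \<le> (\<Sum>i\<in>W. ?D)"
  proof (rule sum_mono)
    fix i assume "i \<in> W"
    then have "i < ?m" using assms(2) by auto
    have "card {S \<in> ?H. i \<in> S} \<le> card {S \<in> join_faces d r. i \<in> S}"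
      using finite_join_faces[of d r] by (intro card_mono) auto
    also have "\<dots> \<le> ?D" by (rule degree_join_faces_le[OF \<open>i < ?m\<close>])
    finally show "card {S \<in> ?H. i \<in> S} \<le> ?D" .
  qed
  finally have "(d + 1) * card ?H \<le> card W * ?D" by simp
  then have "(d + 1) * card ?H * ?m \<le> card W * ?D * ?m" by (rule mult_le_mono1)
  also have "\<dots> = card W * (?m * ?D)" by (simp only: mult.assoc mult.commute[of ?D])
  also have "\<dots> = card W * ((d + 1) * card (join_faces d r))"
    by (simp only: card_join_faces_regular[OF assms(1)])
  finally have "Suc d * (card ?H * ?m) \<le> Suc d * (card W * card (join_faces d r))"
    by (simp only: Suc_eq_plus1 mult.assoc mult.left_commute)
  then show ?thesis by (rule Suc_mult_le_cancel1[THEN iffD1])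
qed

text \<open>A \<open>d\<close>-subset of \<open>r - 1\<close> blocks of size \<open>d + 1\<close> and one block of size \<open>d\<close> misses some
  \<open>i\<close>-th layer of the large blocks, and the small block is contained in the complement of each layer.\<close>

lemma binomial_layers_le:
  assumes "1 \<le> r"
  shows "(((d + 1) * r - 1) choose d) - 1 \<le> (d + 1) * (((d * r) choose d) - 1)"
proof -
  \<comment> \<open>Coordinates are (layer, block); block 0 is the small one, having lost the vertex
    whose degree is counted. The subtracted 1 on both sides stands for \<open>B\<close>, which would
    complete that vertex to its own block; it lies in every \<open>L i\<close>.\<close>
  define B :: "(nat \<times> nat) set" where "B = {..<d} \<times> {0}"
  define L where "L i = ({..d} - {i}) \<times> {1..<r} \<union> B" for i
  define Y where "Y = {..d} \<times> {1..<r} \<union> B"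
  let ?sub = "\<lambda>Z. {S. S \<subseteq> Z \<and> card S = d}"
  have fin: "finite Y" "finite (L i)" for i by (auto simp: Y_def L_def B_def)
  have cB: "card B = d" by (simp add: B_def card_cartesian_product)
  have sub: "card (?sub Z - {B}) = (card Z choose d) - 1" if "finite Z" "B \<subseteq> Z" for Z
  proof -
    have "B \<in> ?sub Z" using that cB by blast
    moreover have "finite (?sub Z)" by (rule finite_subset[of _ "Pow Z"]) (use that in auto)
    ultimately show ?thesis using n_subsets[OF that(1), of d] by (simp add: card_Diff_singleton)
  qed
  obtain r' where r': "r = Suc r'" using assms by (cases r) auto
  have cY: "card Y = (d + 1) * r - 1"
  proof -
    have "card Y = card ({..d} \<times> {1..<r}) + card B"
      unfolding Y_def by (rule card_Un_disjoint) (auto simp: B_def)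
    also have "\<dots> = (d + 1) * (r - 1) + d" by (simp add: cB card_cartesian_product)
    also have "\<dots> = (d + 1) * r - 1" unfolding r' by simp
    finally show ?thesis .
  qed
  have cL: "card (L i) = d * r" if "i \<le> d" for i
  proof -
    have "card (L i) = card (({..d} - {i}) \<times> {1..<r}) + card B"
      unfolding L_def by (rule card_Un_disjoint) (auto simp: B_def)
    also have "\<dots> = d * (r - 1) + d" using that by (simp add: cB card_cartesian_product)
    also have "\<dots> = d * r" unfolding r' by simp
    finally show ?thesis .
  qed
  have "?sub Y - {B} \<subseteq> (\<Union>i\<in>{..d}. ?sub (L i) - {B})"
  proof
    fix S assume S: "S \<in> ?sub Y - {B}"
    then have fS: "finite S" using fin(1) finite_subset by blast
    have "card (fst ` S) \<le> d" using card_image_le[OF fS, of fst] S by simp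
    then have "\<not> {..d} \<subseteq> fst ` S"
      using card_mono[of "fst ` S" "{..d}"] fS by auto
    then obtain i where i: "i \<le> d" "i \<notin> fst ` S" by auto
    have "S \<subseteq> L i"
    proof
      fix y assume y: "y \<in> S"
      then have "y \<in> Y" "fst y \<noteq> i" using S i(2) by auto
      then show "y \<in> L i" by (auto simp: Y_def L_def)
    qed
    then show "S \<in> (\<Union>i\<in>{..d}. ?sub (L i) - {B})" using S i(1) by blast
  qed
  then have "card (?sub Y - {B}) \<le> card (\<Union>i\<in>{..d}. ?sub (L i) - {B})"
    by (intro card_mono) (auto intro: finite_subset[OF _ fin(2)[THEN finite_Pow_iff[THEN iffD2]]])
  also have "\<dots> \<le> (\<Sum>i\<in>{..d}. card (?sub (L i) - {B}))"
    by (rule card_UN_le) simp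
  also have "\<dots> = (\<Sum>i\<in>{..d}. ((d * r) choose d) - 1)"
  proof (rule sum.cong[OF refl])
    fix i assume "i \<in> {..d}"
    then show "card (?sub (L i) - {B}) = ((d * r) choose d) - 1"
      using sub[OF fin(2), of i] cL[of i] by (simp add: L_def)
  qed
  finally show ?thesis using sub[OF fin(1)] cY by (simp add: Y_def)
qed

section \<open>Copies of the join in the random complex\<close>

text \<open>The vertex \<open>i\<close> of a copy is chosen in the \<open>i\<close>-th of disjoint intervals of length \<open>q\<close>, so
  two copies share exactly the faces on which the choices agree.\<close>

definition place :: "nat \<Rightarrow> (nat \<Rightarrow> nat) \<Rightarrow> nat \<Rightarrow> nat" where
  "place q x i = q * i + x i + 1"

definition positions :: "nat \<Rightarrow> nat \<Rightarrow> (nat \<Rightarrow> nat) set" where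
  "positions m q = {..<m} \<rightarrow>\<^sub>E {..<q}"

definition copy_faces :: "nat \<Rightarrow> nat \<Rightarrow> nat \<Rightarrow> (nat \<Rightarrow> nat) \<Rightarrow> nat set set" where
  "copy_faces d r q x = image (place q x) ` join_faces d r"

lemma positions_less: "x \<in> positions m q \<Longrightarrow> i < m \<Longrightarrow> x i < q"
  by (auto simp: positions_def)

lemma place_eqD:
  assumes "x \<in> positions m q" "y \<in> positions m q" "i < m" "j < m" "place q x i = place q y j"
  shows "i = j" "x i = y j"
proof -
  have x: "x i < q" and y: "y j < q" using assms positions_less by auto
  have eq: "q * i + x i = q * j + y j" using assms(5) by (simp add: place_def)
  have "(q * i + x i) div q = i" using x by simp
  moreover have "(q * j + y j) div q = j" using y by simp
  ultimately show "i = j" using eq by simp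
  then show "x i = y j" using eq by simp
qed

lemma inj_on_place: "x \<in> positions m q \<Longrightarrow> inj_on (place q x) {..<m}"
  by (rule inj_onI) (rule place_eqD(1), auto)

lemma place_range:
  assumes "x \<in> positions m q" "m * q \<le> n"
  shows "place q x ` {..<m} \<subseteq> {1..n}"
proof (rule image_subsetI)
  fix i assume "i \<in> {..<m}"
  then have i: "i < m" by simp
  have "q * i + x i < q * Suc i" using positions_less[OF assms(1) i] by simp
  also have "\<dots> \<le> q * m" using i by (intro mult_le_mono2) simp
  finally show "place q x i \<in> {1..n}" using assms(2) by (simp add: place_def mult.commute)
qed

lemma card_place_image:
  assumes "x \<in> positions m q" "S \<subseteq> {..<m}"
  shows "card (place q x ` S) = card S"
  using inj_on_subset[OF inj_on_place[OF assms(1)] assms(2)] by (rule card_image)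

lemma inj_on_image_place: "x \<in> positions m q \<Longrightarrow> inj_on (image (place q x)) (Pow {..<m})"
  by (rule inj_on_image_Pow[OF inj_on_place])

lemma join_faces_subset_Pow: "join_faces d r \<subseteq> Pow {..<(d + 1) * r}"
  by (auto simp: join_faces_def)

lemma card_copy_faces:
  assumes "x \<in> positions ((d + 1) * r) q"
  shows "card (copy_faces d r q x) = card (join_faces d r)"
  unfolding copy_faces_def
  by (rule card_image[OF inj_on_subset[OF inj_on_image_place[OF assms] join_faces_subset_Pow]])

lemma finite_copy_faces: "finite (copy_faces d r q x)"
  unfolding copy_faces_def using finite_join_faces by simp

lemma copy_faces_subset_ksets:
  assumes x: "x \<in> positions ((d + 1) * r) q" and n: "((d + 1) * r) * q \<le> n"
  shows "copy_faces d r q x \<subseteq> ksets (d + 1) n"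
proof
  fix F assume "F \<in> copy_faces d r q x"
  then obtain S where S: "F = place q x ` S" "S \<subseteq> {..<(d + 1) * r}" "card S = d + 1"
    by (auto simp: copy_faces_def join_faces_def)
  then show "F \<in> ksets (d + 1) n"
    using place_range[OF x n] card_place_image[OF x S(2)] by auto
qed

text \<open>A vertex shared by two copies has the same index and the same choice in both. Shared
  faces therefore come from the subhypergraph induced on the agreement set.\<close>

lemma card_copy_faces_Un:
  assumes x: "x \<in> positions ((d + 1) * r) q" and y: "y \<in> positions ((d + 1) * r) q"
  shows "2 * card (join_faces d r) -
      card {S \<in> join_faces d r. S \<subseteq> {i. i < (d + 1) * r \<and> x i = y i}}
    \<le> card (copy_faces d r q x \<union> copy_faces d r q y)"
proof -
  let ?H = "{S \<in> join_faces d r. S \<subseteq> {i. i < (d + 1) * r \<and> x i = y i}}"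
  have "copy_faces d r q x \<inter> copy_faces d r q y \<subseteq> image (place q x) ` ?H"
  proof
    fix F assume "F \<in> copy_faces d r q x \<inter> copy_faces d r q y"
    then obtain S T where S: "F = place q x ` S" "S \<in> join_faces d r"
      and T: "F = place q y ` T" "T \<in> join_faces d r"
      unfolding copy_faces_def by blast
    have "S \<subseteq> {i. i < (d + 1) * r \<and> x i = y i}"
    proof
      fix i assume i: "i \<in> S"
      then have im: "i < (d + 1) * r" using S(2) join_faces_subset_Pow by blast
      have "place q x i \<in> place q y ` T" using i S(1) T(1) by blast
      then obtain j where j: "j \<in> T" "place q x i = place q y j" by blast
      then have "j < (d + 1) * r" using T(2) join_faces_subset_Pow by blast
      from place_eqD[OF x y im this j(2)] show "i \<in> {i. i < (d + 1) * r \<and> x i = y i}"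
        using im by simp
    qed
    then show "F \<in> image (place q x) ` ?H" using S by blast
  qed
  moreover have fH: "finite ?H" using finite_join_faces[of d r] by simp
  ultimately have "card (copy_faces d r q x \<inter> copy_faces d r q y) \<le> card ?H"
    by (rule surj_card_le[rotated])
  moreover have "card (copy_faces d r q x \<union> copy_faces d r q y) +
      card (copy_faces d r q x \<inter> copy_faces d r q y) = 2 * card (join_faces d r)"
    using card_Un_Int[OF finite_copy_faces finite_copy_faces, of d r q x d r q y]
      card_copy_faces[OF x] card_copy_faces[OF y] by simp
  ultimately show ?thesis by linarith
qed

section \<open>Overlapping pairs of copies\<close>

lemma card_positions: "card (positions m q) = q ^ m"
  by (simp add: positions_def card_PiE)

lemma finite_positions: "finite (positions m q)"
  by (simp add: positions_def finite_PiE)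

text \<open>Group the \<open>y\<close> by the set \<open>W\<close> on which they agree with
  \<open>x\<close>; only the coordinates outside \<open>W\<close> can vary, leaving at most
  \<open>q ^ (m - card W)\<close> choices.\<close>

lemma sum_agreement_le:
  fixes f :: "nat set \<Rightarrow> real"
  assumes x: "x \<in> positions m q" and f: "\<And>W. 0 \<le> f W"
  shows "(\<Sum>y\<in>positions m q. f {i. i < m \<and> x i = y i}) \<le> (\<Sum>W\<in>Pow {..<m}. real q ^ (m - card W) * f W)"
proof -
  let ?ag = "\<lambda>y. {i. i < m \<and> x i = y i}"
  have "(\<Sum>y\<in>positions m q. f (?ag y)) =
      (\<Sum>W\<in>Pow {..<m}. \<Sum>y\<in>{y \<in> positions m q. ?ag y = W}. f (?ag y))"
    by (rule sum.group[symmetric]) (auto simp: finite_positions)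
  also have "\<dots> = (\<Sum>W\<in>Pow {..<m}. card {y \<in> positions m q. ?ag y = W} * f W)"
    by (rule sum.cong) auto
  also have "\<dots> \<le> (\<Sum>W\<in>Pow {..<m}. real q ^ (m - card W) * f W)"
  proof (rule sum_mono)
    fix W assume "W \<in> Pow {..<m}"
    then have W: "W \<subseteq> {..<m}" by simp
    let ?B = "\<lambda>i. if i \<in> W then {x i} else {..<q}"
    have "card {y \<in> positions m q. ?ag y = W} \<le> card (PiE {..<m} ?B)"
    proof (rule card_mono)
      show "finite (PiE {..<m} ?B)" by (intro finite_PiE) auto
      show "{y \<in> positions m q. ?ag y = W} \<subseteq> PiE {..<m} ?B"
      proof
        fix y assume "y \<in> {y \<in> positions m q. ?ag y = W}"
        then have y: "y \<in> positions m q" "?ag y = W" by simp_all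
        show "y \<in> PiE {..<m} ?B"
        proof (rule PiE_I)
          fix i assume "i \<in> {..<m}"
          then show "y i \<in> ?B i" using y(2) positions_less[OF y(1), of i] by auto
        next
          fix i assume "i \<notin> {..<m}"
          then show "y i = undefined" using y(1) unfolding positions_def by (rule PiE_arb[rotated])
        qed
      qed
    qed
    also have "\<dots> = (\<Prod>i<m. card (?B i))" by (rule card_PiE) simp
    also have "\<dots> = (\<Prod>i<m. if i \<in> W then 1 else q)" by (rule prod.cong) auto
    also have "\<dots> = q ^ card ({..<m} - W)"
      using W by (simp add: prod.If_cases Diff_eq)
    also have "card ({..<m} - W) = m - card W"
      using W finite_subset[OF W] by (simp add: card_Diff_subset)
    finally have "real (card {y \<in> positions m q. ?ag y = W}) \<le> real (q ^ (m - card W))"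
      by (rule of_nat_mono)
    then have "real (card {y \<in> positions m q. ?ag y = W}) \<le> real q ^ (m - card W)"
      by (simp only: of_nat_power)
    then show "card {y \<in> positions m q. ?ag y = W} * f W \<le> real q ^ (m - card W) * f W"
      by (intro mult_right_mono f)
  qed
  finally show ?thesis .
qed

text \<open>The summand for \<open>W\<close> is the reciprocal of the expected number of copies of
  the part induced on \<open>W\<close>; it bounds the relative contribution to the second moment of
  pairs agreeing exactly on \<open>W\<close>. Empty agreement is left out: it gives the main term
  1.\<close>

definition overlap_error :: "nat \<Rightarrow> nat \<Rightarrow> nat \<Rightarrow> real \<Rightarrow> real" where
  "overlap_error d r q p = (\<Sum>W\<in>Pow {..<(d + 1) * r} - {{}}.
     1 / (real q ^ card W * p ^ card {S \<in> join_faces d r. S \<subseteq> W}))"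

lemma sum_prob_copy_pairs_le:
  fixes p :: real
  assumes p: "0 < p" "p \<le> 1" and q: "0 < q" and n: "((d + 1) * r) * q \<le> n"
  defines "X \<equiv> positions ((d + 1) * r) q" and "e \<equiv> card (join_faces d r)"
  shows "(\<Sum>x\<in>X. \<Sum>y\<in>X. measure_pmf.prob (random_complex d n p)
       ({K. copy_faces d r q x \<subseteq> K} \<inter> {K. copy_faces d r q y \<subseteq> K}))
    \<le> (1 + overlap_error d r q p) * (card X * p ^ e)\<^sup>2"
proof -
  let ?m = "(d + 1) * r"
  define h where "h W = card {S \<in> join_faces d r. S \<subseteq> W}" for W
  have h_le: "h W \<le> e" for W
    unfolding h_def e_def by (intro card_mono finite_join_faces) auto
  have "(\<Sum>y\<in>X. measure_pmf.prob (random_complex d n p)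
       ({K. copy_faces d r q x \<subseteq> K} \<inter> {K. copy_faces d r q y \<subseteq> K}))
     \<le> real q ^ ?m * p ^ (2 * e) * (1 + overlap_error d r q p)" if x: "x \<in> X" for x
  proof -
    have "(\<Sum>y\<in>X. measure_pmf.prob (random_complex d n p)
        ({K. copy_faces d r q x \<subseteq> K} \<inter> {K. copy_faces d r q y \<subseteq> K}))
      \<le> (\<Sum>y\<in>X. p ^ (2 * e - h {i. i < ?m \<and> x i = y i}))"
    proof (rule sum_mono)
      fix y assume y: "y \<in> X"
      let ?U = "copy_faces d r q x \<union> copy_faces d r q y"
      have "{K. copy_faces d r q x \<subseteq> K} \<inter> {K. copy_faces d r q y \<subseteq> K} = {K. ?U \<subseteq> K}"
        by auto
      moreover have "measure_pmf.prob (random_complex d n p) {K. ?U \<subseteq> K} = p ^ card ?U"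
        using x y copy_faces_subset_ksets[OF _ n] p unfolding X_def
        by (intro prob_faces_subset) auto
      moreover have "p ^ card ?U \<le> p ^ (2 * e - h {i. i < ?m \<and> x i = y i})"
        using card_copy_faces_Un[of x d r q y] x y p unfolding X_def e_def h_def
        by (intro power_decreasing) auto
      ultimately show "measure_pmf.prob (random_complex d n p)
          ({K. copy_faces d r q x \<subseteq> K} \<inter> {K. copy_faces d r q y \<subseteq> K})
          \<le> p ^ (2 * e - h {i. i < ?m \<and> x i = y i})" by simp
    qed
    also have "\<dots> \<le> (\<Sum>W\<in>Pow {..<?m}. real q ^ (?m - card W) * p ^ (2 * e - h W))"
      using x p unfolding X_def by (intro sum_agreement_le[of x ?m q "\<lambda>W. p ^ (2 * e - h W)"]) auto
    also have "\<dots> = (\<Sum>W\<in>Pow {..<?m}. real q ^ ?m * p ^ (2 * e) * (1 / (real q ^ card W * p ^ h W)))"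
    proof (rule sum.cong[OF refl])
      fix W assume "W \<in> Pow {..<?m}"
      then have "card W \<le> ?m" using card_mono[of "{..<?m}" W] by simp
      moreover have "h W \<le> 2 * e" using h_le[of W] by simp
      ultimately show "real q ^ (?m - card W) * p ^ (2 * e - h W) =
          real q ^ ?m * p ^ (2 * e) * (1 / (real q ^ card W * p ^ h W))"
        using p q by (simp add: power_diff)
    qed
    also have "\<dots> = real q ^ ?m * p ^ (2 * e) * (\<Sum>W\<in>Pow {..<?m}. 1 / (real q ^ card W * p ^ h W))"
      by (rule sum_distrib_left[symmetric])
    also have "(\<Sum>W\<in>Pow {..<?m}. 1 / (real q ^ card W * p ^ h W)) = 1 + overlap_error d r q p"
    proof -
      have "{S \<in> join_faces d r. S \<subseteq> {}} = {}" by (auto simp: join_faces_def)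
      then have "h {} = 0" by (simp only: h_def card.empty)
      then have "1 / (real q ^ card ({} :: nat set) * p ^ h {}) = 1" by simp
      moreover have "(\<Sum>W\<in>Pow {..<?m}. 1 / (real q ^ card W * p ^ h W)) =
          1 / (real q ^ card ({} :: nat set) * p ^ h {}) +
          (\<Sum>W\<in>Pow {..<?m} - {{}}. 1 / (real q ^ card W * p ^ h W))"
        by (rule sum.remove) auto
      ultimately show ?thesis unfolding overlap_error_def by (simp only: h_def[symmetric])
    qed
    finally show ?thesis .
  qed
  then have "(\<Sum>x\<in>X. \<Sum>y\<in>X. measure_pmf.prob (random_complex d n p)
       ({K. copy_faces d r q x \<subseteq> K} \<inter> {K. copy_faces d r q y \<subseteq> K}))
    \<le> (\<Sum>x\<in>X. real q ^ ?m * p ^ (2 * e) * (1 + overlap_error d r q p))"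
    by (rule sum_mono)
  also have "\<dots> = card X * (real q ^ ?m * p ^ (2 * e) * (1 + overlap_error d r q p))"
    by (rule sum_constant)
  also have "\<dots> = (1 + overlap_error d r q p) * (card X * p ^ e)\<^sup>2"
    by (simp add: X_def card_positions power2_eq_square power_add mult_2)
  finally show ?thesis .
qed

section \<open>Copies with a maximal facet\<close>

definition copy_facet :: "nat \<Rightarrow> nat \<Rightarrow> nat \<Rightarrow> (nat \<Rightarrow> nat) \<Rightarrow> nat set" where
  "copy_facet d r q x = place q x ` ({..<(d + 1) * r} - (\<lambda>i. (d + 1) * i) ` {..<r})"

text \<open>The two ways in which the chosen facet, which omits the first vertex of every block, may
  fail to be maximal: a block is filled in, so that its omitted vertex might be added, or a vertex
  outside the copy is joined to all \<open>d\<close>-subsets of the facet.\<close>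

definition bad_copy :: "nat \<Rightarrow> nat \<Rightarrow> nat \<Rightarrow> nat \<Rightarrow> (nat \<Rightarrow> nat) \<Rightarrow> nat set set set" where
  "bad_copy n d r q x = {K. copy_faces d r q x \<subseteq> K \<and>
     ((\<exists>i<r. place q x ` block d i \<in> K) \<or>
      (\<exists>v\<in>{1..n} - place q x ` {..<(d + 1) * r}. coface d (copy_facet d r q x) v \<subseteq> K))}"

lemma first_in_block: "(d + 1) * i \<in> block d i"
  by (simp add: block_def)

lemma first_of_blocks_subset:
  fixes d r :: nat
  shows "(\<lambda>i. (d + 1) * i) ` {..<r} \<subseteq> {..<(d + 1) * r}"
proof (rule image_subsetI)
  fix i assume "i \<in> {..<r}"
  then have "i < r" by (simp only: lessThan_iff)
  from subsetD[OF block_subset[OF this] first_in_block] show "(d + 1) * i \<in> {..<(d + 1) * r}" .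
qed

lemma card_copy_facet:
  assumes "x \<in> positions ((d + 1) * r) q"
  shows "card (copy_facet d r q x) = d * r"
proof -
  have "inj_on (\<lambda>i. (d + 1) * i) {..<r}"
  proof (rule inj_onI)
    fix i j assume "(d + 1) * i = (d + 1) * j"
    then have "i = j \<or> d + 1 = 0" by (simp only: mult_cancel1)
    then show "i = j" by simp
  qed
  then have "card ((\<lambda>i. (d + 1) * i) ` {..<r}) = r"
    by (simp only: card_image card_lessThan)
  then have "card ({..<(d + 1) * r} - (\<lambda>i. (d + 1) * i) ` {..<r}) = (d + 1) * r - r"
    using card_Diff_subset[OF _ first_of_blocks_subset[of d r]] by simp
  then show ?thesis
    unfolding copy_facet_def using card_place_image[OF assms] by simp
qed

text \<open>Each defect demands faces disjoint from those of the copy: one block, or the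
  \<open>(d * r) choose d\<close> faces joining an outside vertex to the facet. The bracket is the
  union bound over at most \<open>r\<close> blocks and \<open>n\<close> vertices, relative to the
  probability of the copy.\<close>

lemma prob_bad_copy_le:
  assumes p: "0 \<le> p" "p \<le> 1" and x: "x \<in> positions ((d + 1) * r) q" and n: "((d + 1) * r) * q \<le> n"
  shows "measure_pmf.prob (random_complex d n p) (bad_copy n d r q x)
    \<le> (real r * p + real n * p ^ ((d * r) choose d)) * p ^ card (join_faces d r)"
proof -
  let ?P = "measure_pmf.prob (random_complex d n p)"
  let ?m = "(d + 1) * r" and ?C = "copy_faces d r q x" and ?F = "copy_facet d r q x"
  let ?e = "card (join_faces d r)" and ?V = "{1..n} - place q x ` {..<(d + 1) * r}"
  have range: "place q x ` {..<?m} \<subseteq> {1..n}" by (rule place_range[OF x n])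
  have C: "?C \<subseteq> ksets (d + 1) n" by (rule copy_faces_subset_ksets[OF x n])
  have F: "?F \<subseteq> place q x ` {..<?m}" unfolding copy_facet_def by blast
  have fF: "finite ?F" by (simp add: copy_facet_def)
  define B1 B2 where "B1 = {K. \<exists>i<r. ?C \<union> {place q x ` block d i} \<subseteq> K}"
    and "B2 = {K. \<exists>v\<in>?V. ?C \<union> coface d ?F v \<subseteq> K}"
  have "?P B1 \<le> card {..<r} * p ^ (?e + 1)"
  proof (rule prob_UN_le)
    show "B1 \<subseteq> (\<Union>i\<in>{..<r}. {K. ?C \<union> {place q x ` block d i} \<subseteq> K})" by (auto simp: B1_def)
    fix i assume "i \<in> {..<r}"
    then have i: "i < r" by simp
    have b: "block d i \<subseteq> {..<?m}" by (rule block_subset[OF i])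
    have "place q x ` block d i \<notin> ?C"
    proof
      assume "place q x ` block d i \<in> ?C"
      then obtain S where S: "S \<in> join_faces d r" "place q x ` block d i = place q x ` S"
        by (auto simp: copy_faces_def)
      then have "block d i = S"
        using inj_onD[OF inj_on_image_place[OF x] S(2)] b subsetD[OF join_faces_subset_Pow S(1)]
        by blast
      then show False using S(1) i by (auto simp: join_faces_def)
    qed
    then have eq: "card (?C \<union> {place q x ` block d i}) = ?e + 1"
      using card_copy_faces[OF x] finite_copy_faces by simp
    have sub: "?C \<union> {place q x ` block d i} \<subseteq> ksets (d + 1) n"
      using C range b card_place_image[OF x b] card_block[of d i] by auto
    show "?P {K. ?C \<union> {place q x ` block d i} \<subseteq> K} \<le> p ^ (?e + 1)"
      unfolding prob_faces_subset[OF p sub] eq by (rule order_refl)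
  qed simp
  moreover have "?P B2 \<le> card ?V * p ^ (?e + ((d * r) choose d))"
  proof (rule prob_UN_le)
    show "B2 \<subseteq> (\<Union>v\<in>?V. {K. ?C \<union> coface d ?F v \<subseteq> K})" by (auto simp: B2_def)
    fix v assume v: "v \<in> ?V"
    have vF: "v \<notin> ?F" using v F by blast
    have "?C \<inter> coface d ?F v = {}"
    proof -
      have "v \<notin> T" if "T \<in> ?C" for T
        using that v join_faces_subset_Pow[of d r] unfolding copy_faces_def by blast
      moreover have "v \<in> T" if "T \<in> coface d ?F v" for T using that by (auto simp: coface_def)
      ultimately show ?thesis by blast
    qed
    moreover have cv: "coface d ?F v \<subseteq> ksets (d + 1) n"
      using v F range vF by (intro coface_subset_ksets) auto
    moreover have "finite (coface d ?F v)" by (rule finite_subset[OF cv finite_ksets])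
    ultimately have eq: "card (?C \<union> coface d ?F v) = ?e + ((d * r) choose d)"
      using card_copy_faces[OF x] finite_copy_faces card_coface[OF fF vF] card_copy_facet[OF x]
      by (simp add: card_Un_disjoint)
    show "?P {K. ?C \<union> coface d ?F v \<subseteq> K} \<le> p ^ (?e + ((d * r) choose d))"
      unfolding prob_faces_subset[OF p Un_least[OF C cv]] eq by (rule order_refl)
  qed simp
  moreover have "real (card ?V) * p ^ (?e + ((d * r) choose d)) \<le> real n * p ^ (?e + ((d * r) choose d))"
    using card_mono[of "{1..n}" ?V] p by (intro mult_right_mono) auto
  moreover have "?P (bad_copy n d r q x) \<le> ?P B1 + ?P B2"
  proof -
    have "bad_copy n d r q x \<subseteq> B1 \<union> B2" by (auto simp: bad_copy_def B1_def B2_def)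
    then have "?P (bad_copy n d r q x) \<le> ?P (B1 \<union> B2)"
      by (intro measure_pmf.finite_measure_mono) auto
    also have "\<dots> \<le> ?P B1 + ?P B2" by (rule measure_Un_le) auto
    finally show ?thesis .
  qed
  ultimately have "?P (bad_copy n d r q x) \<le>
      real r * p ^ (?e + 1) + real n * p ^ (?e + ((d * r) choose d))"
    unfolding card_lessThan by linarith
  also have "\<dots> = (real r * p + real n * p ^ ((d * r) choose d)) * p ^ ?e"
    unfolding power_add power_one_right by algebra
  finally show ?thesis .
qed

lemma not_acyclic_at_good_copy:
  assumes K: "spans_skeleton d n K" and x: "x \<in> positions ((d + 1) * r) q"
    and n: "((d + 1) * r) * q \<le> n"
    and copy: "copy_faces d r q x \<subseteq> K" and good: "K \<notin> bad_copy n d r q x"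
  shows "\<not> acyclic_at (d * r) (clique_complex d K)"
proof -
  let ?m = "(d + 1) * r" and ?f = "place q x"
  define V B v where "V = ?f ` {..<?m}" and "B i = ?f ` block d i" and "v i = ?f ((d + 1) * i)" for i
  have block: "B i \<notin> K" if "i < r" for i
    using good copy that unfolding bad_copy_def B_def by blast
  have ext: "\<not> coface d (copy_facet d r q x) u \<subseteq> K" if "u \<in> {1..n} - V" for u
    using good copy that unfolding bad_copy_def V_def by blast
  have range: "V \<subseteq> {1..n}" unfolding V_def by (rule place_range[OF x n])
  have inj: "inj_on ?f {..<?m}" by (rule inj_on_place[OF x])
  have facet: "V - v ` {..<r} = copy_facet d r q x"
  proof -
    have "v ` {..<r} = ?f ` ((\<lambda>i. (d + 1) * i) ` {..<r})" by (simp add: v_def image_image)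
    then show ?thesis
      unfolding V_def copy_facet_def
      using inj_on_image_set_diff[OF inj _ first_of_blocks_subset] by simp
  qed
  have cB: "card (B i) = d + 1" if "i < r" for i
    using card_place_image[OF x block_subset[OF that]] card_block by (simp add: B_def)
  have V: "V = (\<Union>i<r. B i)"
  proof -
    have "{..<?m} = (\<Union>i<r. block d i)"
    proof
      show "(\<Union>i<r. block d i) \<subseteq> {..<?m}" using block_subset by blast
      show "{..<?m} \<subseteq> (\<Union>i<r. block d i)"
      proof
        fix j assume "j \<in> {..<?m}"
        then have "j div (d + 1) < r" by (simp add: less_mult_imp_div_less mult.commute)
        moreover have "j \<in> block d (j div (d + 1))" by (simp add: mem_block)
        ultimately show "j \<in> (\<Union>i<r. block d i)" by blast
      qed
    qed
    then show ?thesis unfolding V_def B_def by (simp only: image_UN)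
  qed
  have disj: "B i \<inter> B j = {}" if "i < r" "j < r" "i \<noteq> j" for i j
  proof -
    have "block d i \<inter> block d j = {}" using that(3) by (auto simp: mem_block)
    then show ?thesis
      unfolding B_def using inj_on_image_Int[OF inj block_subset[OF that(1)] block_subset[OF that(2)]]
      by simp
  qed
  have "\<not> acyclic_at (card V - r) (clique_complex d K)"
  proof (rule not_acyclic_at_if_maximal_facet[where B = B and v = v])
    show "finite (B i)" for i by (simp add: B_def block_def)
    show "B i \<inter> B j = {}" if "i < r" "j < r" "i \<noteq> j" for i j by (rule disj[OF that])
    show "v i \<in> B i" for i unfolding v_def B_def by (rule imageI[OF first_in_block])
    show "V = (\<Union>i<r. B i)" by (rule V)
  next
    fix F assume F: "F \<subseteq> V" "\<And>i. i < r \<Longrightarrow> \<not> B i \<subseteq> F"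
    have "S \<in> K" if S: "S \<subseteq> F" "card S = d + 1" for S
    proof -
      have "S \<subseteq> ?f ` {..<?m}" using S(1) F(1) by (simp add: V_def)
      then obtain T where T: "T \<subseteq> {..<?m}" "S = ?f ` T" by (auto simp: subset_image_iff)
      have "card T = d + 1" using card_place_image[OF x T(1)] T(2) S(2) by simp
      moreover have "T \<noteq> block d i" if "i < r" for i
        using F(2)[OF that] S(1) T(2) unfolding B_def by blast
      ultimately have "T \<in> join_faces d r" using T(1) by (auto simp: join_faces_def)
      then show ?thesis using copy T(2) by (auto simp: copy_faces_def)
    qed
    moreover have "F \<subseteq> {1..n}" using F(1) range by (rule subset_trans)
    ultimately show "F \<in> clique_complex d K"
      unfolding mem_clique_complex[OF K] by blast
  next
    fix u assume u: "u \<notin> V - v ` {..<r}"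
    show "insert u (V - v ` {..<r}) \<notin> clique_complex d K"
    proof
      assume C: "insert u (V - v ` {..<r}) \<in> clique_complex d K"
      then have un: "u \<in> {1..n}" unfolding mem_clique_complex[OF K] by blast
      show False
      proof (cases "u \<in> V")
        case True
        then obtain i where i: "i < r" "u = v i" using u by blast
        \<comment> \<open>A vertex of the copy outside the facet is the omitted vertex of some
          block, so adding it completes that block; the block would then be a face.\<close>
        have "B i \<subseteq> insert u (V - v ` {..<r})"
        proof
          fix w assume w: "w \<in> B i"
          have "w = u" if "w = v j" "j < r" for j
          proof -
            have "v j \<in> B j" unfolding v_def B_def by (rule imageI[OF first_in_block])
            then have "j = i" using disj[OF that(2) i(1)] w that(1) by blast
            then show ?thesis using that(1) i(2) by simp
          qed
          then show "w \<in> insert u (V - v ` {..<r})" using w i(1) V by blast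
        qed
        then have "B i \<in> K" using clique_complexD[OF C] cB[OF i(1)] by blast
        then show False using block[OF i(1)] by blast
      next
        case False
        have "coface d (V - v ` {..<r}) u \<subseteq> K"
        proof
          fix S assume S: "S \<in> coface d (V - v ` {..<r}) u"
          have sub: "V - v ` {..<r} \<subseteq> {1..n}" using range by blast
          have "card S = d + 1"
            using coface_subset_ksets[OF sub un] u S by blast
          moreover have "S \<subseteq> insert u (V - v ` {..<r})" using S by (auto simp: coface_def)
          ultimately show "S \<in> K" using clique_complexD[OF C] by blast
        qed
        then show False using ext[of u] un False unfolding facet by blast
      qed
    qed
  qed
  moreover have "card V - r = d * r"
    using card_place_image[OF x, of "{..<?m}"] by (simp add: V_def)
  ultimately show ?thesis by simp
qed

section \<open>Nonvanishing homology\<close>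

text \<open>Rounding is harmless: for \<open>n \<ge> 2 * m\<close> the interval length
  \<open>n div m\<close> is at least \<open>n / (2 * m)\<close>, so only the constant
  \<open>(2 * m) ^ j\<close> is lost.\<close>

lemma reciprocal_tendsto_0:
  fixes m j h :: nat
  assumes m: "0 < m" and \<alpha>: "\<alpha> \<le> 0" and s: "0 < real j + \<alpha> * real h"
  shows "(\<lambda>n. 1 / (real (n div m) ^ j * edge_prob \<alpha> n ^ h)) \<longlonglongrightarrow> 0"
proof (rule tendsto_sandwich[OF _ _ tendsto_const])
  let ?s = "real j + \<alpha> * real h"
  show "(\<lambda>n. (2 * real m) ^ j * real n powr (- ?s)) \<longlonglongrightarrow> 0"
    by (rule tendsto_mult_right_zero[OF tendsto_neg_powr[OF _ filterlim_real_sequentially]])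
      (use s in linarith)
  show "\<forall>\<^sub>F n in sequentially. 0 \<le> 1 / (real (n div m) ^ j * edge_prob \<alpha> n ^ h)"
    using edge_prob_bounds(1) by (intro always_eventually allI) simp
  show "\<forall>\<^sub>F n in sequentially. 1 / (real (n div m) ^ j * edge_prob \<alpha> n ^ h)
      \<le> (2 * real m) ^ j * real n powr (- ?s)"
    using eventually_ge_at_top[of "2 * m"]
  proof eventually_elim
    case (elim n)
    have n: "1 \<le> n" using elim m by linarith
    have "2 \<le> real n / real m" using elim m by (simp add: le_divide_eq flip: of_nat_mult)
    moreover have "real n / real m \<le> real (n div m) + 1"
      using floor_divide_of_nat_eq[of n m, where ?'a = real] by linarith
    moreover have "real n / (2 * real m) = (real n / real m) / 2" by simp
    ultimately have q: "real n / (2 * real m) \<le> real (n div m)" by linarith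
    have pos: "0 < (real n / (2 * real m)) ^ j * edge_prob \<alpha> n ^ h"
      using n m by (simp add: edge_prob_eq)
    have "1 / (real (n div m) ^ j * edge_prob \<alpha> n ^ h)
        \<le> 1 / ((real n / (2 * real m)) ^ j * edge_prob \<alpha> n ^ h)"
    proof (rule divide_left_mono)
      show le: "(real n / (2 * real m)) ^ j * edge_prob \<alpha> n ^ h \<le> real (n div m) ^ j * edge_prob \<alpha> n ^ h"
        using q by (intro mult_right_mono power_mono zero_le_power edge_prob_bounds) auto
      show "0 < real (n div m) ^ j * edge_prob \<alpha> n ^ h * ((real n / (2 * real m)) ^ j * edge_prob \<alpha> n ^ h)"
        by (rule mult_pos_pos[OF less_le_trans[OF pos le] pos])
    qed simp
    also have "\<dots> = (2 * real m) ^ j / (real n ^ j * edge_prob \<alpha> n ^ h)"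
      by (simp add: power_divide)
    also have "\<dots> = (2 * real m) ^ j * real n powr (- ?s)"
      unfolding power_edge_prob[OF \<alpha> n] powr_minus by (simp add: divide_inverse)
    finally show ?case .
  qed
qed

text \<open>Since \<alpha> \<le> 0, balancedness transfers \<open>dens\<close> to every nonempty
  \<open>W\<close>: with \<open>m\<close> vertices, \<open>e\<close> faces and \<open>h\<close>
  faces inside \<open>W\<close>, it gives \<open>m * (card W + \<alpha> * h) \<ge> card W * (m +
  \<alpha> * e) > 0\<close>.\<close>

lemma overlap_error_tendsto_0:
  assumes r: "1 \<le> r" and \<alpha>: "\<alpha> \<le> 0"
    and dens: "0 < real ((d + 1) * r) + \<alpha> * real (card (join_faces d r))"
  shows "(\<lambda>n. overlap_error d r (n div ((d + 1) * r)) (edge_prob \<alpha> n)) \<longlonglongrightarrow> 0"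
  unfolding overlap_error_def
proof (rule tendsto_null_sum)
  fix W assume "W \<in> Pow {..<(d + 1) * r} - {{}}"
  then have W: "W \<subseteq> {..<(d + 1) * r}" "W \<noteq> {}" by auto
  let ?m = "(d + 1) * r" and ?e = "card (join_faces d r)"
    and ?h = "card {S \<in> join_faces d r. S \<subseteq> W}"
  have m: "0 < ?m" using r by simp
  have "finite W" using W(1) finite_subset by blast
  then have cW: "0 < card W" using W(2) by (simp add: card_gt_0_iff)
  have "real ?h * real ?m \<le> real (card W) * real ?e"
    using join_faces_balanced[OF r W(1)] by (metis of_nat_le_iff of_nat_mult)
  then have "\<alpha> * (real (card W) * real ?e) \<le> \<alpha> * (real ?h * real ?m)"
    using \<alpha> by (rule mult_left_mono_neg)
  moreover have "0 < real (card W) * (real ?m + \<alpha> * real ?e)"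
    using cW dens by (intro mult_pos_pos) auto
  moreover have "real (card W) * (real ?m + \<alpha> * real ?e) =
      real (card W) * real ?m + \<alpha> * (real (card W) * real ?e)" by (simp only: algebra_simps)
  moreover have "real ?m * (real (card W) + \<alpha> * real ?h) =
      real (card W) * real ?m + \<alpha> * (real ?h * real ?m)" by (simp only: algebra_simps)
  ultimately have "0 < real ?m * (real (card W) + \<alpha> * real ?h)" by linarith
  then have "0 < real (card W) + \<alpha> * real ?h"
    using m by (metis of_nat_0_less_iff zero_less_mult_pos)
  then show "(\<lambda>n. 1 / (real (n div ?m) ^ card W * edge_prob \<alpha> n ^ ?h)) \<longlonglongrightarrow> 0"
    by (rule reciprocal_tendsto_0[OF m \<alpha>])
qed

text \<open>\<open>dens\<close> makes the relative variance of the number of copies tend to 0, and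
  \<open>ext\<close> makes \<open>n * p ^ ((d * r) choose d)\<close> tend to 0, so that a copy is
  rarely bad. Some copy is then good, and its sphere gives a non-bounding cycle.\<close>

lemma nontrivial_homology_join:
  assumes d: "1 \<le> d" and r: "1 \<le> r" and \<alpha>: "\<alpha> < 0"
    and dens: "0 < real ((d + 1) * r) + \<alpha> * real (card (join_faces d r))"
    and ext: "1 + \<alpha> * real ((d * r) choose d) < 0"
  shows "asymptotically_almost_surely (\<lambda>n. random_complex d n (edge_prob \<alpha> n))
    (\<lambda>K. \<not> trivial_group (reduced_simplicial_homology (d * r - 1) (clique_complex d K)))"
proof -
  let ?m = "(d + 1) * r" and ?e = "card (join_faces d r)" and ?b = "(d * r) choose d"
  define X where "X n = positions ?m (n div ?m)" for n
  define Bad where "Bad n = {K. \<forall>x\<in>X n. copy_faces d r (n div ?m) x \<subseteq> K \<longrightarrow>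
      K \<in> bad_copy n d r (n div ?m) x}" for n
  have m: "0 < ?m" using r by simp
  have fit: "?m * (n div ?m) \<le> n" for n by (rule times_div_less_eq_dividend)
  show ?thesis
  proof (rule asymptotically_almost_surelyI[where Bad = Bad])
    let ?err = "\<lambda>n. 4 * overlap_error d r (n div ?m) (edge_prob \<alpha> n) +
        2 * (real r * edge_prob \<alpha> n + real n * edge_prob \<alpha> n ^ ?b)"
    show "(\<lambda>n. measure_pmf.prob (random_complex d n (edge_prob \<alpha> n)) (Bad n)) \<longlonglongrightarrow> 0"
    proof (rule tendsto_sandwich[OF _ _ tendsto_const])
      have "(\<lambda>n. edge_prob \<alpha> n) \<longlonglongrightarrow> 0"
        using power_edge_prob_tendsto_0[of \<alpha> 0 1] \<alpha> by simp
      moreover have "(\<lambda>n. real n * edge_prob \<alpha> n ^ ?b) \<longlonglongrightarrow> 0"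
        using power_edge_prob_tendsto_0[of \<alpha> 1 ?b] \<alpha> ext by simp
      ultimately show "?err \<longlonglongrightarrow> 0"
        using overlap_error_tendsto_0[OF r _ dens] \<alpha>
        by (intro tendsto_add_zero tendsto_mult_right_zero) auto
      show "\<forall>\<^sub>F n in sequentially. measure_pmf.prob (random_complex d n (edge_prob \<alpha> n)) (Bad n) \<le> ?err n"
        using eventually_ge_at_top[of ?m]
      proof eventually_elim
        case (elim n)
        have q: "0 < n div ?m" using elim m by (simp only: div_greater_zero_iff)
        have n: "1 \<le> n" using elim m by linarith
        have p: "0 < edge_prob \<alpha> n" using n by (simp add: edge_prob_eq)
        have "X n \<noteq> {}" using q by (auto simp: X_def positions_def PiE_eq_empty_iff)
        moreover have "finite (X n)" by (simp add: X_def finite_positions)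
        ultimately have "measure_pmf.prob (random_complex d n (edge_prob \<alpha> n))
            {K. \<forall>x\<in>X n. K \<in> {K. copy_faces d r (n div ?m) x \<subseteq> K} \<longrightarrow> K \<in> bad_copy n d r (n div ?m) x}
          \<le> ?err n"
        proof (intro second_moment_bound[where a = "edge_prob \<alpha> n ^ ?e"])
          fix x assume "x \<in> X n"
          then have x: "x \<in> positions ?m (n div ?m)" by (simp add: X_def)
          show "measure_pmf.prob (random_complex d n (edge_prob \<alpha> n)) {K. copy_faces d r (n div ?m) x \<subseteq> K} =
              edge_prob \<alpha> n ^ ?e"
            using prob_faces_subset[OF edge_prob_bounds copy_faces_subset_ksets[OF x fit]]
            by (simp only: card_copy_faces[OF x])
          show "measure_pmf.prob (random_complex d n (edge_prob \<alpha> n)) (bad_copy n d r (n div ?m) x) \<le>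
              (real r * edge_prob \<alpha> n + real n * edge_prob \<alpha> n ^ ?b) * edge_prob \<alpha> n ^ ?e"
            by (rule prob_bad_copy_le[OF edge_prob_bounds x fit])
        next
          show "(\<Sum>x\<in>X n. \<Sum>y\<in>X n. measure_pmf.prob (random_complex d n (edge_prob \<alpha> n))
              ({K. copy_faces d r (n div ?m) x \<subseteq> K} \<inter> {K. copy_faces d r (n div ?m) y \<subseteq> K}))
            \<le> (1 + overlap_error d r (n div ?m) (edge_prob \<alpha> n)) * (card (X n) * edge_prob \<alpha> n ^ ?e)\<^sup>2"
            unfolding X_def by (rule sum_prob_copy_pairs_le[OF p edge_prob_bounds(2) q fit])
        qed (use p in simp_all)
        then show ?case by (simp only: Bad_def mem_Collect_eq)
      qed
    qed auto
    show "\<forall>\<^sub>F n in sequentially. \<forall>K\<in>set_pmf (random_complex d n (edge_prob \<alpha> n)).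
        K \<notin> Bad n \<longrightarrow> \<not> trivial_group (reduced_simplicial_homology (d * r - 1) (clique_complex d K))"
    proof (intro always_eventually allI ballI impI)
      fix n K assume K: "K \<in> set_pmf (random_complex d n (edge_prob \<alpha> n))" "K \<notin> Bad n"
      then obtain x where x: "x \<in> positions ?m (n div ?m)" "copy_faces d r (n div ?m) x \<subseteq> K"
        "K \<notin> bad_copy n d r (n div ?m) x"
        unfolding Bad_def X_def by blast
      have "\<not> acyclic_at (d * r) (clique_complex d K)"
        by (rule not_acyclic_at_good_copy[OF spans_skeleton_random_complex[OF d K(1)] x(1) fit x(2,3)])
      moreover have "Suc (d * r - 1) = d * r" using d r by simp
      ultimately show "\<not> trivial_group (reduced_simplicial_homology (d * r - 1) (clique_complex d K))"
        using trivial_homology_random_complex[OF d K(1), of "d * r - 1"] by simp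
    qed
  qed
qed

text \<open>The upper bound on \<open>\<alpha>\<close> rules out vertices extending a facet of a copy.\<close>

lemma join_density_le:
  assumes "1 \<le> d" "1 \<le> r"
  shows "real (card (join_faces d r)) / real ((d + 1) * r) + 1 \<le> real ((d * r) choose d)"
proof -
  let ?m = "(d + 1) * r" and ?e = "card (join_faces d r)" and ?b = "(d * r) choose d"
  \<comment> \<open>Regularity expresses \<open>(d + 1) * ?e\<close> as \<open>?m\<close> times the
    degree, and the layer bound on the degree carries another factor \<open>d + 1\<close>; the two
    cancel.\<close>
  have "(d + 1) * ?e \<le> ?m * ((d + 1) * (?b - 1))"
    unfolding card_join_faces_regular[OF assms(2)]
    by (rule mult_le_mono2[OF binomial_layers_le[OF assms(2)]])
  then have "Suc d * ?e \<le> Suc d * (?m * (?b - 1))"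
    by (simp only: Suc_eq_plus1 mult.left_commute)
  then have "?e \<le> ?m * (?b - 1)" by (rule Suc_mult_le_cancel1[THEN iffD1])
  then have "real ?e \<le> real ?m * real (?b - 1)" by (metis of_nat_le_iff of_nat_mult)
  moreover have m: "0 < real ?m"
    unfolding of_nat_0_less_iff using assms by (intro mult_pos_pos) auto
  ultimately have "real ?e / real ?m \<le> real (?b - 1)"
    by (simp only: pos_divide_le_eq mult.commute)
  moreover have "d \<le> d * r" using assms(2) by simp
  then have "1 \<le> ?b" by (simp add: Suc_le_eq)
  then have "real (?b - 1) = real ?b - 1" by (simp add: of_nat_diff)
  ultimately show ?thesis by linarith
qed

theorem theorem1p2:
  fixes d k :: nat and \<alpha> :: real
  assumes "d \<ge> 1" and "k \<ge> d"
  defines "p \<equiv> \<lambda>n::nat. min 1 (real n powr \<alpha>)"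
  shows "(\<alpha> < max (-1 / (real k - real d + 1)) (- (real d + 1) / real (k choose d)) \<or>
          \<alpha> > -1 / real ((2 * k + 2) choose d) \<longrightarrow>
            asymptotically_almost_surely (\<lambda>n. random_complex d n (p n))
              (\<lambda>X. trivial_group (reduced_simplicial_homology k (clique_complex d X))))
       \<and> (k \<ge> 1 \<longrightarrow>
          (let t = inverse ((real d + 1) * (real k + 1) /
                     (real (((d + 1) * (k + 1)) choose (d + 1)) - (real k + 1)))
           in -1 / t < \<alpha> \<and> \<alpha> < -1 / (t + 1) \<longrightarrow>
            asymptotically_almost_surely (\<lambda>n. random_complex d n (p n))
              (\<lambda>X. \<not> trivial_group
                 (reduced_simplicial_homology ((k + 1) * d - 1) (clique_complex d X)))))"
proof -
  have p: "p = edge_prob \<alpha>" by (simp add: p_def edge_prob_def fun_eq_iff)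
  have "asymptotically_almost_surely (\<lambda>n. random_complex d n (p n))
      (\<lambda>X. trivial_group (reduced_simplicial_homology k (clique_complex d X)))"
    if "\<alpha> < max (-1 / (real k - real d + 1)) (- (real d + 1) / real (k choose d)) \<or>
      \<alpha> > -1 / real ((2 * k + 2) choose d)"
    using that trivial_homology_sparse[OF assms(1,2)] trivial_homology_no_faces[OF assms(1,2)]
      trivial_homology_dense[OF assms(1,2)]
    unfolding p less_max_iff_disj by blast
  moreover have "let t = inverse ((real d + 1) * (real k + 1) /
                     (real (((d + 1) * (k + 1)) choose (d + 1)) - (real k + 1)))
           in -1 / t < \<alpha> \<and> \<alpha> < -1 / (t + 1) \<longrightarrow>
            asymptotically_almost_surely (\<lambda>n. random_complex d n (p n))
              (\<lambda>X. \<not> trivial_group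
                 (reduced_simplicial_homology ((k + 1) * d - 1) (clique_complex d X)))"
  proof -
    let ?r = "k + 1" and ?e = "real (card (join_faces d (k + 1)))" and ?m = "real ((d + 1) * (k + 1))"
    \<comment> \<open>Faces per vertex of the join: removing the \<open>k + 1\<close> blocks from
      all \<open>(d + 1)\<close>-sets explains the subtraction in the stated formula.\<close>
    define t where "t = ?e / ?m"
    have "real (card (join_faces d ?r) + ?r) = real (((d + 1) * ?r) choose (d + 1))"
      by (simp only: card_join_faces)
    then have "real (((d + 1) * ?r) choose (d + 1)) - (real k + 1) = ?e"
      by (simp only: of_nat_add of_nat_1 add_diff_cancel_right')
    then have t: "inverse ((real d + 1) * (real k + 1) /
        (real (((d + 1) * (k + 1)) choose (d + 1)) - (real k + 1))) = t"
      by (simp only: t_def inverse_divide of_nat_mult of_nat_add of_nat_1)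
    have m: "0 < ?m" unfolding of_nat_0_less_iff by (intro mult_pos_pos) auto
    have t0: "0 \<le> t" by (simp add: t_def)
    have "asymptotically_almost_surely (\<lambda>n. random_complex d n (p n))
        (\<lambda>X. \<not> trivial_group (reduced_simplicial_homology ((k + 1) * d - 1) (clique_complex d X)))"
      if \<alpha>: "- 1 / t < \<alpha>" "\<alpha> < - 1 / (t + 1)"
    proof -
      have t1: "0 < t + 1" using t0 by simp
      have "\<alpha> * (t + 1) < - 1" using \<alpha>(2) t1 by (simp only: pos_less_divide_eq)
      then have neg: "\<alpha> < 0" using t1 by (smt (verit) mult_nonneg_nonneg)
      \<comment> \<open>For \<open>t = 0\<close> the convention for division by zero would turn the
        lower bound into \<open>0 < \<alpha>\<close>, contradicting \<open>neg\<close>.\<close>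
      have "t \<noteq> 0" using \<alpha>(1) neg by auto
      then have "0 < t" using t0 by simp
      then have "- 1 < \<alpha> * t" using \<alpha>(1) by (simp only: pos_divide_less_eq)
      then have "- 1 < \<alpha> * ?e / ?m" by (simp only: t_def times_divide_eq_right)
      then have "- 1 * ?m < \<alpha> * ?e" by (simp only: pos_less_divide_eq[OF m])
      then have "0 < ?m + \<alpha> * ?e" by linarith
      moreover have "1 + \<alpha> * real ((d * ?r) choose d) < 0"
      proof -
        have "t + 1 \<le> real ((d * ?r) choose d)"
          using join_density_le[OF assms(1), of ?r] by (simp only: t_def le_add2)
        then have "\<alpha> * real ((d * ?r) choose d) \<le> \<alpha> * (t + 1)"
          using neg by (intro mult_left_mono_neg) auto
        then show ?thesis using \<open>\<alpha> * (t + 1) < - 1\<close> by linarith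
      qed
      ultimately show ?thesis
        using nontrivial_homology_join[OF assms(1) _ neg, of ?r] unfolding p
        by (simp only: mult.commute[of "k + 1" d] le_add2)
    qed
    then show ?thesis unfolding t by (simp only: Let_def) blast
  qed
  ultimately show ?thesis by blast
qed

end
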